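(* Let $u\in W^{2,2}(\mathbb{R}^n)$, $n\ge 3$, be a solution of the differential inequality $|\Delta u(x)|\le |V(x)u(x)|$, whose support is contained in a ball $B(a,r)$. If $\mathbf{1}_{B(a,r)}V\in\mathcal{KS}_n$, then there exists $r_0>0$ such that for all $r<r_0$ $$\|\mathbf{1}_{B(a,r)}V\|_{\mathcal{KS}_n}\ge C>0$$ with a constant $C$ independent of $r$.
   Context: $V$ is a potential function on $\mathbb{R}^n$, $n\ge 3$. $W^{m,p}(\mathbb{R}^n)$ denotes the Sobolev space of functions whose derivatives up to order $m$ belong to $L^p(\mathbb{R}^n)$. $B(x,r)$ is the ball of radius $r>0$ centered at $x\in\mathbb{R}^n$, and $\mathbf{1}_A$ is the characteristic function of a set $A\subset\mathbb{R}^n$. The Kerman-Sawyer norm of $V$ is $$\|V\|_{\mathcal{KS}_n}=\sup_{Q}\bigg(\int_Q|V(x)|\,dx\bigg)^{-1}\int_Q\int_Q\frac{|V(x)V(y)|}{|x-y|^{n-2}}\,dx\,dy,$$ where the supremum is taken over all dyadic cubes $Q$ in $\mathbb{R}^n$; $V$ is in the Kerman-Sawyer class $\mathcal{KS}_n$ if this quantity is finite.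
   Formalization: The solution u is assumed not to vanish almost everywhere, since u = 0 with V = 0 satisfies every hypothesis while the Kerman-Sawyer norm is 0. *)

theory Defs
  imports "HOL-Analysis.Analysis"
begin

section \<open>Test functions and weak derivatives\<close>

definition partial_deriv :: "'n::finite \<Rightarrow> (real^'n \<Rightarrow> real) \<Rightarrow> real^'n \<Rightarrow> real" where
  "partial_deriv i f x = frechet_derivative f (at x) (axis i 1)"

text \<open>A partial derivative of order \<open>m\<close> is indexed by the list of length \<open>m\<close> of the
  directions of differentiation, rather than by a multi-index.\<close>

definition iter_partial :: "'n::finite list \<Rightarrow> (real^'n \<Rightarrow> real) \<Rightarrow> real^'n \<Rightarrow> real" where
  "iter_partial is f = foldr partial_deriv is f"

definition smooth :: "(real^'n::finite \<Rightarrow> real) \<Rightarrow> bool" where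
  "smooth f \<longleftrightarrow> (\<forall>is. iter_partial is f differentiable_on UNIV)"

definition test_functions :: "(real^'n::finite \<Rightarrow> real) set" where
  "test_functions = {\<phi>. smooth \<phi> \<and> compact (closure {x. \<phi> x \<noteq> 0})}"

definition locally_integrable :: "(real^'n::finite \<Rightarrow> complex) \<Rightarrow> bool" where
  "locally_integrable f \<longleftrightarrow> (\<forall>K. compact K \<longrightarrow> set_integrable lebesgue K f)"

text \<open>Real-valued test functions suffice for complex-valued \<open>u\<close>, since the identity below is
  linear in \<open>\<phi>\<close>.\<close>

definition is_weak_deriv ::
    "'n::finite list \<Rightarrow> (real^'n \<Rightarrow> complex) \<Rightarrow> (real^'n \<Rightarrow> complex) \<Rightarrow> bool" where
  "is_weak_deriv is u g \<longleftrightarrow> locally_integrable u \<and> locally_integrable g \<and>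
     (\<forall>\<phi>\<in>test_functions.
        (LINT x|lebesgue. iter_partial is \<phi> x *\<^sub>R u x) =
        (-1) ^ length is * (LINT x|lebesgue. \<phi> x *\<^sub>R g x))"

text \<open>Weak derivatives are unique up to null sets, so the choice below is immaterial in
  almost-everywhere statements.\<close>

definition weak_deriv :: "'n::finite list \<Rightarrow> (real^'n \<Rightarrow> complex) \<Rightarrow> real^'n \<Rightarrow> complex" where
  "weak_deriv is u = (SOME g. is_weak_deriv is u g)"

definition laplacian :: "(real^'n::finite \<Rightarrow> complex) \<Rightarrow> real^'n \<Rightarrow> complex" where
  "laplacian u x = (\<Sum>i\<in>UNIV. weak_deriv [i, i] u x)"

section \<open>Sobolev spaces and supports\<close>

definition Lp_space :: "real \<Rightarrow> (real^'n::finite \<Rightarrow> complex) set" where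
  "Lp_space p = {f \<in> borel_measurable lebesgue. integrable lebesgue (\<lambda>x. norm (f x) powr p)}"

text \<open>The empty list accounts for \<open>u\<close> itself, which is its own derivative of order 0.\<close>

definition sobolev :: "nat \<Rightarrow> real \<Rightarrow> (real^'n::finite \<Rightarrow> complex) set" where
  "sobolev m p =
     {u \<in> Lp_space p. \<forall>is. length is \<le> m \<longrightarrow> (\<exists>g\<in>Lp_space p. is_weak_deriv is u g)}"

text \<open>The support of an almost-everywhere class of functions: the complement of the largest open
  set on which \<open>u\<close> vanishes almost everywhere.\<close>

definition ess_support :: "(real^'n::finite \<Rightarrow> complex) \<Rightarrow> (real^'n) set" where
  "ess_support u =
     - \<Union>{U. open U \<and> (AE x in lebesgue. x \<in> U \<longrightarrow> u x = 0)}"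

section \<open>The Kerman-Sawyer class\<close>

definition dyadic_cubes :: "(real^'n::finite) set set" where
  "dyadic_cubes =
     {Q. \<exists>(k::int) (m::int^'n).
        Q = {x. \<forall>i. 2 powi k * of_int (m $ i) \<le> x $ i \<and> x $ i < 2 powi k * (of_int (m $ i) + 1)}}"

definition ks_mass :: "(real^'n::finite \<Rightarrow> complex) \<Rightarrow> (real^'n) set \<Rightarrow> ennreal" where
  "ks_mass V Q = (\<integral>\<^sup>+x\<in>Q. ennreal (norm (V x)) \<partial>lebesgue)"

text \<open>On the diagonal the kernel below takes the value 0; each slice of the diagonal is a null
  set.\<close>

definition ks_energy :: "(real^'n::finite \<Rightarrow> complex) \<Rightarrow> (real^'n) set \<Rightarrow> ennreal" where
  "ks_energy V Q =
     (\<integral>\<^sup>+x\<in>Q. (\<integral>\<^sup>+y\<in>Q.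
        ennreal (norm (V x * V y) / norm (x - y) ^ (CARD('n) - 2)) \<partial>lebesgue) \<partial>lebesgue)"

text \<open>A cube on which \<open>V\<close> vanishes almost everywhere contributes \<open>inverse 0 * 0 = 0\<close> in
  \<open>ennreal\<close>. A cube on which \<open>V\<close> is not integrable has infinite energy and must contribute
  \<open>\<infinity>\<close>, whereas \<open>inverse \<infinity> * \<infinity> = 0\<close> in \<open>ennreal\<close>; hence the case distinction.\<close>

definition ks_norm :: "(real^'n::finite \<Rightarrow> complex) \<Rightarrow> ennreal" where
  "ks_norm V =
     (SUP Q\<in>dyadic_cubes.
        if ks_mass V Q = \<infinity> then \<infinity> else inverse (ks_mass V Q) * ks_energy V Q)"

definition KS_class :: "(real^'n::finite \<Rightarrow> complex) set" where
  "KS_class = {V \<in> borel_measurable lebesgue. ks_norm V < \<infinity>}"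

definition restrict_fun :: "(real^'n::finite) set \<Rightarrow> (real^'n \<Rightarrow> complex) \<Rightarrow> real^'n \<Rightarrow> complex" where
  "restrict_fun A V x = indicator A x * V x"

end

theory Submission
  imports Defs "HOL-Real_Asymp.Real_Asymp"
begin

text \<open>Put \<open>g = |\<Delta>u|\<close>, \<open>k(x, y) = |x - y|\<^sup>2\<^sup>-\<^sup>n\<close> and \<open>X = \<integral>g|u|\<close>. Testing the weak Laplacian against a
  truncated, regularised Newton kernel gives \<open>|u| \<le> c \<integral>k(\<cdot>, y) g(y) dy\<close> almost everywhere, so
  \<open>X \<le> c \<integral>\<integral>k g g\<close>. For \<open>|x - y| < 1\<close> the kernel \<open>k\<close> is dominated by the sum over \<open>j \<ge> 0\<close> of
  \<open>2\<^sup>j\<^sup>(\<^sup>n\<^sup>-\<^sup>2\<^sup>)\<close> times the indicator that \<open>x\<close> and \<open>y\<close> lie in equal or adjacent cubes of side \<open>2\<^sup>-\<^sup>j\<close>,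
  whence \<open>\<integral>\<integral>k g g \<le> c \<Sum>\<^sub>Q \<ell>(Q)\<^sup>2\<^sup>-\<^sup>n (\<integral>\<^sub>Q g)\<^sup>2\<close>. Conversely the energy of \<open>V\<close> on a cube dominates the
  corresponding sum over its dyadic subcubes with \<open>|V|\<close> in place of \<open>g\<close>, so that a bound on the
  Kerman-Sawyer norm is a Carleson condition. Since \<open>g \<le> |V u|\<close> gives
  \<open>(\<integral>\<^sub>Q g)\<^sup>2 \<le> \<integral>\<^sub>Q |V| \<cdot> \<integral>\<^sub>Q g|u|\<close>, the Carleson embedding theorem yields \<open>X \<le> C \<parallel>V\<parallel> X\<close>. As \<open>X\<close> is
  finite, either the norm is at least \<open>1/C\<close> or \<open>X = 0\<close>, and then \<open>g\<close> and hence \<open>u\<close> vanish.\<close>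

section \<open>Smooth functions and the regularised Newton kernel\<close>

text \<open>Weak derivatives are tested only against smooth compactly supported functions, so the
  Newton kernel cannot be inserted directly. Replacing |z|^2 by |z|^2 + e^2 makes it smooth, and its
  Laplacian is then a constant times an explicit positive bump whose mass is bounded below uniformly
  in e. An upper bound for |u| is all that is wanted, so the bump is never normalised and no
  representation formula for u is proved. The two sides of the kernel comparison do not match: the
  upper bound needs pairs of adjacent cubes, while the Kerman-Sawyer norm sees one cube at a time.
  Products over adjacent cubes are absorbed into squares, at the price of the number of neighbours.
  The restriction r < 1/2 keeps any two points of the ball closer than 1, so cubes of side at most 1
  suffice and the constants depend on n alone. X is finite because Laplacian and function are both
  square integrable, and only this makes the final absorption legitimate. Tree sums are cut at a
  finite depth with bounds independent of it, which keeps them real and lets the Carleson estimate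
  go by induction.\<close>

definition flat_exp :: "nat \<Rightarrow> real \<Rightarrow> real" where
  "flat_exp m t = (if t > 0 then inverse t ^ m * exp (- inverse t) else 0)"

lemma flat_exp_nonneg: "flat_exp m t \<ge> 0"
  by (simp add: flat_exp_def)

lemma flat_exp_tendsto_0: "(flat_exp m \<longlongrightarrow> 0) (at 0)"
proof -
  have "((\<lambda>s::real. s ^ m / exp s) \<longlongrightarrow> 0) at_top"
    by (rule tendsto_power_div_exp_0)
  then have "((\<lambda>t::real. inverse t ^ m / exp (inverse t)) \<longlongrightarrow> 0) (at_right 0)"
    by (rule filterlim_compose) (rule filterlim_inverse_at_top_right)
  then have "(flat_exp m \<longlongrightarrow> 0) (at_right 0)"
    by (rule Lim_transform_eventually)
       (simp add: flat_exp_def eventually_at_filter exp_minus divide_inverse)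
  moreover have "(flat_exp m \<longlongrightarrow> 0) (at_left 0)"
    by (rule Lim_transform_eventually[where f="\<lambda>_. 0"])
       (auto simp: flat_exp_def eventually_at_filter)
  ultimately show ?thesis
    by (simp add: filterlim_split_at)
qed

text \<open>Differentiating t^(-m) exp(-1/t) produces functions of the same kind with larger m, so
  one family indexed by m carries all derivatives of the standard flat function
  \<open>flat_exp 0\<close>.\<close>

lemma flat_exp_has_derivative:
  "(flat_exp m has_real_derivative (flat_exp (m + 2) t - real m * flat_exp (m + 1) t)) (at t)"
proof (cases t "0::real" rule: linorder_cases)
  case less
  have "((\<lambda>_. 0) has_real_derivative 0) (at t)" by simp
  then have "(flat_exp m has_real_derivative 0) (at t)"
    by (rule has_field_derivative_transform_within_open[where S="{..<0}"])
       (use less in \<open>auto simp: flat_exp_def\<close>)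
  then show ?thesis using less by (simp add: flat_exp_def)
next
  case equal
  \<comment> \<open>At the origin the difference quotient of \<open>flat_exp m\<close> is exactly
    \<open>flat_exp (Suc m)\<close>, on both sides of 0.\<close>
  have "((\<lambda>h. flat_exp (Suc m) h) \<longlongrightarrow> 0) (at 0)" by (rule flat_exp_tendsto_0)
  then have "((\<lambda>h. (flat_exp m h - flat_exp m 0) / h) \<longlongrightarrow> 0) (at 0)"
    by (rule Lim_transform_eventually)
       (auto simp: flat_exp_def eventually_at_filter divide_inverse)
  then show ?thesis
    using equal by (simp add: DERIV_def has_field_derivative_iff flat_exp_def)
next
  case greater
  have "((\<lambda>t. inverse t ^ m * exp (- inverse t)) has_real_derivative
      (flat_exp (m + 2) t - real m * flat_exp (m + 1) t)) (at t)"
  proof -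
    have "((\<lambda>s. s ^ m * exp (- s)) has_real_derivative
        (real m * inverse t ^ (m - 1) * exp (- inverse t) - inverse t ^ m * exp (- inverse t))) (at (inverse t))"
      by (auto intro!: derivative_eq_intros)
    moreover have "(inverse has_real_derivative - (inverse t * inverse t)) (at t)"
      using greater by (auto intro!: derivative_eq_intros)
    ultimately have "((\<lambda>t. inverse t ^ m * exp (- inverse t)) has_real_derivative
        (real m * inverse t ^ (m - 1) * exp (- inverse t) - inverse t ^ m * exp (- inverse t)) *
        - (inverse t * inverse t)) (at t)"
      by (rule DERIV_chain2)
    also have "(real m * inverse t ^ (m - 1) * exp (- inverse t) - inverse t ^ m * exp (- inverse t)) *
        - (inverse t * inverse t) = flat_exp (m + 2) t - real m * flat_exp (m + 1) t"
      using greater by (cases m) (simp_all add: flat_exp_def algebra_simps)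
    finally show ?thesis .
  qed
  then show ?thesis
    by (rule has_field_derivative_transform_within_open[where S="{0<..}"])
       (use greater in \<open>auto simp: flat_exp_def\<close>)
qed

text \<open>An algebra of smooth functions that is closed under partial derivatives by construction, so
  that membership yields smoothness, and that contains the cutoffs and kernels used as test
  functions.\<close>

inductive_set smooth_algebra :: "(real^'n::finite \<Rightarrow> real) set" where
  const: "(\<lambda>_. c) \<in> smooth_algebra"
| coord: "(\<lambda>x. x $ i) \<in> smooth_algebra"
| add: "f \<in> smooth_algebra \<Longrightarrow> g \<in> smooth_algebra \<Longrightarrow> (\<lambda>x. f x + g x) \<in> smooth_algebra"
| mult: "f \<in> smooth_algebra \<Longrightarrow> g \<in> smooth_algebra \<Longrightarrow> (\<lambda>x. f x * g x) \<in> smooth_algebra"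
| flat: "f \<in> smooth_algebra \<Longrightarrow> (\<lambda>x. flat_exp m (f x)) \<in> smooth_algebra"
| powr: "f \<in> smooth_algebra \<Longrightarrow> (\<And>x. f x > 0) \<Longrightarrow> (\<lambda>x. f x powr c) \<in> smooth_algebra"

section \<open>Calculus of partial derivatives on the algebra\<close>

lemma has_derivative_partial_deriv:
  assumes "(f has_derivative f') (at x)"
  shows "partial_deriv i f x = f' (axis i 1)"
  using assms frechet_derivative_at[OF assms] by (simp add: partial_deriv_def)

lemma smooth_algebra_diff: "f \<in> smooth_algebra \<Longrightarrow> g \<in> smooth_algebra \<Longrightarrow> (\<lambda>x. f x - g x) \<in> smooth_algebra"
  using smooth_algebra.add[OF _ smooth_algebra.mult[OF smooth_algebra.const[of "-1"], of g], of f] by simp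

lemma smooth_algebra_sum:
  "finite A \<Longrightarrow> (\<And>i. i \<in> A \<Longrightarrow> f i \<in> smooth_algebra) \<Longrightarrow> (\<lambda>x. \<Sum>i\<in>A. f i x) \<in> smooth_algebra"
  by (induction A rule: finite_induct) (auto intro: smooth_algebra.intros)

lemma partial_deriv_add:
  assumes "f differentiable at x" "g differentiable at x"
  shows "partial_deriv i (\<lambda>x. f x + g x) x = partial_deriv i f x + partial_deriv i g x"
  using has_derivative_partial_deriv[OF has_derivative_add[OF assms[unfolded frechet_derivative_works]]]
  by (simp add: partial_deriv_def)

lemma partial_deriv_diff:
  assumes "f differentiable at x" "g differentiable at x"
  shows "partial_deriv i (\<lambda>x. f x - g x) x = partial_deriv i f x - partial_deriv i g x"
  using has_derivative_partial_deriv[OF has_derivative_diff[OF assms[unfolded frechet_derivative_works]]]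
  by (simp add: partial_deriv_def)

lemma partial_deriv_mult:
  assumes "f differentiable at x" "g differentiable at x"
  shows "partial_deriv i (\<lambda>x. f x * g x) x = f x * partial_deriv i g x + partial_deriv i f x * g x"
  using has_derivative_partial_deriv[OF has_derivative_mult[OF assms[unfolded frechet_derivative_works]]]
  by (simp add: partial_deriv_def)

lemma partial_deriv_chain:
  assumes "f differentiable at x" "(h has_real_derivative h') (at (f x))"
  shows "(\<lambda>x. h (f x)) differentiable at x"
        "partial_deriv i (\<lambda>x. h (f x)) x = h' * partial_deriv i f x"
proof -
  have *: "((\<lambda>x. h (f x)) has_derivative (\<lambda>v. h' * frechet_derivative f (at x) v)) (at x)"
    using has_derivative_compose[OF assms(1)[unfolded frechet_derivative_works] assms(2)[unfolded has_field_derivative_def]] .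
  show "(\<lambda>x. h (f x)) differentiable at x" using * by (rule differentiableI)
  show "partial_deriv i (\<lambda>x. h (f x)) x = h' * partial_deriv i f x"
    using has_derivative_partial_deriv[OF *] by (simp add: partial_deriv_def)
qed

lemma partial_deriv_coord: "partial_deriv i (\<lambda>x. x $ j) x = (if i = j then 1 else 0)"
  by (subst has_derivative_partial_deriv[OF bounded_linear.has_derivative[OF bounded_linear_vec_nth has_derivative_ident]])
     (auto simp: axis_def)

lemma partial_deriv_const: "partial_deriv i (\<lambda>x. c) x = 0"
  by (subst has_derivative_partial_deriv[OF has_derivative_const]) simp

lemma smooth_algebra_differentiable:
  "f \<in> smooth_algebra \<Longrightarrow> f differentiable at x"
proof (induction rule: smooth_algebra.induct)
  case (coord i)
  show ?case by (rule bounded_linear_imp_differentiable) (rule bounded_linear_vec_nth)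
next
  case (flat f m)
  show ?case by (rule partial_deriv_chain(1)[OF flat.IH flat_exp_has_derivative])
next
  case (powr f c)
  show ?case
    by (rule partial_deriv_chain(1)[OF powr.IH has_real_derivative_powr[OF powr.hyps(2)]])
qed (auto intro: differentiable_add differentiable_mult)

lemma partial_deriv_coord_diff: "partial_deriv i (\<lambda>x. x $ i - c) x = 1"
  by (subst partial_deriv_diff)
     (auto intro!: smooth_algebra_differentiable smooth_algebra.intros simp: partial_deriv_const partial_deriv_coord)

lemma smooth_algebra_partial_deriv:
  "f \<in> smooth_algebra \<Longrightarrow> partial_deriv i f \<in> smooth_algebra"
proof (induction rule: smooth_algebra.induct)
  case (const c)
  show ?case using smooth_algebra.const[of 0] by (simp add: partial_deriv_const[abs_def])
next
  case (coord j)
  show ?case using smooth_algebra.const[of "if i = j then 1 else 0"]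
    by (simp add: partial_deriv_coord[abs_def])
next
  case (add f g)
  then have "partial_deriv i (\<lambda>x. f x + g x) = (\<lambda>x. partial_deriv i f x + partial_deriv i g x)"
    by (intro ext partial_deriv_add smooth_algebra_differentiable)
  then show ?case using add by (simp add: smooth_algebra.add)
next
  case (mult f g)
  then have "partial_deriv i (\<lambda>x. f x * g x) = (\<lambda>x. f x * partial_deriv i g x + partial_deriv i f x * g x)"
    by (intro ext partial_deriv_mult smooth_algebra_differentiable)
  then show ?case using mult by (auto intro!: smooth_algebra.intros)
next
  case (flat f m)
  then have "partial_deriv i (\<lambda>x. flat_exp m (f x)) =
      (\<lambda>x. (flat_exp (m + 2) (f x) - real m * flat_exp (m + 1) (f x)) * partial_deriv i f x)"
    by (intro ext partial_deriv_chain(2)[OF smooth_algebra_differentiable flat_exp_has_derivative])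
  then show ?case using flat by (auto intro!: smooth_algebra.intros smooth_algebra_diff)
next
  case (powr f c)
  then have "partial_deriv i (\<lambda>x. f x powr c) = (\<lambda>x. (c * f x powr (c - 1)) * partial_deriv i f x)"
    by (intro ext partial_deriv_chain(2)[OF smooth_algebra_differentiable has_real_derivative_powr])
  then show ?case using powr by (auto intro!: smooth_algebra.intros)
qed

lemma smooth_algebra_iter_partial:
  "f \<in> smooth_algebra \<Longrightarrow> iter_partial is f \<in> smooth_algebra"
  by (induction "is") (auto simp: iter_partial_def smooth_algebra_partial_deriv)

lemma smooth_algebra_smooth: "f \<in> smooth_algebra \<Longrightarrow> smooth f"
  unfolding smooth_def
  by (intro allI differentiable_at_imp_differentiable_on smooth_algebra_differentiable smooth_algebra_iter_partial)

lemma smooth_algebra_continuous: "f \<in> smooth_algebra \<Longrightarrow> continuous_on A f"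
  by (intro differentiable_imp_continuous_on differentiable_at_imp_differentiable_on smooth_algebra_differentiable)

lemma norm_sq_eq_sum: "(norm (x::real^'n::finite))\<^sup>2 = (\<Sum>i\<in>UNIV. (x $ i)\<^sup>2)"
  by (simp add: norm_vec_def L2_set_def real_sqrt_pow2 sum_nonneg)

lemma smooth_algebra_norm_sq: "(\<lambda>x. (norm (x - a))\<^sup>2) \<in> smooth_algebra"
proof -
  have "(\<lambda>x. \<Sum>i\<in>UNIV. (x $ i - a $ i) * (x $ i - a $ i)) \<in> smooth_algebra"
    by (rule smooth_algebra_sum) (auto intro!: smooth_algebra.intros smooth_algebra_diff)
  then show ?thesis unfolding norm_sq_eq_sum by (simp add: power2_eq_square)
qed

text \<open>The usual smooth step p / (p + q), with p vanishing off the ball of radius 2 r and q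
  vanishing on the ball of radius r. The quotient is written with \<open>powr (-1)\<close> so that
  membership in \<open>smooth_algebra\<close> is immediate.\<close>

definition cutoff :: "real^'n::finite \<Rightarrow> real \<Rightarrow> real^'n \<Rightarrow> real" where
  "cutoff a r x =
     flat_exp 0 (4 * r\<^sup>2 - (norm (x - a))\<^sup>2) *
     (flat_exp 0 (4 * r\<^sup>2 - (norm (x - a))\<^sup>2) + flat_exp 0 ((norm (x - a))\<^sup>2 - r\<^sup>2)) powr (-1)"

lemma cutoff_denominator_pos:
  assumes "r > 0"
  shows "flat_exp 0 (4 * r\<^sup>2 - (norm (x - a))\<^sup>2) + flat_exp 0 ((norm (x - a))\<^sup>2 - r\<^sup>2) > 0"
proof -
  have "4 * r\<^sup>2 - (norm (x - a))\<^sup>2 > 0 \<or> (norm (x - a))\<^sup>2 - r\<^sup>2 > 0"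
    using zero_less_power[OF assms, of 2] by linarith
  then show ?thesis
    using flat_exp_nonneg[of 0 "4 * r\<^sup>2 - (norm (x - a))\<^sup>2"] flat_exp_nonneg[of 0 "(norm (x - a))\<^sup>2 - r\<^sup>2"]
    by (auto simp: flat_exp_def add_pos_nonneg add_nonneg_pos)
qed

lemma cutoff_smooth: "r > 0 \<Longrightarrow> cutoff a r \<in> smooth_algebra"
  unfolding cutoff_def[abs_def]
  by (intro smooth_algebra.mult smooth_algebra.powr smooth_algebra.flat smooth_algebra.add smooth_algebra_diff
      smooth_algebra_norm_sq smooth_algebra.const cutoff_denominator_pos)

lemma cutoff_range:
  assumes "r > 0"
  shows "0 \<le> cutoff a r x" "cutoff a r x \<le> 1"
proof -
  have "0 \<le> p * (p + q) powr (-1) \<and> p * (p + q) powr (-1) \<le> 1"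
    if "0 \<le> p" "0 \<le> q" "0 < p + q" for p q :: real
    using that by (simp add: powr_minus_divide)
  from this[OF flat_exp_nonneg flat_exp_nonneg cutoff_denominator_pos[OF assms, of x a]]
  show "0 \<le> cutoff a r x" "cutoff a r x \<le> 1" unfolding cutoff_def by blast+
qed

lemma cutoff_eq_1: "r > 0 \<Longrightarrow> x \<in> cball a r \<Longrightarrow> cutoff a r x = 1"
proof -
  assume r: "r > 0" and x: "x \<in> cball a r"
  then have "(norm (x - a))\<^sup>2 \<le> r\<^sup>2"
    by (auto simp: dist_norm norm_minus_commute)
  then have "flat_exp 0 ((norm (x - a))\<^sup>2 - r\<^sup>2) = 0"
    by (simp add: flat_exp_def)
  then show ?thesis
    using cutoff_denominator_pos[OF r, of x a] by (simp add: cutoff_def powr_minus_divide)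
qed

lemma cutoff_eq_0: "r > 0 \<Longrightarrow> x \<notin> cball a (2 * r) \<Longrightarrow> cutoff a r x = 0"
proof -
  assume r: "r > 0" and x: "x \<notin> cball a (2 * r)"
  then have "(2 * r)\<^sup>2 < (norm (x - a))\<^sup>2"
    by (intro power_strict_mono) (auto simp: dist_norm norm_minus_commute)
  then show ?thesis
    by (simp add: cutoff_def flat_exp_def power_mult_distrib)
qed

lemma cutoff_mult_test_function:
  assumes "r > 0" "f \<in> smooth_algebra"
  shows "(\<lambda>x. cutoff a r x * f x) \<in> test_functions"
proof -
  have "closure {x. cutoff a r x * f x \<noteq> 0} \<subseteq> cball a (2 * r)"
    by (rule closure_minimal) (use cutoff_eq_0[OF assms(1), of _ a] in \<open>force+\<close>)
  then have "compact (closure {x. cutoff a r x * f x \<noteq> 0})"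
    by (simp add: compact_eq_bounded_closed bounded_subset[OF bounded_cball])
  then show ?thesis
    using assms by (auto simp: test_functions_def intro!: smooth_algebra_smooth smooth_algebra.mult cutoff_smooth)
qed

lemma partial_deriv_cong_open:
  assumes "open S" "x \<in> S" "\<And>y. y \<in> S \<Longrightarrow> f y = g y"
  shows "partial_deriv i f x = partial_deriv i g x"
proof -
  have "(f has_derivative D) (at x) = (g has_derivative D) (at x)" for D
    using assms has_derivative_transform_within_open[of f D x UNIV S g]
      has_derivative_transform_within_open[of g D x UNIV S f] by auto
  then show ?thesis by (simp add: partial_deriv_def frechet_derivative_def)
qed

text \<open>Serves to drop the cutoff from derivatives inside the ball on which it equals 1.\<close>

lemma iter_partial_cong_open:
  assumes "open S" "\<And>y. y \<in> S \<Longrightarrow> f y = g y"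
  shows "x \<in> S \<Longrightarrow> iter_partial is f x = iter_partial is g x"
  using assms
proof (induction "is" arbitrary: x)
  case (Cons i "is")
  then show ?case
    using partial_deriv_cong_open[OF \<open>open S\<close>, of x "iter_partial is f" "iter_partial is g" i]
    by (simp add: iter_partial_def)
qed (simp add: iter_partial_def)

text \<open>Up to the factor \<open>- n (n - 2)\<close> the mollifier is the Laplacian of the regularised Newton
  kernel. It is not normalised.\<close>

definition mollifier :: "real \<Rightarrow> real^'n::finite \<Rightarrow> real" where
  "mollifier e z = e\<^sup>2 * ((norm z)\<^sup>2 + e\<^sup>2) powr (- (real CARD('n) + 2) / 2)"

definition newton_reg :: "real \<Rightarrow> real^'n::finite \<Rightarrow> real" where
  "newton_reg e z = ((norm z)\<^sup>2 + e\<^sup>2) powr (- (real CARD('n) - 2) / 2)"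

lemma norm_sq_plus_pos: "e > 0 \<Longrightarrow> (norm z)\<^sup>2 + e\<^sup>2 > (0::real)"
  by (simp add: add_nonneg_pos)

lemma norm_sq_plus_smooth: "(\<lambda>y. (norm (y - x))\<^sup>2 + e\<^sup>2) \<in> smooth_algebra"
  by (intro smooth_algebra.add smooth_algebra_norm_sq smooth_algebra.const)

lemma newton_reg_smooth: "e > 0 \<Longrightarrow> (\<lambda>y. newton_reg e (y - x)) \<in> smooth_algebra"
  unfolding newton_reg_def by (intro smooth_algebra.powr norm_sq_plus_smooth norm_sq_plus_pos)

lemma mollifier_smooth: "e > 0 \<Longrightarrow> (\<lambda>y. mollifier e (y - x)) \<in> smooth_algebra"
  unfolding mollifier_def
  by (intro smooth_algebra.powr smooth_algebra.mult smooth_algebra.const norm_sq_plus_smooth norm_sq_plus_pos)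

lemma partial_deriv_norm_sq:
  "partial_deriv i (\<lambda>y. (norm (y - x))\<^sup>2 + c) y = 2 * (y $ i - x $ i)"
proof -
  have "((\<lambda>y. (norm (y - x))\<^sup>2 + c) has_derivative (\<lambda>v. 2 * ((y - x) \<bullet> v))) (at y)"
    unfolding power2_norm_eq_inner
    by (auto intro!: derivative_eq_intros simp: inner_commute)
  from has_derivative_partial_deriv[OF this] show ?thesis
    by (simp add: inner_axis)
qed

lemma partial_deriv_powr_norm_sq:
  assumes "e > 0"
  shows "partial_deriv i (\<lambda>y. ((norm (y - x))\<^sup>2 + e\<^sup>2) powr s) y =
         2 * s * ((norm (y - x))\<^sup>2 + e\<^sup>2) powr (s - 1) * (y $ i - x $ i)"
  using partial_deriv_chain(2)[OF smooth_algebra_differentiable[OF norm_sq_plus_smooth]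
      has_real_derivative_powr[OF norm_sq_plus_pos[OF assms], where r = s], where i=i]
  by (simp add: partial_deriv_norm_sq)

lemma second_partial_powr_norm_sq:
  assumes "e > 0"
  shows "iter_partial [i, i] (\<lambda>y. ((norm (y - x))\<^sup>2 + e\<^sup>2) powr s) y =
     2 * s * ((norm (y - x))\<^sup>2 + e\<^sup>2) powr (s - 1) +
     4 * s * (s - 1) * ((norm (y - x))\<^sup>2 + e\<^sup>2) powr (s - 2) * (y $ i - x $ i)\<^sup>2"
proof -
  have "iter_partial [i, i] (\<lambda>y. ((norm (y - x))\<^sup>2 + e\<^sup>2) powr s) y =
    partial_deriv i (\<lambda>y. (2 * s) * (((norm (y - x))\<^sup>2 + e\<^sup>2) powr (s - 1) * (y $ i - x $ i))) y"
    by (simp add: iter_partial_def partial_deriv_powr_norm_sq[OF assms, abs_def] mult.assoc)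
  also have "\<dots> = (2 * s) * partial_deriv i (\<lambda>y. ((norm (y - x))\<^sup>2 + e\<^sup>2) powr (s - 1) * (y $ i - x $ i)) y"
    by (subst partial_deriv_mult)
       (auto intro!: smooth_algebra_differentiable smooth_algebra.intros smooth_algebra_diff norm_sq_plus_smooth norm_sq_plus_pos[OF assms]
             simp: partial_deriv_const)
  also have "partial_deriv i (\<lambda>y. ((norm (y - x))\<^sup>2 + e\<^sup>2) powr (s - 1) * (y $ i - x $ i)) y =
     ((norm (y - x))\<^sup>2 + e\<^sup>2) powr (s - 1) + 
     2 * (s - 1) * ((norm (y - x))\<^sup>2 + e\<^sup>2) powr (s - 1 - 1) * (y $ i - x $ i) * (y $ i - x $ i)"
    by (subst partial_deriv_mult)
       (auto intro!: smooth_algebra_differentiable smooth_algebra.intros smooth_algebra_diff norm_sq_plus_smooth norm_sq_plus_pos[OF assms]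
             simp: partial_deriv_coord_diff partial_deriv_powr_norm_sq[OF assms])
  finally show ?thesis by (simp add: algebra_simps power2_eq_square)
qed

text \<open>With q = |y - x|^2 + e^2, the Laplacian of q^s is 2 s q^(s-2) (n q + 2 (s - 1) |y -
  x|^2). The exponent s = -(n - 2)/2 is the one with 2 (s - 1) = -n, so the terms in |y - x|^2
  cancel and n e^2 remains.\<close>

lemma laplacian_newton_reg:
  fixes x y :: "real^'n::finite"
  assumes "e > 0"
  shows "(\<Sum>i\<in>UNIV. iter_partial [i, i] (\<lambda>y. newton_reg e (y - x)) y) =
     - (real CARD('n) * (real CARD('n) - 2)) * mollifier e (y - x)"
proof -
  define q where "q = (norm (y - x))\<^sup>2 + e\<^sup>2"
  define s where "s = - (real CARD('n) - 2) / 2"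
  have q: "q > 0" unfolding q_def by (rule norm_sq_plus_pos[OF assms])
  have "(\<Sum>i\<in>UNIV. iter_partial [i, i] (\<lambda>y. newton_reg e (y - x)) y) =
     (\<Sum>i\<in>(UNIV::'n set). 2 * s * q powr (s - 1) + 4 * s * (s - 1) * q powr (s - 2) * ((y - x) $ i)\<^sup>2)"
    unfolding newton_reg_def s_def[symmetric] second_partial_powr_norm_sq[OF assms] q_def by simp
  also have "\<dots> = 2 * s * real CARD('n) * q powr (s - 1) + 4 * s * (s - 1) * q powr (s - 2) * (norm (y - x))\<^sup>2"
    by (simp add: sum.distrib norm_sq_eq_sum sum_distrib_left)
  also have "q powr (s - 1) = q powr (s - 2) * q"
    using q powr_add[of q "s - 2" 1] by simp
  also have "2 * s * real CARD('n) * (q powr (s - 2) * q) + 4 * s * (s - 1) * q powr (s - 2) * (norm (y - x))\<^sup>2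
     = 2 * s * q powr (s - 2) * (real CARD('n) * q + 2 * (s - 1) * (norm (y - x))\<^sup>2)"
    by (simp add: algebra_simps)
  also have "real CARD('n) * q + 2 * (s - 1) * (norm (y - x))\<^sup>2 = real CARD('n) * e\<^sup>2"
    proof -
    have "2 * (s - 1) = - real CARD('n)" by (simp add: s_def field_simps)
    then show ?thesis by (simp add: q_def distrib_left)
  qed
  moreover have s2: "2 * s = - (real CARD('n) - 2)"
    by (simp add: s_def)
  ultimately have "(\<Sum>i\<in>UNIV. iter_partial [i, i] (\<lambda>y. newton_reg e (y - x)) y) =
      - (real CARD('n) - 2) * q powr (s - 2) * (real CARD('n) * e\<^sup>2)"
    by simp
  also have "s - 2 = - (real CARD('n) + 2) / 2"
    by (simp add: s_def field_simps)
  finally show ?thesis unfolding mollifier_def q_def[symmetric]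
    by (simp add: algebra_simps)
qed

lemma newton_reg_le:
  fixes z :: "real^'n::finite"
  assumes "z \<noteq> 0" "CARD('n) \<ge> 2"
  shows "newton_reg e z \<le> inverse (norm z ^ (CARD('n) - 2))"
proof -
  have "newton_reg e z \<le> ((norm z)\<^sup>2) powr (- (real CARD('n) - 2) / 2)"
    unfolding newton_reg_def using assms by (intro powr_mono2') auto
  also have "\<dots> = norm z powr (- real (CARD('n) - 2))"
  proof -
    have "((norm z) powr 2) powr (- (real CARD('n) - 2) / 2) = norm z powr (2 * (- (real CARD('n) - 2) / 2))"
      by (rule powr_powr)
    also have "2 * (- (real CARD('n) - 2) / 2) = - real (CARD('n) - 2)"
      using assms by simp
    finally show ?thesis using assms by (simp add: powr_numeral)
  qed
  also have "\<dots> = inverse (norm z ^ (CARD('n) - 2))"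
    using powr_realpow[of "norm z" "CARD('n) - 2"] assms(1) by (simp add: powr_minus del: of_nat_diff)
  finally show ?thesis .
qed

section \<open>Mollification\<close>

lemma sigma_finite_lebesgue: "sigma_finite_measure (lebesgue :: 'a::euclidean_space measure)"
proof -
  obtain A :: "'a set set" where A: "countable A" "A \<subseteq> sets lborel" "\<Union>A = space lborel"
      "\<forall>a\<in>A. emeasure lborel a \<noteq> \<infinity>"
    using lborel.sigma_finite_countable by blast
  show ?thesis
    by standard (use A in \<open>auto intro!: exI[of _ A]\<close>)
qed

interpretation lebesgue: sigma_finite_measure "lebesgue :: 'a::euclidean_space measure"
  by (rule sigma_finite_lebesgue)

interpretation lebesgue_pair: pair_sigma_finite
  "lebesgue :: 'a::euclidean_space measure" "lebesgue :: 'b::euclidean_space measure" ..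

lemma measurable_lebesgue_ident: "(\<lambda>x. x) \<in> lebesgue \<rightarrow>\<^sub>M borel"
  by (rule measurable_completion) simp

text \<open>The product of two completed measures need not be complete, but its sigma-algebra
  contains the Borel sets of the product space: the identity is measurable coordinate by coordinate.
  This covers every kernel depending continuously on x - y.\<close>

lemma measurable_lebesgue_pair:
  assumes "(\<lambda>(x, y). f x y) \<in> borel_measurable (borel :: ('a::euclidean_space \<times> 'b::euclidean_space) measure)"
  shows "(\<lambda>(x, y). f x y) \<in> borel_measurable (lebesgue \<Otimes>\<^sub>M lebesgue)"
proof -
  have "(\<lambda>p::'a \<times> 'b. (fst p, snd p)) \<in> (lebesgue \<Otimes>\<^sub>M lebesgue) \<rightarrow>\<^sub>M (borel \<Otimes>\<^sub>M borel)"
    by (intro measurable_Pair measurable_compose[OF measurable_fst measurable_lebesgue_ident]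
        measurable_compose[OF measurable_snd measurable_lebesgue_ident])
  then have "(\<lambda>p::'a \<times> 'b. p) \<in> (lebesgue \<Otimes>\<^sub>M lebesgue) \<rightarrow>\<^sub>M borel"
    by (simp add: borel_prod)
  from measurable_compose[OF this assms] show ?thesis .
qed

lemma lebesgue_integral_translate:
  fixes f :: "'a::euclidean_space \<Rightarrow> real"
  assumes [measurable]: "f \<in> borel_measurable borel"
  shows "(LINT z|lebesgue. f (y + z)) = (LINT x|lebesgue. f x)"
proof -
  have "(LINT x|lebesgue. f x) = (LINT x|distr lborel borel ((+) y). f x)"
    by (simp add: integral_completion lborel_distr_plus)
  also have "\<dots> = (LINT z|lborel. f (y + z))"
    by (rule integral_distr) simp_all
  finally show ?thesis by (simp add: integral_completion)
qed

section \<open>Mass and concentration of the bump\<close>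

lemma mollifier_pos: "e > 0 \<Longrightarrow> mollifier e z > 0"
  using norm_sq_plus_pos[of e z] by (simp add: mollifier_def)

text \<open>Two instances are used. With d = 0 and c = e^2 it bounds the bump by its value at 0;
  with c = 0 it shows that at distance d > 0 the bump is of order e^2.\<close>

lemma mollifier_le_norm:
  assumes "e > 0" "d \<ge> 0" "d \<le> norm z" "d\<^sup>2 + c > 0" "c \<le> e\<^sup>2"
  shows "mollifier e (z::real^'n::finite) \<le> e\<^sup>2 * (d\<^sup>2 + c) powr (- (real CARD('n) + 2) / 2)"
  unfolding mollifier_def using assms
  by (intro mult_left_mono powr_mono2' add_mono power_mono) auto

lemma mollifier_measurable: "e > 0 \<Longrightarrow> mollifier e \<in> borel_measurable borel"
  using smooth_algebra_continuous[OF mollifier_smooth[of e 0], of UNIV]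
  by (auto intro: borel_measurable_continuous_onI)

text \<open>A lower bound for the mass of \<open>mollifier e\<close> on the ball of radius e, where
  the bump is at least \<open>2 powr (- (n + 2) / 2) / e ^ n\<close>. By scaling it does not depend
  on e. It takes the place of the exact normalising constant, which an inequality for |u| does not
  require.\<close>

definition mollifier_const :: "'n::finite itself \<Rightarrow> real" where
  "mollifier_const _ = 2 powr (- (real CARD('n) + 2) / 2) * measure lebesgue (ball (0::real^'n) 1)"

lemma mollifier_const_pos: "mollifier_const TYPE('n::finite) > 0"
  using content_ball_gt_0_iff[of "0::real^'n" 1] by (simp add: mollifier_const_def)

lemma mollifier_ge:
  assumes "e > 0" "norm z \<le> e"
  shows "mollifier e (z::real^'n::finite) \<ge> 2 powr (- (real CARD('n) + 2) / 2) / e ^ CARD('n)"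
proof -
  define s where "s = - (real CARD('n) + 2) / 2"
  have "(norm z)\<^sup>2 \<le> e\<^sup>2" using assms by (intro power_mono) auto
  then have "e\<^sup>2 * (2 * e\<^sup>2) powr s \<le> mollifier e z"
    unfolding mollifier_def s_def using norm_sq_plus_pos[OF assms(1), of z]
    by (intro mult_left_mono powr_mono2') auto
  moreover have "e\<^sup>2 * (2 * e\<^sup>2) powr s = 2 powr s / e ^ CARD('n)"
  proof -
    have "(e powr 2) powr s = e powr (2 * s)" by (rule powr_powr)
    then have "(e\<^sup>2) powr s = e powr (2 * s)" using assms by (simp add: powr_numeral)
    then have "e\<^sup>2 * (2 * e\<^sup>2) powr s = 2 powr s * (e powr 2 * e powr (2 * s))"
      using assms by (simp add: powr_mult powr_numeral)
    also have "e powr 2 * e powr (2 * s) = e powr (- real CARD('n))"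
    proof -
      have "2 + 2 * s = - real CARD('n)" by (simp add: s_def field_simps)
      then show ?thesis by (simp flip: powr_add)
    qed
    also have "\<dots> = inverse (e ^ CARD('n))"
      using assms by (simp add: powr_minus powr_realpow)
    finally show ?thesis by (simp add: divide_inverse)
  qed
  ultimately show ?thesis by (simp add: s_def)
qed

lemma truncated_mollifier_integrable:
  fixes G :: "real^'n::finite \<Rightarrow> real"
  assumes "e > 0" and [measurable]: "G \<in> borel_measurable lebesgue" and "\<And>z. \<bar>G z\<bar> \<le> b"
  shows "integrable lebesgue (\<lambda>z. G z * (indicator (ball 0 R) z * mollifier e z))"
proof (rule Bochner_Integration.integrable_bound)
  show "integrable lebesgue (\<lambda>z. (b * mollifier e (0::real^'n)) * indicator (ball (0::real^'n) R) z :: real)"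
    using lmeasurable_ball[of "0::real^'n" R]
    by (intro integrable_mult_right) (auto simp: fmeasurable_def integrable_indicator_iff)
  have moll: "mollifier e \<in> borel_measurable (lebesgue :: (real^'n) measure)"
    by (rule measurable_completion) (simp add: mollifier_measurable[OF assms(1)])
  show "(\<lambda>z. G z * (indicator (ball 0 R) z * mollifier e z)) \<in> borel_measurable lebesgue"
    by (intro borel_measurable_times borel_measurable_indicator moll assms(2)) auto
  show "AE z in lebesgue. norm (G z * (indicator (ball 0 R) z * mollifier e z))
      \<le> norm ((b * mollifier e (0::real^'n)) * indicator (ball 0 R) z)"
  proof (intro always_eventually allI)
    fix z :: "real^'n"
    have "mollifier e z \<le> mollifier e (0::real^'n)"
      using mollifier_le_norm[of e 0 z "e\<^sup>2"] assms(1) by (simp add: mollifier_def)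
    then have "\<bar>G z\<bar> * mollifier e z \<le> b * mollifier e (0::real^'n)"
      using assms(3)[of z] mollifier_pos[OF assms(1), of z] by (intro mult_mono) auto
    also have "\<dots> \<le> \<bar>b * mollifier e (0::real^'n)\<bar>" by simp
    finally show "norm (G z * (indicator (ball 0 R) z * mollifier e z))
      \<le> norm ((b * mollifier e (0::real^'n)) * indicator (ball 0 R) z)"
      using mollifier_pos[OF assms(1), of z] by (auto simp del: abs_mult simp: abs_mult[of "G z"] split: split_indicator)
  qed
qed

definition mollifier_mass :: "real \<Rightarrow> real \<Rightarrow> 'n::finite itself \<Rightarrow> real" where
  "mollifier_mass e R _ = (LINT z|lebesgue. indicator (ball 0 R) z * mollifier e (z::real^'n))"

lemma mollifier_mass_ge:
  assumes "e > 0" "e \<le> R"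
  shows "mollifier_mass e R TYPE('n::finite) \<ge> mollifier_const TYPE('n)"
proof -
  define c where "c = 2 powr (- (real CARD('n) + 2) / 2) / e ^ CARD('n)"
  have "measure lebesgue (ball (0::real^'n) e) = e ^ CARD('n) * measure lebesgue (ball (0::real^'n) 1)"
    using content_ball_conv_unit_ball[of e "0::real^'n"] assms by simp
  then have "mollifier_const TYPE('n) = c * measure lebesgue (ball (0::real^'n) e)"
    using assms by (simp add: mollifier_const_def c_def)
  also have "\<dots> = (LINT z|lebesgue. c * indicator (ball (0::real^'n) e) z)"
    by simp
  also have "\<dots> \<le> mollifier_mass e R TYPE('n)"
    unfolding mollifier_mass_def
  proof (rule integral_mono)
    show "integrable lebesgue (\<lambda>z. c * indicator (ball (0::real^'n) e) z :: real)"
      using lmeasurable_ball[of "0::real^'n" e]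
      by (intro integrable_mult_right) (auto simp: fmeasurable_def integrable_indicator_iff)
    show "integrable lebesgue (\<lambda>z. indicator (ball 0 R) z * mollifier e (z::real^'n))"
      using truncated_mollifier_integrable[OF assms(1), of "\<lambda>_. 1" 1 R] by simp
    show "c * indicator (ball 0 e) z \<le> indicator (ball 0 R) z * mollifier e z" for z :: "real^'n"
      using mollifier_ge[of e z] mollifier_pos[of e z] assms by (auto simp: c_def split: split_indicator)
  qed
  finally show ?thesis .
qed

text \<open>Near 0 the integrand is close to G 0 by continuity; away from 0 the bump is of order
  e^2, and dividing by the mass is harmless because the mass stays above
  \<open>mollifier_const\<close>. Continuity at the single point 0 is enough, so G may contain an
  indicator.\<close>

lemma mollifier_approx_identity:
  fixes G :: "real^'n::finite \<Rightarrow> real"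
  assumes G[measurable]: "G \<in> borel_measurable lebesgue" and G1: "\<And>z. \<bar>G z\<bar> \<le> 1" and cont: "isCont G 0"
    and e: "\<And>k. e k > 0" "\<And>k. e k \<le> R" "e \<longlonglongrightarrow> 0"
  shows "(\<lambda>k. (LINT z|lebesgue. G z * (indicator (ball 0 R) z * mollifier (e k) z)) /
           mollifier_mass (e k) R TYPE('n)) \<longlonglongrightarrow> G 0"
proof (rule LIMSEQ_I)
  fix \<eta> :: real assume \<eta>: "\<eta> > 0"
  obtain \<delta> where \<delta>: "\<delta> > 0" "\<And>z. norm z < \<delta> \<Longrightarrow> \<bar>G z - G 0\<bar> < \<eta> / 2"
    using cont \<eta> unfolding continuous_at_eps_delta dist_norm
    by (metis diff_zero half_gt_zero_iff real_norm_def)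
  \<comment> \<open>What the region |z| >= \<delta> contributes apart from the factor e^2: the
    oscillation of G is at most 2, the bump is bounded by \<open>mollifier_le_norm\<close>, and the
    integration runs over the ball of radius R.\<close>
  define D where "D = 2 * (\<delta>\<^sup>2) powr (- (real CARD('n) + 2) / 2) * measure lebesgue (ball (0::real^'n) R)"
  define \<kappa> where "\<kappa> = mollifier_const TYPE('n)"
  have \<kappa>: "\<kappa> > 0" unfolding \<kappa>_def by (rule mollifier_const_pos)
  have "(\<lambda>k. (e k)\<^sup>2 * D / \<kappa>) \<longlonglongrightarrow> 0\<^sup>2 * D / \<kappa>"
    using \<kappa> by (intro tendsto_intros e) auto
  then have "eventually (\<lambda>k. (e k)\<^sup>2 * D / \<kappa> < \<eta> / 2) sequentially"
    using \<eta> by (intro order_tendstoD(2)) auto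
  then obtain N where N: "\<And>k. k \<ge> N \<Longrightarrow> (e k)\<^sup>2 * D / \<kappa> < \<eta> / 2"
    by (auto simp: eventually_sequentially)
  show "\<exists>N. \<forall>k\<ge>N. norm ((LINT z|lebesgue. G z * (indicator (ball 0 R) z * mollifier (e k) z)) /
           mollifier_mass (e k) R TYPE('n) - G 0) < \<eta>"
  proof (intro exI allI impI)
    fix k assume k: "k \<ge> N"
    define K where "K = (\<lambda>z::real^'n. indicator (ball 0 R) z * mollifier (e k) z)"
    define m where "m = mollifier_mass (e k) R TYPE('n)"
    have m: "m \<ge> \<kappa>" unfolding m_def \<kappa>_def by (intro mollifier_mass_ge e)
    have K0: "K z \<ge> 0" for z
      using mollifier_pos[of "e k" z] e(1)[of k] by (simp add: K_def)
    have intK: "integrable lebesgue K"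
      using truncated_mollifier_integrable[OF e(1), of "\<lambda>_. 1" 1 R] by (simp add: K_def)
    have intGK: "integrable lebesgue (\<lambda>z. G z * K z)"
      unfolding K_def by (rule truncated_mollifier_integrable[OF e(1) G G1])
    have intB: "integrable lebesgue (\<lambda>z. c * indicator (ball (0::real^'n) R) z :: real)" for c
      using lmeasurable_ball[of "0::real^'n" R]
      by (intro integrable_mult_right) (auto simp: fmeasurable_def integrable_indicator_iff)
    define c where "c = 2 * ((e k)\<^sup>2 * (\<delta>\<^sup>2) powr (- (real CARD('n) + 2) / 2))"
    have "\<bar>(LINT z|lebesgue. G z * K z) - G 0 * m\<bar> = \<bar>LINT z|lebesgue. (G z - G 0) * K z\<bar>"
      using intK intGK by (simp add: left_diff_distrib m_def mollifier_mass_def K_def)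
    also have "\<dots> \<le> (LINT z|lebesgue. \<bar>(G z - G 0) * K z\<bar>)"
      by (rule integral_abs_bound)
    also have "\<dots> \<le> (LINT z|lebesgue. \<eta> / 2 * K z + c * indicator (ball (0::real^'n) R) z)"
    proof (rule integral_mono)
      show "integrable lebesgue (\<lambda>z. \<bar>(G z - G 0) * K z\<bar>)"
        using intK intGK by (intro integrable_abs) (simp add: left_diff_distrib)
      show "integrable lebesgue (\<lambda>z. \<eta> / 2 * K z + c * indicator (ball (0::real^'n) R) z)"
        using intK intB by (intro Bochner_Integration.integrable_add integrable_mult_right) auto
      fix z
      show "\<bar>(G z - G 0) * K z\<bar> \<le> \<eta> / 2 * K z + c * indicator (ball (0::real^'n) R) z"
      proof (cases "norm z < \<delta>")
        case True
        then have "\<bar>G z - G 0\<bar> * K z \<le> \<eta> / 2 * K z"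
          using \<delta>(2)[of z] K0[of z] by (intro mult_right_mono) auto
        moreover have "c \<ge> 0" by (simp add: c_def)
        ultimately show ?thesis using K0[of z] by (simp add: abs_mult add_increasing2)
      next
        case False
        have "K z \<le> (e k)\<^sup>2 * (\<delta>\<^sup>2 + 0) powr (- (real CARD('n) + 2) / 2) * indicator (ball (0::real^'n) R) z"
          unfolding K_def using False \<delta> mollifier_le_norm[of "e k" \<delta> z 0] e(1)[of k]
          by (auto split: split_indicator)
        moreover have "\<bar>G z - G 0\<bar> \<le> 2" using G1[of z] G1[of 0] by linarith
        ultimately have "\<bar>G z - G 0\<bar> * K z \<le> c * indicator (ball (0::real^'n) R) z"
          unfolding c_def mult.assoc using K0[of z] by (intro mult_mono) auto
        then show ?thesis using K0[of z] \<eta> by (simp add: abs_mult add_increasing)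
      qed
    qed
    also have "\<dots> = \<eta> / 2 * m + (e k)\<^sup>2 * D"
      using intK intB by (simp add: m_def mollifier_mass_def K_def c_def D_def)
    finally have "\<bar>(LINT z|lebesgue. G z * K z) - G 0 * m\<bar> \<le> \<eta> / 2 * m + (e k)\<^sup>2 * D" .
    then have "\<bar>(LINT z|lebesgue. G z * K z) / m - G 0\<bar> \<le> \<eta> / 2 + (e k)\<^sup>2 * D / m"
      using m \<kappa> by (simp add: field_simps abs_div_pos[symmetric] abs_divide)
    also have "(e k)\<^sup>2 * D / m \<le> (e k)\<^sup>2 * D / \<kappa>"
      using m \<kappa> by (intro divide_left_mono) (auto simp: D_def)
    also have "\<dots> < \<eta> / 2" by (rule N[OF k])
    finally show "norm ((LINT z|lebesgue. G z * (indicator (ball 0 R) z * mollifier (e k) z)) /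
           mollifier_mass (e k) R TYPE('n) - G 0) < \<eta>"
      by (simp add: K_def m_def)
  qed
qed

text \<open>For closed T the continuous functions max 0 (1 - j dist(x, T)) lie in [0, 1] and
  decrease to the indicator of T, so h has nonnegative integral over every closed set. A closed set
  inside {h < 0} is therefore null, and inner regularity extends this to the whole set.\<close>

lemma AE_nonneg_if_integral_against_continuous_nonneg:
  fixes h :: "'a::euclidean_space \<Rightarrow> real"
  assumes h: "integrable lebesgue h"
    and nonneg: "\<And>\<psi>. continuous_on UNIV \<psi> \<Longrightarrow> (\<And>x. 0 \<le> \<psi> x) \<Longrightarrow> (\<And>x. \<psi> x \<le> 1) \<Longrightarrow>
       0 \<le> (LINT x|lebesgue. \<psi> x * h x)"
  shows "AE x in lebesgue. 0 \<le> h x"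
proof -
  have [measurable]: "h \<in> borel_measurable lebesgue" using h by auto
  have closed_ge: "0 \<le> (LINT x|lebesgue. indicator T x * h x)" if T: "closed T" "T \<noteq> {}" for T
  proof -
    define \<psi> where "\<psi> = (\<lambda>j x. max 0 (1 - real j * infdist x T))"
    have [measurable]: "T \<in> sets lebesgue" using T by auto
    have cont: "continuous_on UNIV (\<psi> j)" for j
      unfolding \<psi>_def by (intro continuous_intros)
    have [measurable]: "\<psi> j \<in> borel_measurable lebesgue" for j
      by (rule measurable_completion) (simp add: borel_measurable_continuous_onI[OF cont])
    have b: "0 \<le> \<psi> j x" "\<psi> j x \<le> 1" for j x
      by (auto simp: \<psi>_def infdist_nonneg)
    have "(\<lambda>j. LINT x|lebesgue. \<psi> j x * h x) \<longlonglongrightarrow> (LINT x|lebesgue. indicator T x * h x)"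
    proof (rule integral_dominated_convergence[where w="\<lambda>x. \<bar>h x\<bar>"])
      show "AE x in lebesgue. (\<lambda>j. \<psi> j x * h x) \<longlonglongrightarrow> indicator T x * h x"
      proof (intro always_eventually allI tendsto_mult tendsto_const)
        fix x
        show "(\<lambda>j. \<psi> j x) \<longlonglongrightarrow> indicator T x"
        proof (cases "x \<in> T")
          case True
          then have "infdist x T = 0" by simp
          then show ?thesis using True by (simp add: \<psi>_def)
        next
          case False
          then have pos: "infdist x T > 0"
            using T infdist_nonneg[of x T] in_closed_iff_infdist_zero[of T x] by force
          obtain N where N: "1 / infdist x T < real N" using reals_Archimedean2 by blast
          have "eventually (\<lambda>j. \<psi> j x = 0) sequentially"
            unfolding eventually_sequentially
          proof (intro exI allI impI)
            fix j assume "j \<ge> N"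
            then have "1 / infdist x T < real j" using N by linarith
            then have "1 < real j * infdist x T" using pos by (simp add: field_simps)
            then show "\<psi> j x = 0" by (simp add: \<psi>_def)
          qed
          then show ?thesis using False by (simp add: tendsto_eventually)
        qed
      qed
      show "AE x in lebesgue. norm (\<psi> j x * h x) \<le> \<bar>h x\<bar>" for j
        using b[of j] by (auto simp: abs_mult intro!: mult_left_le_one_le)
    qed (use h in auto)
    then show ?thesis
      by (rule LIMSEQ_le_const) (auto intro!: nonneg cont b)
  qed
  have null: "T \<in> null_sets lebesgue" if T: "closed T" "T \<subseteq> {x. h x < 0}" for T
  proof (cases "T = {}")
    case False
    have [measurable]: "T \<in> sets lebesgue" using T by auto
    have int: "integrable lebesgue (\<lambda>x. indicator T x * h x)"
      using integrable_mult_indicator[of T lebesgue h] h by simp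
    have "(LINT x|lebesgue. - (indicator T x * h x)) = 0 \<longleftrightarrow> (AE x in lebesgue. - (indicator T x * h x) = 0)"
      by (rule integral_nonneg_eq_0_iff_AE[OF _ AE_I2]) (use int T in \<open>auto split: split_indicator\<close>)
    moreover have "(LINT x|lebesgue. - (indicator T x * h x)) \<ge> 0"
      by (rule integral_nonneg_AE, rule AE_I2) (use T in \<open>auto split: split_indicator\<close>)
    ultimately have "AE x in lebesgue. indicator T x * h x = 0"
      using closed_ge[OF T(1) False] int by auto
    then have "AE x in lebesgue. x \<notin> T"
      by eventually_elim (use T in \<open>auto split: split_indicator_asm\<close>)
    then show ?thesis
      using AE_iff_null[of lebesgue "\<lambda>x. x \<notin> T"] by simp
  qed auto
  define S where "S = {x. h x < 0}"
  have "S = {x\<in>space lebesgue. h x < 0}" by (simp add: S_def)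
  also have "\<dots> \<in> sets lebesgue" by measurable
  finally have S[measurable]: "S \<in> sets lebesgue" .
  have "emeasure lebesgue S \<le> 0"
  proof (rule ennreal_le_epsilon)
    fix e :: real assume "e > 0"
    obtain T where T: "closed T" "T \<subseteq> S" "emeasure lebesgue (S - T) < ennreal e"
      using sets_lebesgue_inner_closed[OF S \<open>e > 0\<close>] by metis
    have "emeasure lebesgue S = emeasure lebesgue (S - T)"
      using null[of T] T emeasure_Diff_null_set[of T lebesgue S] S by (simp add: S_def)
    then show "emeasure lebesgue S \<le> 0 + ennreal e" using T by simp
  qed
  then have "S \<in> null_sets lebesgue" by auto
  then have "AE x in lebesgue. x \<notin> S" by (rule AE_not_in)
  then show ?thesis by eventually_elim (auto simp: S_def)
qed


lemma integrable_pair_product: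
  fixes f :: "'a::euclidean_space \<Rightarrow> real" and g :: "'b::euclidean_space \<Rightarrow> real"
  assumes f: "integrable lebesgue f" and g: "integrable lebesgue g"
  shows "integrable (lebesgue \<Otimes>\<^sub>M lebesgue) (\<lambda>(x, y). f x * g y)"
proof (rule lebesgue_pair.Fubini_integrable)
  have [measurable]: "f \<in> borel_measurable lebesgue" "g \<in> borel_measurable lebesgue"
    using f g by auto
  show "(\<lambda>(x, y). f x * g y) \<in> borel_measurable (lebesgue \<Otimes>\<^sub>M lebesgue)"
    by measurable
  show "integrable lebesgue (\<lambda>x. LINT y|lebesgue. norm (case (x, y) of (x, y) \<Rightarrow> f x * g y))"
    using f by (auto simp: abs_mult)
  show "AE x in lebesgue. integrable lebesgue (\<lambda>y. case (x, y) of (x, y) \<Rightarrow> f x * g y)"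
    using g by auto
qed

lemma mollifier_diff_measurable:
  assumes "e > 0"
  shows "(\<lambda>(x, y). mollifier e (y - x :: real^'n::finite)) \<in> borel_measurable (lebesgue \<Otimes>\<^sub>M lebesgue)"
proof (rule measurable_lebesgue_pair)
  have "(\<lambda>p::(real^'n) \<times> (real^'n). snd p - fst p) \<in> borel \<rightarrow>\<^sub>M borel"
    by (intro borel_measurable_continuous_onI continuous_intros)
  from measurable_compose[OF this mollifier_measurable[OF assms]]
  show "(\<lambda>(x, y). mollifier e (y - x :: real^'n)) \<in> borel_measurable borel"
    by (simp add: case_prod_beta)
qed

text \<open>Instead of differentiating the integral of f almost everywhere, the inequality is tested
  against a continuous \<psi>. Fubini moves the bump from f to \<psi> restricted to the ball, whose
  mollifications converge at every point of the open ball; f vanishes elsewhere, so dominated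
  convergence applies.\<close>

lemma AE_le_if_mollified_le:
  fixes f w :: "real^'n::finite \<Rightarrow> real"
  assumes r: "r > 0" and f: "integrable lebesgue f" and f0: "\<And>x. x \<notin> ball a r \<Longrightarrow> f x = 0"
    and w: "integrable lebesgue w" and w0: "\<And>x. w x \<ge> 0"
    and le: "AE x in lebesgue. x \<in> ball a r \<longrightarrow>
      (\<forall>e>0. (LINT y|lebesgue. f y * mollifier e (y - x)) \<le> w x)"
  shows "AE x in lebesgue. x \<in> ball a r \<longrightarrow> f x \<le> w x / mollifier_const TYPE('n)"
proof -
  define \<kappa> where "\<kappa> = mollifier_const TYPE('n)"
  have \<kappa>: "\<kappa> > 0" unfolding \<kappa>_def by (rule mollifier_const_pos)
  define B where "B = ball a r"
  have [measurable]: "B \<in> sets borel" "B \<in> sets lebesgue" by (auto simp: B_def)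
  have [measurable]: "f \<in> borel_measurable lebesgue" "w \<in> borel_measurable lebesgue"
    using f w by auto
  define e where "e = (\<lambda>k. 2 * r / (real k + 1))"
  have e: "e k > 0" "e k \<le> 2 * r" for k
    using r by (auto simp: e_def field_simps)
  have e0: "e \<longlonglongrightarrow> 0"
    unfolding e_def by real_asymp
  have wB: "integrable lebesgue (\<lambda>x. indicator B x * w x)"
    using integrable_mult_indicator[of B lebesgue w] w by simp
  have intB: "integrable lebesgue (indicator B :: _ \<Rightarrow> real)"
    using lmeasurable_ball[of a r] by (simp add: fmeasurable_def integrable_indicator_iff B_def)
  have h: "integrable lebesgue (\<lambda>x. indicator B x * w x / \<kappa> - f x)"
    using wB f by auto
  have "AE x in lebesgue. 0 \<le> indicator B x * w x / \<kappa> - f x"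
  proof (rule AE_nonneg_if_integral_against_continuous_nonneg[OF h])
    fix \<psi> :: "real^'n \<Rightarrow> real"
    assume cont: "continuous_on UNIV \<psi>" and \<psi>0: "\<And>x. 0 \<le> \<psi> x" and \<psi>1: "\<And>x. \<psi> x \<le> 1"
    have [measurable]: "\<psi> \<in> borel_measurable borel"
      using cont by (rule borel_measurable_continuous_onI)
    then have [measurable]: "\<psi> \<in> borel_measurable lebesgue"
      by (intro measurable_completion) simp
    define K where "K = (\<lambda>k y. LINT x|lebesgue. \<psi> x * indicator B x * mollifier (e k) (y - x))"
    define m where "m = (\<lambda>k. mollifier_mass (e k) (2 * r) TYPE('n))"
    have m: "m k \<ge> \<kappa>" for k unfolding m_def \<kappa>_def by (intro mollifier_mass_ge e)
    have K_eq: "K k y = (LINT z|lebesgue. (\<psi> (y + z) * indicator B (y + z)) *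
          (indicator (ball 0 (2 * r)) z * mollifier (e k) z))" if y: "y \<in> B" for k y
    proof -
      have [measurable]: "mollifier (e k) \<in> borel_measurable (borel :: (real^'n) measure)"
        by (rule mollifier_measurable[OF e(1)])
      have "K k y = (LINT z|lebesgue. \<psi> (y + z) * indicator B (y + z) * mollifier (e k) (y - (y + z)))"
        unfolding K_def by (rule lebesgue_integral_translate[symmetric]) measurable
      also have "\<dots> = (LINT z|lebesgue. (\<psi> (y + z) * indicator B (y + z)) *
          (indicator (ball 0 (2 * r)) z * mollifier (e k) z))"
      proof (rule Bochner_Integration.integral_cong[OF refl])
        fix z
        have "norm z < 2 * r" if "y + z \<in> B"
        proof -
          have "dist y (y + z) \<le> dist y a + dist a (y + z)" by (rule dist_triangle)
          then show ?thesis using that y by (simp add: B_def dist_commute dist_norm)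
        qed
        then show "\<psi> (y + z) * indicator B (y + z) * mollifier (e k) (y - (y + z)) =
           (\<psi> (y + z) * indicator B (y + z)) * (indicator (ball 0 (2 * r)) z * mollifier (e k) z)"
          by (auto simp: mollifier_def split: split_indicator)
      qed
      finally show ?thesis .
    qed
    have G: "(\<lambda>z. \<psi> (y + z) * indicator B (y + z)) \<in> borel_measurable lebesgue" for y
      by (rule measurable_completion) simp
    have G1: "\<bar>\<psi> (y + z) * indicator B (y + z)\<bar> \<le> 1" for y z
      using \<psi>0[of "y + z"] \<psi>1[of "y + z"] by (auto split: split_indicator)
    have K_lim: "(\<lambda>k. K k y / m k) \<longlonglongrightarrow> \<psi> y" if y: "y \<in> B" for y
    proof -
      have "isCont (\<lambda>z. \<psi> (y + z)) 0"
        using continuous_on_compose2[OF cont, of UNIV "\<lambda>z. y + z"]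
        by (simp add: continuous_on_eq_continuous_at continuous_intros)
      then have "((\<lambda>z. \<psi> (y + z)) \<longlongrightarrow> \<psi> y) (at 0)"
        by (simp add: isCont_def)
      moreover have "eventually (\<lambda>z. y + z \<in> B) (at 0)"
      proof -
        have "((\<lambda>z. y + z) \<longlongrightarrow> y + 0) (at 0)" by (intro tendsto_intros)
        then show ?thesis
          by (rule topological_tendstoD) (use y in \<open>auto simp: B_def\<close>)
      qed
      ultimately have "((\<lambda>z. \<psi> (y + z) * indicator B (y + z)) \<longlongrightarrow> \<psi> y) (at 0)"
        by (elim Lim_transform_eventually) (auto elim: eventually_mono)
      then have "isCont (\<lambda>z. \<psi> (y + z) * indicator B (y + z)) 0"
        using y by (simp add: isCont_def)
      from mollifier_approx_identity[OF G G1 this e e0]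
      show ?thesis using y by (simp add: K_eq[OF y] m_def)
    qed
    have K_bound: "\<bar>K k y / m k\<bar> \<le> 1" if y: "y \<in> B" for k y
    proof -
      have "\<bar>K k y\<bar> \<le> (LINT z|lebesgue. \<bar>(\<psi> (y + z) * indicator B (y + z)) *
          (indicator (ball 0 (2 * r)) z * mollifier (e k) z)\<bar>)"
        unfolding K_eq[OF y] by (rule integral_abs_bound)
      also have "\<dots> \<le> m k"
        unfolding m_def mollifier_mass_def
      proof (rule integral_mono)
        show "integrable lebesgue (\<lambda>z. \<bar>(\<psi> (y + z) * indicator B (y + z)) *
          (indicator (ball 0 (2 * r)) z * mollifier (e k) z)\<bar>)"
          by (intro integrable_abs truncated_mollifier_integrable[OF e(1) G G1])
        show "integrable lebesgue (\<lambda>z. indicator (ball 0 (2 * r)) z * mollifier (e k) (z::real^'n))"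
          using truncated_mollifier_integrable[OF e(1), of "\<lambda>_. 1" 1 "2 * r"] by simp
        show "\<bar>(\<psi> (y + z) * indicator B (y + z)) * (indicator (ball 0 (2 * r)) z * mollifier (e k) z)\<bar>
           \<le> indicator (ball 0 (2 * r)) z * mollifier (e k) z" for z
          using G1[of y z] mollifier_pos[OF e(1), of k z]
          by (subst abs_mult) (auto intro!: mult_left_le_one_le split: split_indicator)
      qed
      finally show ?thesis using m[of k] \<kappa> by (simp add: abs_divide)
    qed
    \<comment> \<open>Exchanging the order of integration turns f against the mollified \<psi> into
      \<psi> against the mollified f, where the hypothesis \<open>le\<close> applies.\<close>
    have fub: "(LINT y|lebesgue. f y * K k y) \<le> (LINT x|lebesgue. \<psi> x * (indicator B x * w x))" for k
    proof -
      define F where "F = (\<lambda>x y. (\<psi> x * indicator B x) * (f y * mollifier (e k) (y - x)))"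
      have F_int: "integrable (lebesgue \<Otimes>\<^sub>M lebesgue) (case_prod F)"
      proof (rule Bochner_Integration.integrable_bound)
        show "integrable (lebesgue \<Otimes>\<^sub>M lebesgue)
            (\<lambda>(x, y). indicator B x * (mollifier (e k) (0::real^'n) * f y))"
          using f intB by (intro integrable_pair_product) auto
        note mollifier_diff_measurable[OF e(1)[of k], measurable]
        have "(\<lambda>(x, y). (\<psi> x * indicator B x) * (f y * (case (x, y) of (x, y) \<Rightarrow> mollifier (e k) (y - x))))
           \<in> borel_measurable (lebesgue \<Otimes>\<^sub>M lebesgue)"
          by measurable
        then show "case_prod F \<in> borel_measurable (lebesgue \<Otimes>\<^sub>M lebesgue)"
          by (simp add: F_def)
        show "AE p in lebesgue \<Otimes>\<^sub>M lebesgue. norm (case_prod F p) \<le>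
          norm (case p of (x, y) \<Rightarrow> indicator B x * (mollifier (e k) (0::real^'n) * f y))"
        proof (intro AE_I2, clarify)
          fix x y :: "real^'n"
          have "\<bar>\<psi> x\<bar> * \<bar>mollifier (e k) (y - x)\<bar> \<le> 1 * \<bar>mollifier (e k) (0::real^'n)\<bar>"
            using \<psi>0[of x] \<psi>1[of x] mollifier_le_norm[of "e k" 0 "y - x" "(e k)\<^sup>2"] e(1)[of k]
              mollifier_pos[OF e(1), of k "y - x"] mollifier_pos[OF e(1), of k "0::real^'n"]
            by (intro mult_mono) (auto simp: mollifier_def)
          then have "\<bar>f y\<bar> * (\<bar>\<psi> x\<bar> * \<bar>mollifier (e k) (y - x)\<bar>) \<le> \<bar>f y\<bar> * (1 * \<bar>mollifier (e k) (0::real^'n)\<bar>)"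
            by (rule mult_left_mono) simp
          then show "norm (F x y) \<le> norm (indicator B x * (mollifier (e k) (0::real^'n) * f y))"
            by (auto simp: F_def abs_mult algebra_simps split: split_indicator)
        qed
      qed
      have "(LINT y|lebesgue. f y * K k y) = (LINT y|lebesgue. LINT x|lebesgue. F x y)"
        by (simp add: K_def F_def algebra_simps flip: integral_mult_right_zero)
      also have "\<dots> = (LINT x|lebesgue. LINT y|lebesgue. F x y)"
        by (rule lebesgue_pair.Fubini_integral[OF F_int])
      also have "\<dots> \<le> (LINT x|lebesgue. \<psi> x * (indicator B x * w x))"
      proof (rule integral_mono_AE)
        show "integrable lebesgue (\<lambda>x. LINT y|lebesgue. F x y)"
          using lebesgue_pair.integrable_fst[OF F_int] by simp
        show "integrable lebesgue (\<lambda>x. \<psi> x * (indicator B x * w x))"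
          by (rule Bochner_Integration.integrable_bound[OF w])
             (auto intro!: AE_I2 mult_left_le_one_le \<psi>0 \<psi>1 simp: abs_mult abs_of_nonneg[OF \<psi>0] split: split_indicator)
        show "AE x in lebesgue. (LINT y|lebesgue. F x y) \<le> \<psi> x * (indicator B x * w x)"
          using le
        proof eventually_elim
          case (elim x)
          have "(LINT y|lebesgue. F x y) = \<psi> x * indicator B x * (LINT y|lebesgue. f y * mollifier (e k) (y - x))"
            by (simp add: F_def)
          then show ?case
            using elim e(1)[of k] \<psi>0[of x] by (auto simp: B_def intro!: mult_left_mono split: split_indicator)
        qed
      qed
      finally show ?thesis .
    qed
    define W where "W = (LINT x|lebesgue. \<psi> x * (indicator B x * w x))"
    have W0: "W \<ge> 0" unfolding W_def
      by (rule integral_nonneg_AE, rule AE_I2) (use w0 \<psi>0 in \<open>auto split: split_indicator\<close>)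
    have "(\<lambda>k. LINT y|lebesgue. f y * (K k y / m k)) \<longlonglongrightarrow> (LINT y|lebesgue. f y * \<psi> y)"
    proof (rule integral_dominated_convergence[where w="\<lambda>y. \<bar>f y\<bar>"])
      show "AE y in lebesgue. (\<lambda>k. f y * (K k y / m k)) \<longlonglongrightarrow> f y * \<psi> y"
      proof (rule AE_I2)
        fix y
        show "(\<lambda>k. f y * (K k y / m k)) \<longlonglongrightarrow> f y * \<psi> y"
          by (cases "y \<in> B") (use tendsto_mult[OF tendsto_const K_lim[of y]] f0[of y] in \<open>auto simp: B_def\<close>)
      qed
      show "AE y in lebesgue. norm (f y * (K k y / m k)) \<le> \<bar>f y\<bar>" for k
      proof (rule AE_I2)
        fix y
        show "norm (f y * (K k y / m k)) \<le> \<bar>f y\<bar>"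
          using K_bound[of y k] f0[of y]
            mult_left_le[of "\<bar>K k y / m k\<bar>" "\<bar>f y\<bar>"]
          by (cases "y \<in> B") (auto simp: B_def abs_mult)
      qed
      show "(\<lambda>y. f y * (K k y / m k)) \<in> borel_measurable lebesgue" for k
      proof -
        note mollifier_diff_measurable[OF e(1)[of k], measurable]
        have "(\<lambda>(x, y). \<psi> x * indicator B x * (case (x, y) of (x, y) \<Rightarrow> mollifier (e k) (y - x)))
           \<in> borel_measurable (lebesgue \<Otimes>\<^sub>M lebesgue)"
          by measurable
        then have "(\<lambda>(y, x). \<psi> x * indicator B x * mollifier (e k) (y - x))
           \<in> borel_measurable (lebesgue \<Otimes>\<^sub>M lebesgue)"
          by (subst measurable_pair_swap_iff) simp
        then have "K k \<in> borel_measurable lebesgue"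
          unfolding K_def by (rule lebesgue.borel_measurable_lebesgue_integral)
        then show ?thesis by measurable
      qed
    qed (use f in auto)
    then have "(LINT y|lebesgue. f y * \<psi> y) \<le> W / \<kappa>"
    proof (rule LIMSEQ_le_const2, intro exI allI impI)
      fix k :: nat
      have "(LINT y|lebesgue. f y * (K k y / m k)) = (LINT y|lebesgue. f y * K k y) / m k"
        by simp
      also have "\<dots> \<le> W / m k"
        using fub[of k] m[of k] \<kappa> by (intro divide_right_mono) (auto simp: W_def)
      also have "\<dots> \<le> W / \<kappa>"
        using m[of k] \<kappa> W0 by (intro divide_left_mono) auto
      finally show "(LINT y|lebesgue. f y * (K k y / m k)) \<le> W / \<kappa>" .
    qed
    moreover have "(LINT x|lebesgue. \<psi> x * (indicator B x * w x / \<kappa> - f x)) = W / \<kappa> - (LINT y|lebesgue. f y * \<psi> y)"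
    proof -
      have bnd: "integrable lebesgue (\<lambda>x. \<psi> x * g x)" if g: "integrable lebesgue g" for g :: "real^'n \<Rightarrow> real"
      proof (rule Bochner_Integration.integrable_bound[OF g])
        have [measurable]: "g \<in> borel_measurable lebesgue" using g by auto
        show "(\<lambda>x. \<psi> x * g x) \<in> borel_measurable lebesgue" by measurable
        show "AE x in lebesgue. norm (\<psi> x * g x) \<le> norm (g x)"
          by (auto intro!: AE_I2 mult_left_le_one_le \<psi>0 \<psi>1 simp: abs_mult abs_of_nonneg[OF \<psi>0])
      qed
      have "(LINT x|lebesgue. \<psi> x * (indicator B x * w x / \<kappa> - f x)) =
         (LINT x|lebesgue. (\<psi> x * (indicator B x * w x)) / \<kappa> - \<psi> x * f x)"
        by (simp add: algebra_simps)
      also have "\<dots> = W / \<kappa> - (LINT y|lebesgue. \<psi> y * f y)"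
        using bnd[OF wB] bnd[OF f] by (simp add: W_def)
      finally show ?thesis by (simp add: mult.commute)
    qed
    ultimately show "0 \<le> (LINT x|lebesgue. \<psi> x * (indicator B x * w x / \<kappa> - f x))" by simp
  qed
  then show ?thesis
    by eventually_elim (auto simp: B_def \<kappa>_def)
qed

section \<open>The Carleson embedding on the dyadic tree\<close>

text \<open>The vectors m index the cubes of one generation, and division by \<open>2 ^ i\<close> in
  each coordinate passes to the ancestor i generations up. Since \<open>div\<close> rounds down,
  this is also right for negative coordinates.\<close>

definition descendants :: "nat \<Rightarrow> int^'n::finite \<Rightarrow> (int^'n) set" where
  "descendants i m = {m'. \<forall>k. m' $ k div 2 ^ i = m $ k}"

text \<open>The Carleson sum over a cube and its subcubes, cut after N generations, so that sums are
  finite and induction can start at 0. The generation j is carried along for the weight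
  \<open>l\<close>.\<close>

primrec tree_sum :: "(nat \<Rightarrow> real) \<Rightarrow> (nat \<Rightarrow> int^'n::finite \<Rightarrow> real) \<Rightarrow> nat \<Rightarrow> nat \<Rightarrow> int^'n \<Rightarrow> real" where
  "tree_sum l f 0 j m = 0"
| "tree_sum l f (Suc N) j m = l j * (f j m)\<^sup>2 + (\<Sum>m'\<in>descendants 1 m. tree_sum l f N (Suc j) m')"

lemma finite_vec_box: "(\<And>k. finite (S k)) \<Longrightarrow> finite {m :: 'a^'n::finite. \<forall>k. m $ k \<in> S k}"
proof -
  assume "\<And>k. finite (S k)"
  then have "finite (vec_lambda ` PiE UNIV S)"
    by (intro finite_imageI finite_PiE) auto
  moreover have "{m :: 'a^'n. \<forall>k. m $ k \<in> S k} \<subseteq> vec_lambda ` PiE UNIV S"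
  proof
    fix m :: "'a^'n" assume "m \<in> {m. \<forall>k. m $ k \<in> S k}"
    then show "m \<in> vec_lambda ` PiE UNIV S"
      by (intro image_eqI[of _ _ "vec_nth m"]) (auto simp: vec_nth_inverse)
  qed
  ultimately show ?thesis by (rule rev_finite_subset)
qed

lemma finite_descendants: "finite (descendants i (m :: int^'n::finite))"
proof (rule finite_subset)
  show "descendants i m \<subseteq> {m'. \<forall>k. m' $ k \<in> {m $ k * 2 ^ i..m $ k * 2 ^ i + 2 ^ i}}"
  proof clarify
    fix m' k assume "m' \<in> descendants i m"
    then have "m' $ k = m $ k * 2 ^ i + m' $ k mod 2 ^ i"
      unfolding descendants_def using div_mult_mod_eq[of "m' $ k" "2 ^ i"] by auto
    moreover have "0 \<le> m' $ k mod 2 ^ i" "m' $ k mod 2 ^ i < 2 ^ i" by auto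
    ultimately show "m' $ k \<in> {m $ k * 2 ^ i..m $ k * 2 ^ i + 2 ^ i}"
      unfolding atLeastAtMost_iff by linarith
  qed
  show "finite {m' :: int^'n. \<forall>k. m' $ k \<in> {m $ k * 2 ^ i..m $ k * 2 ^ i + 2 ^ i}}"
    by (rule finite_vec_box) simp
qed

lemma descendants_Suc: "descendants (Suc i) m = (\<Union>m'\<in>descendants 1 m. descendants i m')"
proof -
  have *: "z div 2 ^ Suc i = (z div 2 ^ i) div 2" for z :: int
    by (simp add: mult.commute flip: zdiv_zmult2_eq)
  show ?thesis
  proof (intro set_eqI iffI)
    fix x assume "x \<in> descendants (Suc i) m"
    then show "x \<in> (\<Union>m'\<in>descendants 1 m. descendants i m')"
      by (intro UN_I[of "\<chi> k. x $ k div 2 ^ i"]) (auto simp: descendants_def * simp del: power_Suc)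
  qed (auto simp: descendants_def * simp del: power_Suc)
qed

lemma sum_descendants_Suc:
  fixes f :: "int^'n::finite \<Rightarrow> real"
  shows "(\<Sum>m'\<in>descendants 1 m. \<Sum>m''\<in>descendants i m'. f m'') = (\<Sum>m''\<in>descendants (Suc i) m. f m'')"
  unfolding descendants_Suc
  by (subst sum.UNION_disjoint) (auto simp: finite_descendants, auto simp: descendants_def vec_eq_iff)

lemma tree_sum_eq:
  "tree_sum l f N j m = (\<Sum>i<N. l (j + i) * (\<Sum>m'\<in>descendants i m. (f (j + i) m')\<^sup>2))"
proof (induction N arbitrary: j m)
  case (Suc N)
  have "descendants 0 m = {m}" by (auto simp: descendants_def vec_eq_iff)
  moreover have "(\<Sum>m'\<in>descendants 1 m. \<Sum>i<N. l (Suc j + i) * (\<Sum>m''\<in>descendants i m'. (f (Suc j + i) m'')\<^sup>2))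
     = (\<Sum>i<N. l (Suc j + i) * (\<Sum>m'\<in>descendants 1 m. \<Sum>m''\<in>descendants i m'. (f (Suc j + i) m'')\<^sup>2))"
    by (subst sum.swap) (simp add: sum_distrib_left)
  ultimately show ?case
    by (simp only: tree_sum.simps Suc.IH sum_descendants_Suc sum.lessThan_Suc_shift) simp
qed simp

text \<open>This is the convexity of F^2 / D in the pair (F, D), a form of Cauchy-Schwarz. Division
  by zero yields 0, which is the right value only when F vanishes together with D.\<close>

lemma sum_sq_divide_ge:
  fixes F D :: "'a \<Rightarrow> real"
  assumes "\<And>i. i \<in> I \<Longrightarrow> D i \<ge> 0" "\<And>i. i \<in> I \<Longrightarrow> D i = 0 \<Longrightarrow> F i = 0"
  shows "(\<Sum>i\<in>I. F i)\<^sup>2 / (\<Sum>i\<in>I. D i) \<le> (\<Sum>i\<in>I. (F i)\<^sup>2 / D i)"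
proof (cases "(\<Sum>i\<in>I. D i) = 0")
  case True
  then show ?thesis using assms by (auto intro!: sum_nonneg)
next
  case False
  \<comment> \<open>The slope of the tangent plane at the totals: each F^2 / D lies above the linear
    expression 2 t F - t^2 D, with equality for F = t D.\<close>
  define t where "t = (\<Sum>i\<in>I. F i) / (\<Sum>i\<in>I. D i)"
  have "2 * t * F i - t\<^sup>2 * D i \<le> (F i)\<^sup>2 / D i" if i: "i \<in> I" for i
  proof (cases "D i = 0")
    case False
    then have "D i > 0" using assms(1)[OF i] by simp
    moreover have "0 \<le> (F i - t * D i)\<^sup>2" by simp
    ultimately show ?thesis by (simp add: field_simps power2_eq_square)
  qed (use assms(2)[OF i] in simp)
  then have "(\<Sum>i\<in>I. 2 * t * F i - t\<^sup>2 * D i) \<le> (\<Sum>i\<in>I. (F i)\<^sup>2 / D i)"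
    by (rule sum_mono)
  moreover have "(\<Sum>i\<in>I. 2 * t * F i - t\<^sup>2 * D i) = 2 * t * (\<Sum>i\<in>I. F i) - t\<^sup>2 * (\<Sum>i\<in>I. D i)"
    by (simp add: sum_subtractf sum_distrib_left)
  moreover have "\<dots> = (\<Sum>i\<in>I. F i)\<^sup>2 / (\<Sum>i\<in>I. D i)"
    using False by (simp add: t_def field_simps power2_eq_square)
  ultimately show ?thesis by simp
qed

text \<open>Inserting the root term a moves the denominator from E = A M + (S - a) to D = A M + S.
  The gain F^2 / E - F^2 / D = F^2 a / (E D) pays for l F^2. Both denominators are at most 2 A M,
  which is the origin of the constant 4.\<close>

lemma carleson_step:
  fixes A F M S a l :: real
  assumes A: "A > 0" and M: "M > 0" and a: "a = l * M\<^sup>2" "l \<ge> 0" and S: "a \<le> S" "S \<le> A * M"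
  shows "l * F\<^sup>2 + 4 * A * (G - A * (F\<^sup>2 / (A * M + (S - a)))) \<le> 4 * A * (G - A * (F\<^sup>2 / (A * M + S)))"
proof -
  define D where "D = A * M + S"
  define E where "E = A * M + (S - a)"
  have AM: "A * M > 0" using A M by simp
  have a0: "a \<ge> 0" using a by simp
  have D: "D > 0" "D \<le> 2 * A * M" and E: "E > 0" "E \<le> 2 * A * M"
    using AM S a0 by (auto simp: D_def E_def)
  have "E * D \<le> (2 * A * M) * (2 * A * M)"
    using D E by (intro mult_mono) auto
  then have "l * F\<^sup>2 * (E * D) \<le> l * F\<^sup>2 * ((2 * A * M) * (2 * A * M))"
    using a by (intro mult_left_mono) auto
  also have "\<dots> = 4 * A\<^sup>2 * F\<^sup>2 * a"
    by (simp add: a power2_eq_square)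
  finally have "l * F\<^sup>2 \<le> 4 * A\<^sup>2 * F\<^sup>2 * a / (E * D)"
    using D E by (simp add: field_simps)
  also have "\<dots> = 4 * A * (A * (F\<^sup>2 / E)) - 4 * A * (A * (F\<^sup>2 / D))"
  proof -
    have "D - E = a" by (simp add: D_def E_def)
    then have "F\<^sup>2 / E - F\<^sup>2 / D = F\<^sup>2 * a / (E * D)"
      using D E by (simp add: field_simps)
    then have "4 * A * A * (F\<^sup>2 / E - F\<^sup>2 / D) = 4 * A * A * (F\<^sup>2 * a / (E * D))" by simp
    then show ?thesis by (simp add: right_diff_distrib power2_eq_square mult.assoc)
  qed
  finally show ?thesis by (simp add: D_def E_def right_diff_distrib)
qed

lemma tree_sum_nonneg: "(\<And>j. l j \<ge> 0) \<Longrightarrow> tree_sum l f N j m \<ge> 0"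
  by (induction N arbitrary: j m) (auto intro!: add_nonneg_nonneg sum_nonneg)

text \<open>The subtracted term is the Bellman function that makes the induction close.\<close>

lemma carleson_embedding_bellman:
  fixes M F G :: "nat \<Rightarrow> int^'n::finite \<Rightarrow> real"
  assumes l: "\<And>j. l j \<ge> 0" and A: "A > 0"
    and M0: "\<And>j m. M j m \<ge> 0" and G0: "\<And>j m. G j m \<ge> 0"
    and M: "\<And>j m. M j m = (\<Sum>m'\<in>descendants 1 m. M (Suc j) m')"
    and F: "\<And>j m. F j m = (\<Sum>m'\<in>descendants 1 m. F (Suc j) m')"
    and G: "\<And>j m. G j m = (\<Sum>m'\<in>descendants 1 m. G (Suc j) m')"
    and FMG: "\<And>j m. (F j m)\<^sup>2 \<le> M j m * G j m"
    and testing: "\<And>N j m. tree_sum l M N j m \<le> A * M j m"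
  shows "tree_sum l F N j m \<le> 4 * A * (G j m - A * ((F j m)\<^sup>2 / (A * M j m + tree_sum l M N j m)))"
proof (induction N arbitrary: j m)
  \<comment> \<open>Without generations the claim is F^2 / M \<le> G, that is \<open>FMG\<close>;
    for M = 0 the quotient is 0.\<close>
  case 0
  show ?case
  proof (cases "M j m = 0")
    case True
    then show ?thesis using A FMG[of j m] G0[of j m] by simp
  next
    case False
    then have "M j m > 0" using M0[of j m] by simp
    then show ?thesis using A FMG[of j m] by (simp add: field_simps)
  qed
next
  case (Suc N)
  let ?S = "tree_sum l M N (Suc j)"
  let ?D = "\<lambda>m'. A * M (Suc j) m' + ?S m'"
  have F0: "F j m = 0" if "M j m = 0" for j m
    using FMG[of j m] that by simp
  have "(\<Sum>m'\<in>descendants 1 m. tree_sum l F N (Suc j) m') \<le>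
     (\<Sum>m'\<in>descendants 1 m. 4 * A * (G (Suc j) m' - A * ((F (Suc j) m')\<^sup>2 / ?D m')))"
    by (intro sum_mono Suc.IH)
  also have "\<dots> = 4 * A * (G j m - A * (\<Sum>m'\<in>descendants 1 m. (F (Suc j) m')\<^sup>2 / ?D m'))"
    by (simp only: G[of j m] sum_subtractf sum_distrib_left[symmetric])
  \<comment> \<open>Convexity passes the quotient from the children to the parent. A child whose
    denominator vanishes has M = 0, hence F = 0 by \<open>FMG\<close>.\<close>
  also have "\<dots> \<le> 4 * A * (G j m - A * ((F j m)\<^sup>2 / (\<Sum>m'\<in>descendants 1 m. ?D m')))"
  proof -
    have "(\<Sum>m'\<in>descendants 1 m. F (Suc j) m')\<^sup>2 / (\<Sum>m'\<in>descendants 1 m. ?D m')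
        \<le> (\<Sum>m'\<in>descendants 1 m. (F (Suc j) m')\<^sup>2 / ?D m')"
    proof (rule sum_sq_divide_ge)
      fix m'
      have "A * M (Suc j) m' \<ge> 0" "?S m' \<ge> 0"
        using A M0 tree_sum_nonneg[OF l] by auto
      then show "?D m' \<ge> 0" "?D m' = 0 \<Longrightarrow> F (Suc j) m' = 0"
        using A F0[of "Suc j" m'] by (auto simp: add_nonneg_eq_0_iff)
    qed
    then show ?thesis unfolding F[of j m]
      using A by (intro mult_left_mono diff_left_mono) auto
  qed
  \<comment> \<open>The children's denominators add up to the parent's without its own term: this is
    the E of \<open>carleson_step\<close>.\<close>
  also have "(\<Sum>m'\<in>descendants 1 m. ?D m') = A * M j m + (tree_sum l M (Suc N) j m - l j * (M j m)\<^sup>2)"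
    by (simp add: sum.distrib M[of j m] sum_distrib_left)
  finally have *: "tree_sum l F (Suc N) j m \<le> l j * (F j m)\<^sup>2 + 4 * A * (G j m - A * ((F j m)\<^sup>2 /
      (A * M j m + (tree_sum l M (Suc N) j m - l j * (M j m)\<^sup>2))))"
    by simp
  show ?case
  proof (cases "M j m = 0")
    case True
    then show ?thesis using * F0[of j m] by simp
  next
    case False
    show ?thesis
    proof (rule order_trans[OF *], rule carleson_step[OF A])
      show "M j m > 0" using False M0[of j m] by simp
      show "l j * (M j m)\<^sup>2 \<le> tree_sum l M (Suc N) j m"
        by (simp add: sum_nonneg tree_sum_nonneg[OF l])
      show "tree_sum l M (Suc N) j m \<le> A * M j m" by (rule testing)
    qed (use l in auto)
  qed
qed

section \<open>Dyadic cubes and the Newton kernel\<close>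

text \<open>Rounding down makes the cubes half-open, so each generation partitions space. Only sides
  2^(-j) with j >= 0 are indexed, because the pairs of points to be treated lie within distance
  1.\<close>

definition dyadic_index :: "nat \<Rightarrow> real^'n::finite \<Rightarrow> int^'n" where
  "dyadic_index j x = (\<chi> i. \<lfloor>2 ^ j * x $ i\<rfloor>)"

definition dyadic_cube :: "nat \<Rightarrow> int^'n::finite \<Rightarrow> (real^'n) set" where
  "dyadic_cube j m = {x. dyadic_index j x = m}"

definition neighbors :: "int^'n::finite \<Rightarrow> (int^'n) set" where
  "neighbors m = {m'. \<forall>i. \<bar>m' $ i - m $ i\<bar> \<le> 1}"

definition cube_integral :: "(real^'n::finite \<Rightarrow> real) \<Rightarrow> nat \<Rightarrow> int^'n \<Rightarrow> real" where
  "cube_integral f j m = (LINT x|lebesgue. indicator (dyadic_cube j m) x * f x)"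

lemma mem_dyadic_cube_iff:
  "x \<in> dyadic_cube j m \<longleftrightarrow> (\<forall>i. of_int (m $ i) \<le> 2 ^ j * x $ i \<and> 2 ^ j * x $ i < of_int (m $ i) + 1)"
  by (auto simp: dyadic_cube_def dyadic_index_def vec_eq_iff floor_eq_iff)

lemma dyadic_cube_in_dyadic_cubes: "dyadic_cube j m \<in> dyadic_cubes"
proof -
  have "dyadic_cube j m = {x. \<forall>i. 2 powi (- int j) * of_int (m $ i) \<le> x $ i \<and>
      x $ i < 2 powi (- int j) * (of_int (m $ i) + 1)}"
    by (auto simp: mem_dyadic_cube_iff power_int_minus field_simps)
  then show ?thesis unfolding dyadic_cubes_def by blast
qed

lemma dyadic_cube_borel [measurable]: "dyadic_cube j m \<in> sets borel"
proof -
  have "dyadic_cube j m = (\<Inter>i\<in>UNIV. {x \<in> space borel. of_int (m $ i) \<le> 2 ^ j * x $ i \<and> 2 ^ j * x $ i < of_int (m $ i) + 1})"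
    by (auto simp: mem_dyadic_cube_iff)
  also have "\<dots> \<in> sets borel"
    by (intro sets.finite_INT) measurable
  finally show ?thesis .
qed

lemma dyadic_cube_lebesgue [measurable]: "dyadic_cube j m \<in> sets lebesgue"
  using dyadic_cube_borel by auto

lemma dyadic_index_div: "dyadic_index (j + i) x $ k div 2 ^ i = dyadic_index j x $ k"
proof -
  have "dyadic_index (j + i) x $ k div 2 ^ i = \<lfloor>2 ^ (j + i) * x $ k\<rfloor> div (2 ^ i)"
    by (simp add: dyadic_index_def)
  also have "\<dots> = \<lfloor>(2 ^ (j + i) * x $ k) / of_int (2 ^ i)\<rfloor>"
    by (rule floor_divide_real_eq_div[symmetric]) simp
  also have "\<dots> = dyadic_index j x $ k"
    by (simp add: dyadic_index_def power_add)
  finally show ?thesis .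
qed

lemma dyadic_index_mem_descendants_iff:
  "dyadic_index (j + i) x \<in> descendants i m \<longleftrightarrow> x \<in> dyadic_cube j m"
  by (auto simp: descendants_def dyadic_index_div dyadic_cube_def vec_eq_iff)

lemma sum_indicator_descendants:
  "(\<Sum>m'\<in>descendants i m. indicator (dyadic_cube (j + i) m') x) = (indicator (dyadic_cube j m) x :: real)"
proof -
  have "(\<Sum>m'\<in>descendants i m. indicator (dyadic_cube (j + i) m') x) =
      (\<Sum>m'\<in>descendants i m. if m' = dyadic_index (j + i) x then 1 else 0 :: real)"
    by (intro sum.cong) (auto simp: dyadic_cube_def)
  also have "\<dots> = indicator (dyadic_cube j m) x"
    by (simp add: finite_descendants sum.delta dyadic_index_mem_descendants_iff indicator_def)
  finally show ?thesis .
qed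

lemma integrable_cube:
  fixes f :: "real^'n::finite \<Rightarrow> real"
  shows "integrable lebesgue f \<Longrightarrow> integrable lebesgue (\<lambda>x. indicator (dyadic_cube j m) x * f x)"
  using integrable_mult_indicator[of "dyadic_cube j m" lebesgue f] by simp

lemma cube_integral_descendants:
  assumes "integrable lebesgue f"
  shows "cube_integral f j m = (\<Sum>m'\<in>descendants i m. cube_integral f (j + i) m')"
proof -
  have "cube_integral f j m =
     (LINT x|lebesgue. (\<Sum>m'\<in>descendants i m. indicator (dyadic_cube (j + i) m') x * f x))"
    by (simp add: cube_integral_def sum_distrib_right[symmetric] sum_indicator_descendants)
  also have "\<dots> = (\<Sum>m'\<in>descendants i m. cube_integral f (j + i) m')"
    unfolding cube_integral_def
    by (rule Bochner_Integration.integral_sum) (rule integrable_cube[OF assms])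
  finally show ?thesis .
qed

lemma nn_integral_cube:
  assumes "integrable lebesgue f" "\<And>x. f x \<ge> 0"
  shows "(\<integral>\<^sup>+x. ennreal (indicator (dyadic_cube j m) x * f x) \<partial>lebesgue) = ennreal (cube_integral f j m)"
  unfolding cube_integral_def
  by (rule nn_integral_eq_integral) (use assms integrable_cube in auto)

lemma cube_integral_nonneg: "(\<And>x. f x \<ge> 0) \<Longrightarrow> cube_integral f j m \<ge> 0"
  unfolding cube_integral_def by (rule integral_nonneg_AE) auto

section \<open>Sums over adjacent cubes\<close>

lemma finite_neighbors: "finite (neighbors (m :: int^'n::finite))"
proof -
  have "\<bar>a - b\<bar> \<le> 1 \<longleftrightarrow> a \<in> {b - 1..b + 1}" for a b :: int
    unfolding atLeastAtMost_iff by linarith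
  then have "neighbors m = {m'. \<forall>k. m' $ k \<in> {m $ k - 1..m $ k + 1}}"
    by (simp only: neighbors_def)
  then show ?thesis using finite_vec_box[of "\<lambda>k. {m $ k - 1..m $ k + 1}"] by simp
qed

lemma card_neighbors: "card (neighbors (m :: int^'n::finite)) = card (neighbors (0 :: int^'n))"
proof -
  have "neighbors m = (\<lambda>v. m + v) ` neighbors 0"
  proof (intro set_eqI iffI)
    fix x assume "x \<in> neighbors m"
    then show "x \<in> (\<lambda>v. m + v) ` neighbors 0"
      by (intro image_eqI[of _ _ "x - m"]) (auto simp: neighbors_def)
  qed (auto simp: neighbors_def)
  then show ?thesis by (simp add: card_image)
qed

lemma neighbors_sym: "m' \<in> neighbors m \<longleftrightarrow> m \<in> neighbors m'"
  by (simp add: neighbors_def abs_minus_commute)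

text \<open>The product F m F m' is at most half the sum of the squares. Adjacency is symmetric, so
  in either half a square is counted at most once per neighbour. This makes adjacent pairs harmless
  for a norm that knows only single cubes.\<close>

lemma neighbor_sum_le:
  fixes F :: "int^'n::finite \<Rightarrow> real"
  assumes I: "finite I" and F0: "\<And>m. m \<notin> I \<Longrightarrow> F m = 0"
  shows "(\<Sum>m\<in>I. \<Sum>m'\<in>neighbors m. F m * F m') \<le> real (card (neighbors (0 :: int^'n))) * (\<Sum>m\<in>I. (F m)\<^sup>2)"
proof -
  define c where "c = real (card (neighbors (0 :: int^'n)))"
  have c: "real (card (neighbors m)) = c" for m :: "int^'n"
    unfolding c_def using card_neighbors[of m] by (rule arg_cong)
  have "(\<Sum>m\<in>I. \<Sum>m'\<in>neighbors m. F m * F m') \<le> (\<Sum>m\<in>I. \<Sum>m'\<in>neighbors m. (F m)\<^sup>2 / 2 + (F m')\<^sup>2 / 2)"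
  proof (intro sum_mono)
    fix m m' show "F m * F m' \<le> (F m)\<^sup>2 / 2 + (F m')\<^sup>2 / 2"
      using sum_squares_bound[of "F m" "F m'"] by simp
  qed
  also have "\<dots> = c * (\<Sum>m\<in>I. (F m)\<^sup>2) / 2 + (\<Sum>m\<in>I. \<Sum>m'\<in>neighbors m. (F m')\<^sup>2) / 2"
    by (simp only: sum.distrib sum_constant c sum_divide_distrib[symmetric] sum_distrib_left[symmetric])
  also have "(\<Sum>m\<in>I. \<Sum>m'\<in>neighbors m. (F m')\<^sup>2) = (\<Sum>m\<in>I. \<Sum>m'\<in>I. if m' \<in> neighbors m then (F m')\<^sup>2 else 0)"
  proof (rule sum.cong[OF refl])
    fix m
    have "(\<Sum>m'\<in>neighbors m. (F m')\<^sup>2) = (\<Sum>m'\<in>I \<inter> neighbors m. (F m')\<^sup>2)"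
      by (rule sum.mono_neutral_right) (use F0 in \<open>auto simp: finite_neighbors\<close>)
    also have "\<dots> = (\<Sum>m'\<in>I. if m' \<in> neighbors m then (F m')\<^sup>2 else 0)"
      by (rule sum.inter_restrict[OF I])
    finally show "(\<Sum>m'\<in>neighbors m. (F m')\<^sup>2) = (\<Sum>m'\<in>I. if m' \<in> neighbors m then (F m')\<^sup>2 else 0)" .
  qed
  also have "\<dots> = (\<Sum>m'\<in>I. \<Sum>m\<in>I. if m \<in> neighbors m' then (F m')\<^sup>2 else 0)"
    by (subst sum.swap) (intro sum.cong refl if_cong neighbors_sym)
  also have "\<dots> = (\<Sum>m'\<in>I. real (card (I \<inter> neighbors m')) * (F m')\<^sup>2)"
  proof (rule sum.cong[OF refl])
    fix m'
    show "(\<Sum>m\<in>I. if m \<in> neighbors m' then (F m')\<^sup>2 else 0) = real (card (I \<inter> neighbors m')) * (F m')\<^sup>2"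
      by (subst sum.inter_restrict[OF I, symmetric]) simp
  qed
  also have "\<dots> \<le> (\<Sum>m'\<in>I. c * (F m')\<^sup>2)"
  proof (intro sum_mono mult_right_mono)
    fix m'
    have "card (I \<inter> neighbors m') \<le> card (neighbors m')"
      by (intro card_mono finite_neighbors) auto
    then show "real (card (I \<inter> neighbors m')) \<le> c" using c[of m'] by simp
  qed simp
  finally show ?thesis unfolding c_def[symmetric] sum_distrib_left[symmetric] by simp
qed

section \<open>Comparing the Newton kernel with dyadic sums\<close>

lemma sum_geometric_le:
  fixes q X :: real
  assumes "q \<ge> 2" "finite S" "\<And>j. j \<in> S \<Longrightarrow> q ^ j \<le> X" "X \<ge> 0"
  shows "(\<Sum>j\<in>S. q ^ j) \<le> 2 * X"
proof (cases "S = {}")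
  case False
  have "(\<Sum>j\<le>J. q ^ j) \<le> 2 * q ^ J" for J
  proof (induction J)
    case (Suc J)
    have "2 * q ^ J \<le> q * q ^ J" using assms(1) by (intro mult_right_mono) auto
    then show ?case using Suc by simp
  qed (use assms(1) in simp)
  from this[of "Max S"] have "(\<Sum>j\<le>Max S. q ^ j) \<le> 2 * X"
    using assms(3)[OF Max_in[OF assms(2) False]] by linarith
  moreover have "(\<Sum>j\<in>S. q ^ j) \<le> (\<Sum>j\<le>Max S. q ^ j)"
    using assms by (intro sum_mono2) auto
  ultimately show ?thesis by simp
qed (use assms in simp)

lemma norm_diff_le_if_same_dyadic_index:
  fixes x y :: "real^'n::finite"
  assumes "dyadic_index j x = dyadic_index j y"
  shows "2 ^ j * norm (x - y) \<le> real CARD('n)"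
proof -
  have "2 ^ j * \<bar>(x - y) $ i\<bar> \<le> 1" for i
  proof -
    have "\<lfloor>2 ^ j * x $ i\<rfloor> = \<lfloor>2 ^ j * y $ i\<rfloor>"
      using assms by (simp add: dyadic_index_def vec_eq_iff)
    then have "\<bar>2 ^ j * x $ i - 2 ^ j * y $ i\<bar> \<le> 1" by linarith
    then show ?thesis by (simp add: abs_mult flip: right_diff_distrib)
  qed
  then have "(\<Sum>i\<in>UNIV. 2 ^ j * \<bar>(x - y) $ i\<bar>) \<le> (\<Sum>i\<in>(UNIV::'n set). 1)"
    by (intro sum_mono) auto
  then have "2 ^ j * (\<Sum>i\<in>UNIV. \<bar>(x - y) $ i\<bar>) \<le> real CARD('n)"
    by (simp add: sum_distrib_left)
  moreover have "2 ^ j * norm (x - y) \<le> 2 ^ j * (\<Sum>i\<in>UNIV. \<bar>(x - y) $ i\<bar>)"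
    by (intro mult_left_mono norm_le_l1_cart) auto
  ultimately show ?thesis by linarith
qed

lemma neighbors_if_close:
  fixes x y :: "real^'n::finite"
  assumes "norm (x - y) < 1 / 2 ^ j"
  shows "dyadic_index j y \<in> neighbors (dyadic_index j x)"
proof -
  have "\<bar>\<lfloor>2 ^ j * y $ i\<rfloor> - \<lfloor>2 ^ j * x $ i\<rfloor>\<bar> \<le> 1" for i
  proof -
    have "\<bar>(x - y) $ i\<bar> < 1 / 2 ^ j"
      using component_le_norm_cart[of "x - y" i] assms by linarith
    then have "2 ^ j * \<bar>(x - y) $ i\<bar> < 1" by (simp add: field_simps)
    then have "\<bar>2 ^ j * x $ i - 2 ^ j * y $ i\<bar> < 1"
      by (simp add: abs_mult flip: right_diff_distrib)
    then show ?thesis by linarith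
  qed
  then show ?thesis by (simp add: neighbors_def dyadic_index_def)
qed

text \<open>Two points share a cube of side 2^(-j) only while 2^j \<le> n / |x - y|, so the
  geometric sum is controlled by its largest term. No converse can hold: close points on opposite
  sides of a coordinate hyperplane share no cube at all, hence the adjacent cubes in the opposite
  estimate.\<close>

lemma sum_same_dyadic_index_le:
  fixes x y :: "real^'n::finite"
  assumes p: "p \<ge> 1" and xy: "x \<noteq> y" and S: "finite S"
  shows "(\<Sum>j\<in>S. if dyadic_index j x = dyadic_index j y then 2 ^ (j * p) else 0) \<le> 2 * real CARD('n) ^ p / norm (x - y) ^ p"
proof -
  have "(\<Sum>j\<in>S. if dyadic_index j x = dyadic_index j y then 2 ^ (j * p) else 0) =
      (\<Sum>j\<in>{j\<in>S. dyadic_index j x = dyadic_index j y}. (2 ^ p) ^ j :: real)"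
    using S by (simp add: sum.inter_filter power_mult[symmetric] mult.commute)
  also have "\<dots> \<le> 2 * (real CARD('n) ^ p / norm (x - y) ^ p)"
  proof (rule sum_geometric_le)
    have "(2::real) ^ 1 \<le> 2 ^ p" using p by (intro power_increasing) auto
    then show "(2::real) \<le> 2 ^ p" by simp
    fix j assume "j \<in> {j\<in>S. dyadic_index j x = dyadic_index j y}"
    then have "(2 ^ j * norm (x - y)) ^ p \<le> real CARD('n) ^ p"
      by (intro power_mono norm_diff_le_if_same_dyadic_index) auto
    then show "(2 ^ p) ^ j \<le> real CARD('n) ^ p / norm (x - y) ^ p"
      using xy by (simp add: field_simps power_mult_distrib) (simp add: mult.commute flip: power_mult)
  qed (use S in auto)
  finally show ?thesis by simp
qed

text \<open>The single scale with 2^(-j-1) \<le> |z| < 2^(-j) already supplies the kernel up to the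
  factor 2^p, and |z| < 1 guarantees j >= 0.\<close>

lemma inverse_power_norm_le_dyadic_sum:
  fixes z :: "'a::real_normed_vector"
  assumes "p \<ge> 1" "norm z < 1"
  shows "ennreal (1 / norm z ^ p) \<le> ennreal (2 ^ p) * (\<Sum>j. ennreal (2 ^ (j * p)) * indicator (ball 0 (1 / 2 ^ j)) z)"
proof (cases "z = 0")
  \<comment> \<open>At the origin the left side is 1 / 0 = 0, in agreement with the diagonal value
    in \<open>ks_energy\<close>.\<close>
  case True
  then have "ennreal (1 / norm z ^ p) = 0" using assms by (simp add: power_0_left)
  then show ?thesis by (simp only: zero_le)
next
  case False
  define P where "P = (\<lambda>j. 1 / 2 ^ Suc j \<le> norm z)"
  obtain n where "(1/2) ^ n < norm z"
    using real_arch_pow_inv[of "norm z" "1/2"] False by auto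
  moreover have "(1/2::real) ^ Suc n \<le> (1/2) ^ n" by (intro power_decreasing) auto
  ultimately have "P n" by (simp add: P_def power_divide)
  define j where "j = (LEAST j. P j)"
  have j: "1 / 2 ^ Suc j \<le> norm z"
    using LeastI[of P, OF \<open>P n\<close>] unfolding j_def[symmetric] by (simp only: P_def)
  have j2: "norm z < 1 / 2 ^ j"
  proof (cases j)
    case (Suc i)
    then have "i < (LEAST j. P j)" unfolding j_def[symmetric] by simp
    then have "\<not> P i" by (rule not_less_Least)
    then show ?thesis unfolding Suc P_def by linarith
  qed (use assms in simp)
  have "1 / norm z \<le> 2 ^ Suc j"
    using j False by (simp add: field_simps)
  then have "(1 / norm z) ^ p \<le> (2 ^ Suc j) ^ p"
    by (rule power_mono) simp
  moreover have "(2 ^ Suc j) ^ p = (2::real) ^ p * 2 ^ (j * p)"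
    unfolding power_Suc power_mult_distrib by (simp only: power_mult)
  ultimately have "1 / norm z ^ p \<le> 2 ^ p * 2 ^ (j * p)"
    by (simp add: power_divide)
  then have "ennreal (1 / norm z ^ p) \<le> ennreal (2 ^ p) * ennreal (2 ^ (j * p))"
    by (simp add: ennreal_mult[symmetric] ennreal_leI)
  also have "\<dots> \<le> ennreal (2 ^ p) * (\<Sum>j. ennreal (2 ^ (j * p)) * indicator (ball 0 (1 / 2 ^ j)) z)"
  proof (rule mult_left_mono)
    have "(\<Sum>i\<in>{j}. ennreal (2 ^ (i * p)) * indicator (ball 0 (1 / 2 ^ i)) z) \<le>
        (\<Sum>i. ennreal (2 ^ (i * p)) * indicator (ball 0 (1 / 2 ^ i)) z)"
      by (rule sum_le_suminf) auto
    then show "ennreal (2 ^ (j * p)) \<le> (\<Sum>j. ennreal (2 ^ (j * p)) * indicator (ball 0 (1 / 2 ^ j)) z)"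
      using j2 by simp
  qed simp
  finally show ?thesis .
qed

section \<open>The Kerman-Sawyer energy estimate\<close>

text \<open>This yields the testing hypothesis of the Carleson embedding. The square of a cube
  integral is a double integral over the cube times itself, so the weighted sum over subcubes is a
  double integral against the kernel that adds 2^(k p) for each generation k in which x and y share
  a cube. \<open>sum_same_dyadic_index_le\<close> bounds that kernel by the Newton kernel.\<close>

lemma tree_sum_le_ks_energy:
  fixes V :: "real^'n::finite \<Rightarrow> complex"
  assumes n: "CARD('n) \<ge> 3" and V: "integrable lebesgue (\<lambda>x. norm (V x))"
  shows "ennreal (tree_sum (\<lambda>j. 2 ^ (j * (CARD('n) - 2))) (cube_integral (\<lambda>x. norm (V x))) N j m)
     \<le> ennreal (2 * real CARD('n) ^ (CARD('n) - 2)) * ks_energy V (dyadic_cube j m)"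
proof -
  define p where "p = CARD('n) - 2"
  have p: "p \<ge> 1" using n by (simp add: p_def)
  define W where "W = (\<lambda>x. norm (V x))"
  have W: "integrable lebesgue W" using V by (simp add: W_def)
  have W0: "W x \<ge> 0" for x by (simp add: W_def)
  define c where "c = 2 * real CARD('n) ^ p"
  have c0: "c \<ge> 0" by (simp add: c_def)
  define Q where "Q = dyadic_cube j m"
  define f where "f = (\<lambda>i m' x. indicator (dyadic_cube (j + i) m') x * W x)"
  have f0: "f i m' x \<ge> 0" for i m' x by (simp add: f_def W0)
  have f_meas [measurable]: "(\<lambda>x. ennreal (f i m' x)) \<in> borel_measurable lebesgue" for i m'
    using integrable_cube[OF W, of "j + i" m'] by (simp add: f_def)
  \<comment> \<open>That kernel, with the densities included. In each generation at most one
    descendant contains x, and it contributes only if it also contains y.\<close>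
  define R where "R = (\<lambda>x y. \<Sum>i<N. \<Sum>m'\<in>descendants i m. 2 ^ ((j + i) * p) * (f i m' x * f i m' y))"
  have R_le: "R x y \<le> c * (norm (V x * V y) / norm (x - y) ^ p) * indicator Q y * indicator Q x"
    if xy: "x \<noteq> y" for x y
  proof -
    have inner: "(\<Sum>m'\<in>descendants i m. f i m' x * f i m' y) \<le>
        (if dyadic_index (j + i) x = dyadic_index (j + i) y then 1 else 0) * (indicator Q x * indicator Q y * (W x * W y))" for i
    proof -
      have "(\<Sum>m'\<in>descendants i m. f i m' x * f i m' y) =
        (\<Sum>m'\<in>descendants i m. if m' = dyadic_index (j + i) x then
           (if dyadic_index (j + i) x = dyadic_index (j + i) y then 1 else 0) * (W x * W y) else 0)"
        by (intro sum.cong) (auto simp: f_def dyadic_cube_def)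
      also have "\<dots> = (if x \<in> Q then (if dyadic_index (j + i) x = dyadic_index (j + i) y then 1 else 0) * (W x * W y) else 0)"
        by (simp add: finite_descendants sum.delta dyadic_index_mem_descendants_iff Q_def)
      also have "\<dots> = (if dyadic_index (j + i) x = dyadic_index (j + i) y then 1 else 0) * (indicator Q x * indicator Q y * (W x * W y))"
      proof -
        have "y \<in> Q" if "x \<in> Q" "dyadic_index (j + i) x = dyadic_index (j + i) y"
          using that dyadic_index_mem_descendants_iff[of j i x m] dyadic_index_mem_descendants_iff[of j i y m]
          by (simp add: Q_def)
        then show ?thesis by (auto split: split_indicator)
      qed
      finally show ?thesis by simp
    qed
    have "R x y = (\<Sum>i<N. 2 ^ ((j + i) * p) * (\<Sum>m'\<in>descendants i m. f i m' x * f i m' y))"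
      by (simp add: R_def sum_distrib_left)
    also have "\<dots> \<le> (\<Sum>i<N. 2 ^ ((j + i) * p) * ((if dyadic_index (j + i) x = dyadic_index (j + i) y then 1 else 0) *
         (indicator Q x * indicator Q y * (W x * W y))))"
      by (intro sum_mono mult_left_mono inner) auto
    also have "\<dots> = (\<Sum>i<N. if dyadic_index (j + i) x = dyadic_index (j + i) y then 2 ^ ((j + i) * p) else 0) *
         (indicator Q x * indicator Q y * (W x * W y))"
      by (subst sum_distrib_right) (intro sum.cong refl, simp)
    also have "(\<Sum>i<N. if dyadic_index (j + i) x = dyadic_index (j + i) y then 2 ^ ((j + i) * p) else 0) =
       (\<Sum>k\<in>{j..<j + N}. if dyadic_index k x = dyadic_index k y then 2 ^ (k * p) else (0::real))"
      by (rule sum.reindex_bij_witness[of _ "\<lambda>k. k - j" "\<lambda>i. j + i"]) auto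
    also have "\<dots> * (indicator Q x * indicator Q y * (W x * W y)) \<le>
       (c / norm (x - y) ^ p) * (indicator Q x * indicator Q y * (W x * W y))"
      using sum_same_dyadic_index_le[OF p xy, of "{j..<j + N}"] W0 by (intro mult_right_mono) (auto simp: c_def)
    also have "\<dots> = c * (norm (V x * V y) / norm (x - y) ^ p) * indicator Q y * indicator Q x"
      by (simp add: W_def norm_mult)
    finally show ?thesis .
  qed
  have R_nn: "ennreal (R x y) = (\<Sum>i<N. \<Sum>m'\<in>descendants i m. ennreal (2 ^ ((j + i) * p)) * (ennreal (f i m' x) * ennreal (f i m' y)))"
    for x y
    unfolding R_def
    by (subst sum_ennreal[symmetric], force intro!: sum_nonneg mult_nonneg_nonneg f0, rule sum.cong[OF refl],
        subst sum_ennreal[symmetric], force intro!: mult_nonneg_nonneg f0, rule sum.cong[OF refl])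
       (simp add: ennreal_mult f0)
  have int_f: "(\<integral>\<^sup>+x. ennreal (f i m' x) \<partial>lebesgue) = ennreal (cube_integral W (j + i) m')" for i m'
    unfolding f_def by (rule nn_integral_cube[OF W W0])
  have cube0: "cube_integral W k m' \<ge> 0" for k m' by (rule cube_integral_nonneg[OF W0])
  have "ennreal (tree_sum (\<lambda>j. 2 ^ (j * p)) (cube_integral W) N j m) =
     (\<Sum>i<N. \<Sum>m'\<in>descendants i m. ennreal (2 ^ ((j + i) * p)) *
       (ennreal (cube_integral W (j + i) m') * ennreal (cube_integral W (j + i) m')))"
    unfolding tree_sum_eq sum_distrib_left
    by (subst sum_ennreal[symmetric], force intro!: sum_nonneg mult_nonneg_nonneg, rule sum.cong[OF refl],
        subst sum_ennreal[symmetric], force intro!: mult_nonneg_nonneg, rule sum.cong[OF refl])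
       (simp add: ennreal_mult cube0 power2_eq_square)
  also have "\<dots> = (\<integral>\<^sup>+x. \<integral>\<^sup>+y. ennreal (R x y) \<partial>lebesgue \<partial>lebesgue)"
    unfolding R_nn
    by (simp add: nn_integral_sum nn_integral_cmult nn_integral_multc int_f)
  also have "\<dots> \<le> (\<integral>\<^sup>+x. \<integral>\<^sup>+y. ennreal c * ennreal (norm (V x * V y) / norm (x - y) ^ p) * indicator Q y * indicator Q x \<partial>lebesgue \<partial>lebesgue)"
  proof (rule nn_integral_mono, rule nn_integral_mono_AE)
    fix x :: "real^'n"
    \<comment> \<open>The point y = x is removed because the Newton kernel takes the value 0 there
      while \<open>R\<close> need not vanish.\<close>
    have "AE y in lebesgue. y \<notin> {x}" by (rule AE_not_in) simp
    then show "AE y in lebesgue. ennreal (R x y) \<le> ennreal c * ennreal (norm (V x * V y) / norm (x - y) ^ p) * indicator Q y * indicator Q x"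
    proof eventually_elim
      case (elim y)
      then have "ennreal (R x y) \<le> ennreal (c * (norm (V x * V y) / norm (x - y) ^ p) * indicator Q y * indicator Q x)"
        by (intro ennreal_leI R_le) auto
      also have "\<dots> = ennreal c * ennreal (norm (V x * V y) / norm (x - y) ^ p) * indicator Q y * indicator Q x"
        using c0 by (cases "x \<in> Q"; cases "y \<in> Q") (simp_all add: ennreal_mult del: times_divide_eq_right)
      finally show ?case .
    qed
  qed
  also have "\<dots> = ennreal c * ks_energy V Q"
  proof -
    have Vm [measurable]: "W \<in> borel_measurable lebesgue" using W by auto
    have Qm [measurable]: "Q \<in> sets lebesgue" by (simp add: Q_def)
    have m2: "(\<lambda>(x, y). ennreal (norm (V x * V y) / norm (x - y) ^ p) * indicator Q y) \<in> borel_measurable (lebesgue \<Otimes>\<^sub>M lebesgue)"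
    proof -
      have "(\<lambda>(x, y). norm (x - y) :: real) \<in> borel_measurable (lebesgue \<Otimes>\<^sub>M (lebesgue :: (real^'n) measure))"
        by (rule measurable_lebesgue_pair) (simp add: case_prod_beta borel_measurable_continuous_onI continuous_intros)
      note [measurable] = this
      have "(\<lambda>(x, y). ennreal (W x * W y / (case (x, y) of (x, y) \<Rightarrow> norm (x - y)) ^ p) * indicator Q y)
          \<in> borel_measurable (lebesgue \<Otimes>\<^sub>M lebesgue)"
        by measurable
      then show ?thesis by (simp add: W_def norm_mult)
    qed
    have m1: "(\<lambda>y. ennreal (norm (V x * V y) / norm (x - y) ^ p) * indicator Q y) \<in> borel_measurable lebesgue" for x
      using measurable_Pair2[OF m2, of x] by simp
    have m3: "(\<lambda>x. \<integral>\<^sup>+y. ennreal (norm (V x * V y) / norm (x - y) ^ p) * indicator Q y \<partial>lebesgue) \<in> borel_measurable lebesgue"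
      using lebesgue.borel_measurable_nn_integral[OF m2] .
    have "(\<integral>\<^sup>+x. \<integral>\<^sup>+y. ennreal c * ennreal (norm (V x * V y) / norm (x - y) ^ p) * indicator Q y * indicator Q x \<partial>lebesgue \<partial>lebesgue)
       = (\<integral>\<^sup>+x. ennreal c * ((\<integral>\<^sup>+y. ennreal (norm (V x * V y) / norm (x - y) ^ p) * indicator Q y \<partial>lebesgue) * indicator Q x) \<partial>lebesgue)"
    proof (rule nn_integral_cong)
      fix x
      let ?k = "\<lambda>y. ennreal (norm (V x * V y) / norm (x - y) ^ p) * indicator Q y"
      have "(\<integral>\<^sup>+y. ennreal c * ennreal (norm (V x * V y) / norm (x - y) ^ p) * indicator Q y * indicator Q x \<partial>lebesgue)
        = (\<integral>\<^sup>+y. ?k y * (ennreal c * indicator Q x) \<partial>lebesgue)"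
        by (intro nn_integral_cong) (simp only: mult_ac)
      also have "\<dots> = (\<integral>\<^sup>+y. ?k y \<partial>lebesgue) * (ennreal c * indicator Q x)"
        by (rule nn_integral_multc[OF m1])
      finally show "(\<integral>\<^sup>+y. ennreal c * ennreal (norm (V x * V y) / norm (x - y) ^ p) * indicator Q y * indicator Q x \<partial>lebesgue)
        = ennreal c * ((\<integral>\<^sup>+y. ?k y \<partial>lebesgue) * indicator Q x)"
        by (simp only: mult_ac)
    qed
    also have "\<dots> = ennreal c * ks_energy V Q"
      unfolding ks_energy_def p_def[symmetric]
    proof (rule nn_integral_cmult)
      note m3[measurable]
      show "(\<lambda>x. (\<integral>\<^sup>+y. ennreal (norm (V x * V y) / norm (x - y) ^ p) * indicator Q y \<partial>lebesgue) * indicator Q x) \<in> borel_measurable lebesgue"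
        by measurable
    qed
    finally show ?thesis .
  qed
  finally show ?thesis by (simp add: W_def c_def Q_def p_def)
qed

lemma ks_energy_le:
  assumes "ks_norm V \<le> K" "Q \<in> dyadic_cubes" "K < \<infinity>"
  shows "ks_energy V Q \<le> K * ks_mass V Q" "ks_mass V Q < \<infinity>"
proof -
  have *: "(if ks_mass V Q = \<infinity> then \<infinity> else inverse (ks_mass V Q) * ks_energy V Q) \<le> K"
    using assms(1,2) unfolding ks_norm_def by (meson SUP_upper order_trans)
  then show fin: "ks_mass V Q < \<infinity>"
    using assms(3) by (auto split: if_splits simp: less_top top_unique)
  show "ks_energy V Q \<le> K * ks_mass V Q"
  proof (cases "ks_mass V Q = 0")
    \<comment> \<open>In \<open>ennreal\<close> the inverse of 0 is infinite, so a finite K forces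
      the energy of a cube without mass to be 0.\<close>
    case True
    then have "top * ks_energy V Q \<le> K" using * by simp
    then have "ks_energy V Q = 0" using assms(3)
      by (metis ennreal_top_mult infinity_ennreal_def not_less top_greatest top.extremum_unique)
    then show ?thesis by simp
  next
    case False
    then have "ks_energy V Q = (ks_mass V Q * inverse (ks_mass V Q)) * ks_energy V Q"
      using fin by (simp add: ennreal_inverse_mult less_top divide_ennreal_def[symmetric] ennreal_divide_self)
    also have "\<dots> = ks_mass V Q * (inverse (ks_mass V Q) * ks_energy V Q)" by (simp add: mult.assoc)
    also have "\<dots> \<le> ks_mass V Q * K"
    proof (rule mult_left_mono)
      have "ks_mass V Q \<noteq> \<infinity>" using fin by auto
      then show "inverse (ks_mass V Q) * ks_energy V Q \<le> K" using * by (simp only: if_False)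
    qed simp
    finally show ?thesis by (simp add: mult.commute)
  qed
qed

section \<open>Energy of a function supported in a small ball\<close>

lemma finite_dyadic_index_ball: "finite (dyadic_index j ` ball (a :: real^'n::finite) r)"
proof (rule finite_subset)
  show "dyadic_index j ` ball a r \<subseteq> {m. \<forall>i. m $ i \<in> {\<lfloor>2 ^ j * (a $ i - r)\<rfloor>..\<lfloor>2 ^ j * (a $ i + r)\<rfloor>}}"
  proof clarify
    fix x i assume "x \<in> ball a r"
    then have "\<bar>(a - x) $ i\<bar> < r"
      using component_le_norm_cart[of "a - x" i] by (simp add: dist_norm)
    then have "a $ i - r \<le> x $ i" "x $ i \<le> a $ i + r" by auto
    then have "2 ^ j * (a $ i - r) \<le> 2 ^ j * x $ i" "2 ^ j * x $ i \<le> 2 ^ j * (a $ i + r)"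
      by (intro mult_left_mono; simp)+
    then show "dyadic_index j x $ i \<in> {\<lfloor>2 ^ j * (a $ i - r)\<rfloor>..\<lfloor>2 ^ j * (a $ i + r)\<rfloor>}"
      by (simp add: dyadic_index_def floor_mono)
  qed
qed (rule finite_vec_box, simp)

lemma sum_indicator_cubes_ball:
  assumes "x \<in> ball a r"
  shows "(\<Sum>m\<in>dyadic_index j ` ball a r. indicator (dyadic_cube j m) x) = (1::real)"
proof -
  have "(\<Sum>m\<in>dyadic_index j ` ball a r. indicator (dyadic_cube j m) x) =
     (\<Sum>m\<in>dyadic_index j ` ball a r. if m = dyadic_index j x then 1 else (0::real))"
    by (intro sum.cong) (auto simp: dyadic_cube_def)
  then show ?thesis using assms finite_dyadic_index_ball[of j a r] by (simp add: sum.delta)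
qed

lemma sum_cube_integral_ball:
  fixes h :: "real^'n::finite \<Rightarrow> real"
  assumes h: "integrable lebesgue h" and h0: "\<And>x. x \<notin> ball a r \<Longrightarrow> h x = 0"
  shows "(\<Sum>m\<in>dyadic_index j ` ball a r. cube_integral h j m) = (LINT x|lebesgue. h x)"
proof -
  have "(\<Sum>m\<in>dyadic_index j ` ball a r. cube_integral h j m) =
     (LINT x|lebesgue. (\<Sum>m\<in>dyadic_index j ` ball a r. indicator (dyadic_cube j m) x * h x))"
    unfolding cube_integral_def
    by (rule Bochner_Integration.integral_sum[symmetric]) (rule integrable_cube[OF h])
  also have "\<dots> = (LINT x|lebesgue. h x)"
  proof (rule Bochner_Integration.integral_cong[OF refl])
    fix x
    show "(\<Sum>m\<in>dyadic_index j ` ball a r. indicator (dyadic_cube j m) x * h x) = h x"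
      by (cases "x \<in> ball a r") (simp_all add: h0 sum_indicator_cubes_ball flip: sum_distrib_right)
  qed
  finally show ?thesis .
qed

text \<open>Since r \<le> 1/2, all pairs of points are closer than 1 and the kernel splits into
  scales j >= 0. Points closer than 2^(-j) lie in equal or adjacent cubes of side 2^(-j); after
  integration \<open>neighbor_sum_le\<close> leaves only squares of single cube integrals.\<close>

lemma energy_le_dyadic:
  fixes g :: "real^'n::finite \<Rightarrow> real"
  assumes p: "p \<ge> 1" and r: "r \<le> 1 / 2" and g: "integrable lebesgue g" and g0: "\<And>x. g x \<ge> 0"
    and gB: "\<And>x. x \<notin> ball a r \<Longrightarrow> g x = 0"
  shows "(\<integral>\<^sup>+x. \<integral>\<^sup>+y. ennreal (g x * g y / norm (x - y) ^ p) \<partial>lebesgue \<partial>lebesgue) \<le>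
    ennreal (2 ^ p) * (\<Sum>j. ennreal (2 ^ (j * p) * (real (card (neighbors (0 :: int^'n))) *
       (\<Sum>m\<in>dyadic_index j ` ball a r. (cube_integral g j m)\<^sup>2))))"
proof -
  define I where "I = (\<lambda>j. dyadic_index j ` ball a r)"
  have I: "finite (I j)" for j unfolding I_def by (rule finite_dyadic_index_ball)
  define f where "f = (\<lambda>j m x. ennreal (indicator (dyadic_cube j m) x * g x))"
  have f_meas [measurable]: "f j m \<in> borel_measurable lebesgue" for j m
    using integrable_cube[OF g, of j m] by (simp add: f_def)
  have f_int: "(\<integral>\<^sup>+x. f j m x \<partial>lebesgue) = ennreal (cube_integral g j m)" for j m
    unfolding f_def by (rule nn_integral_cube[OF g g0])
  define T where "T = (\<lambda>j x y. \<Sum>m\<in>I j. \<Sum>m'\<in>neighbors m. f j m x * f j m' y)"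
  have le: "ennreal (g x * g y / norm (x - y) ^ p) \<le> ennreal (2 ^ p) * (\<Sum>j. ennreal (2 ^ (j * p)) * T j x y)" for x y
  proof (cases "x \<in> ball a r \<and> y \<in> ball a r")
    case True
    have "dist x y \<le> dist x a + dist a y" by (rule dist_triangle)
    then have xy: "norm (x - y) < 1" using True r by (simp add: dist_norm norm_minus_commute)
    have T: "ennreal (g x * g y) * indicator (ball 0 (1 / 2 ^ j)) (x - y) \<le> T j x y" for j
    proof (cases "norm (x - y) < 1 / 2 ^ j")
      case close: True
      have "ennreal (g x * g y) = f j (dyadic_index j x) x * f j (dyadic_index j y) y"
        by (simp add: f_def dyadic_cube_def ennreal_mult g0)
      also have "\<dots> \<le> (\<Sum>m'\<in>neighbors (dyadic_index j x). f j (dyadic_index j x) x * f j m' y)"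
        using neighbors_if_close[OF close] by (intro member_le_sum) (auto simp: finite_neighbors)
      also have "\<dots> \<le> T j x y"
        unfolding T_def using True
        by (intro member_le_sum[of "dyadic_index j x" "I j" "\<lambda>m. \<Sum>m'\<in>neighbors m. f j m x * f j m' y"])
           (auto simp: I_def finite_dyadic_index_ball)
      finally show ?thesis using close by simp
    qed simp
    have "ennreal (g x * g y / norm (x - y) ^ p) = ennreal (g x * g y) * ennreal (1 / norm (x - y) ^ p)"
      using g0 by (simp flip: ennreal_mult)
    also have "\<dots> \<le> ennreal (g x * g y) * (ennreal (2 ^ p) * (\<Sum>j. ennreal (2 ^ (j * p)) * indicator (ball 0 (1 / 2 ^ j)) (x - y)))"
      by (intro mult_left_mono inverse_power_norm_le_dyadic_sum p xy) simp
    also have "\<dots> = ennreal (2 ^ p) * (\<Sum>j. ennreal (g x * g y) * (ennreal (2 ^ (j * p)) * indicator (ball 0 (1 / 2 ^ j)) (x - y)))"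
      by (subst ennreal_suminf_cmult) (simp only: mult.left_commute)
    also have "\<dots> \<le> ennreal (2 ^ p) * (\<Sum>j. ennreal (2 ^ (j * p)) * T j x y)"
    proof (intro mult_left_mono suminf_le)
      fix j
      show "ennreal (g x * g y) * (ennreal (2 ^ (j * p)) * indicator (ball 0 (1 / 2 ^ j)) (x - y)) \<le> ennreal (2 ^ (j * p)) * T j x y"
        using mult_left_mono[OF T[of j], of "ennreal (2 ^ (j * p))"] by (simp add: mult.left_commute)
    qed auto
    finally show ?thesis .
  next
    case False
    then have "g x * g y / norm (x - y) ^ p = 0" using gB by auto
    then show ?thesis by (simp only: ennreal_0 zero_le)
  qed
  have "(\<integral>\<^sup>+x. \<integral>\<^sup>+y. ennreal (g x * g y / norm (x - y) ^ p) \<partial>lebesgue \<partial>lebesgue) \<le>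
     (\<integral>\<^sup>+x. \<integral>\<^sup>+y. ennreal (2 ^ p) * (\<Sum>j. ennreal (2 ^ (j * p)) * T j x y) \<partial>lebesgue \<partial>lebesgue)"
    by (intro nn_integral_mono le)
  also have "\<dots> = ennreal (2 ^ p) * (\<Sum>j. ennreal (2 ^ (j * p)) *
      (\<Sum>m\<in>I j. \<Sum>m'\<in>neighbors m. ennreal (cube_integral g j m) * ennreal (cube_integral g j m')))"
    unfolding T_def
    by (simp add: nn_integral_cmult nn_integral_suminf nn_integral_sum nn_integral_multc f_int)
  also have "\<dots> \<le> ennreal (2 ^ p) * (\<Sum>j. ennreal (2 ^ (j * p) * (real (card (neighbors (0 :: int^'n))) *
       (\<Sum>m\<in>I j. (cube_integral g j m)\<^sup>2))))"
  proof (intro mult_left_mono suminf_le)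
    fix j
    have c0: "cube_integral g j m \<ge> 0" for m by (rule cube_integral_nonneg[OF g0])
    have "cube_integral g j m = 0" if "m \<notin> I j" for m
    proof -
      have "indicator (dyadic_cube j m) x * g x = 0" for x
      proof (cases "x \<in> ball a r")
        case True
        then have "dyadic_index j x \<in> I j" by (simp add: I_def)
        then have "x \<notin> dyadic_cube j m" using that by (auto simp: dyadic_cube_def)
        then show ?thesis by simp
      qed (simp add: gB)
      then show ?thesis by (simp only: cube_integral_def integral_zero)
    qed
    then have "(\<Sum>m\<in>I j. \<Sum>m'\<in>neighbors m. cube_integral g j m * cube_integral g j m') \<le>
       real (card (neighbors (0 :: int^'n))) * (\<Sum>m\<in>I j. (cube_integral g j m)\<^sup>2)"
      by (rule neighbor_sum_le[OF I])
    then have "2 ^ (j * p) * (\<Sum>m\<in>I j. \<Sum>m'\<in>neighbors m. cube_integral g j m * cube_integral g j m') \<le>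
       2 ^ (j * p) * (real (card (neighbors (0 :: int^'n))) * (\<Sum>m\<in>I j. (cube_integral g j m)\<^sup>2))"
      by (rule mult_left_mono) simp
    moreover have "ennreal (2 ^ (j * p)) * (\<Sum>m\<in>I j. \<Sum>m'\<in>neighbors m. ennreal (cube_integral g j m) * ennreal (cube_integral g j m'))
      = ennreal (2 ^ (j * p) * (\<Sum>m\<in>I j. \<Sum>m'\<in>neighbors m. cube_integral g j m * cube_integral g j m'))"
      by (simp add: ennreal_mult c0 sum_nonneg sum_ennreal[symmetric])
    ultimately show "ennreal (2 ^ (j * p)) * (\<Sum>m\<in>I j. \<Sum>m'\<in>neighbors m. ennreal (cube_integral g j m) * ennreal (cube_integral g j m'))
       \<le> ennreal (2 ^ (j * p) * (real (card (neighbors (0 :: int^'n))) * (\<Sum>m\<in>I j. (cube_integral g j m)\<^sup>2)))"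
      by (simp only: ennreal_leI)
  qed auto
  finally show ?thesis by (simp only: I_def)
qed


text \<open>The constant is a product of four origins: 2^p from decomposing the kernel, the number
  of neighbours from decoupling adjacent cubes, 4 from the Carleson embedding, and the testing
  constant 2 n^p K. The hypothesis \<open>gh\<close> keeps V out of any denominator.\<close>

lemma kerman_sawyer_energy_bound:
  fixes V :: "real^'n::finite \<Rightarrow> complex" and g h :: "real^'n \<Rightarrow> real"
  assumes n: "CARD('n) \<ge> 3" and r: "r \<le> 1 / 2"
    and V: "V \<in> borel_measurable lebesgue" "\<And>x. x \<notin> ball a r \<Longrightarrow> V x = 0"
    and K: "ks_norm V \<le> ennreal K" "K > 0"
    and g: "integrable lebesgue g" "\<And>x. g x \<ge> 0" "\<And>x. x \<notin> ball a r \<Longrightarrow> g x = 0"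
    and h: "integrable lebesgue h" "\<And>x. h x \<ge> 0" "\<And>x. x \<notin> ball a r \<Longrightarrow> h x = 0"
    and gh: "AE x in lebesgue. (g x)\<^sup>2 \<le> norm (V x) * h x"
  shows "(\<integral>\<^sup>+x. \<integral>\<^sup>+y. ennreal (g x * g y / norm (x - y) ^ (CARD('n) - 2)) \<partial>lebesgue \<partial>lebesgue) \<le>
    ennreal (2 ^ (CARD('n) - 2) * (real (card (neighbors (0 :: int^'n))) *
      (4 * (2 * real CARD('n) ^ (CARD('n) - 2) * K) * (LINT x|lebesgue. h x))))"
proof -
  define p where "p = CARD('n) - 2"
  have p: "p \<ge> 1" using n by (simp add: p_def)
  define W where "W = (\<lambda>x. norm (V x))"
  have W0: "W x \<ge> 0" for x by (simp add: W_def)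
  have [measurable]: "W \<in> borel_measurable lebesgue" using V(1) by (simp add: W_def)
  define I where "I = (\<lambda>j. dyadic_index j ` ball a r)"
  have I: "finite (I j)" for j unfolding I_def by (rule finite_dyadic_index_ball)
  note ks = ks_energy_le[OF K(1) dyadic_cube_in_dyadic_cubes]
  \<comment> \<open>Finitely many unit cubes meet the ball, and each has finite mass because the
    norm is finite.\<close>
  have W: "integrable lebesgue W"
  proof (rule integrableI_bounded)
    have "(\<integral>\<^sup>+x. ennreal (norm (W x)) \<partial>lebesgue) \<le> (\<integral>\<^sup>+x. (\<Sum>m\<in>I 0. ennreal (W x) * indicator (dyadic_cube 0 m) x) \<partial>lebesgue)"
    proof (rule nn_integral_mono)
      fix x
      show "ennreal (norm (W x)) \<le> (\<Sum>m\<in>I 0. ennreal (W x) * indicator (dyadic_cube 0 m) x)"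
      proof (cases "x \<in> ball a r")
        case True
        have "ennreal (norm (W x)) = ennreal (W x) * indicator (dyadic_cube 0 (dyadic_index 0 x)) x"
          by (simp add: W0 dyadic_cube_def)
        also have "\<dots> \<le> (\<Sum>m\<in>I 0. ennreal (W x) * indicator (dyadic_cube 0 m) x)"
          using True by (intro member_le_sum[of "dyadic_index 0 x" "I 0"]) (auto simp: I_def finite_dyadic_index_ball)
        finally show ?thesis .
      qed (use V(2) in \<open>simp add: W_def\<close>)
    qed
    also have "\<dots> = (\<Sum>m\<in>I 0. ks_mass V (dyadic_cube 0 m))"
      by (subst nn_integral_sum, measurable) (simp add: ks_mass_def W_def)
    also have "\<dots> < \<infinity>"
      using ks(2) by (simp add: I less_top[symmetric])
    finally show "(\<integral>\<^sup>+x. ennreal (norm (W x)) \<partial>lebesgue) < \<infinity>" .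
  qed measurable
  define M where "M = cube_integral W"
  define F where "F = cube_integral g"
  define G where "G = cube_integral h"
  define l :: "nat \<Rightarrow> real" where "l = (\<lambda>j. 2 ^ (j * p))"
  define A where "A = 2 * real CARD('n) ^ p * K"
  have A: "A > 0" using K(2) by (simp add: A_def)
  have M0: "M j m \<ge> 0" for j m unfolding M_def by (rule cube_integral_nonneg[OF W0])
  have G0: "G j m \<ge> 0" for j m unfolding G_def by (rule cube_integral_nonneg[OF h(2)])
  have testing: "tree_sum l M N j m \<le> A * M j m" for N j m
  proof -
    have "ennreal (tree_sum l M N j m) \<le> ennreal (2 * real CARD('n) ^ p) * ks_energy V (dyadic_cube j m)"
      using tree_sum_le_ks_energy[OF n W[unfolded W_def], of N j m] by (simp only: M_def W_def l_def p_def)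
    also have "\<dots> \<le> ennreal (2 * real CARD('n) ^ p) * (ennreal K * ks_mass V (dyadic_cube j m))"
      by (intro mult_left_mono ks) simp_all
    also have "ks_mass V (dyadic_cube j m) = (\<integral>\<^sup>+x. ennreal (indicator (dyadic_cube j m) x * W x) \<partial>lebesgue)"
      unfolding ks_mass_def W_def by (intro nn_integral_cong) (auto split: split_indicator)
    also have "\<dots> = ennreal (M j m)"
      unfolding M_def by (rule nn_integral_cube[OF W W0])
    also have "ennreal (2 * real CARD('n) ^ p) * (ennreal K * ennreal (M j m)) = ennreal (A * M j m)"
      using K(2) M0[of j m] by (simp only: A_def) (simp add: ennreal_mult mult.assoc)
    finally show ?thesis
      using A M0[of j m] by (simp add: ennreal_le_iff)
  qed
  have FMG: "(F j m)\<^sup>2 \<le> M j m * G j m" for j m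
  proof -
    \<comment> \<open>The integrated form of 2 t g \<le> t^2 |V| + h, which follows pointwise from
      \<open>gh\<close>. Optimising over t below gives Cauchy-Schwarz on the cube, with t = F /
      M.\<close>
    have t: "2 * t * F j m \<le> t\<^sup>2 * M j m + G j m" for t
    proof -
      let ?i = "indicator (dyadic_cube j m) :: _ \<Rightarrow> real"
      have "2 * t * F j m = (LINT x|lebesgue. 2 * t * (?i x * g x))"
        by (simp add: F_def cube_integral_def)
      also have "\<dots> \<le> (LINT x|lebesgue. t\<^sup>2 * (?i x * W x) + ?i x * h x)"
      proof (rule integral_mono_AE)
        show "AE x in lebesgue. 2 * t * (?i x * g x) \<le> t\<^sup>2 * (?i x * W x) + ?i x * h x"
          using gh
        proof eventually_elim
          case (elim x)
          have "(2 * t * g x)\<^sup>2 \<le> 4 * t\<^sup>2 * (W x * h x)"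
            using elim by (simp add: power_mult_distrib W_def mult_left_mono)
          also have "\<dots> = 2 * (2 * (t\<^sup>2 * W x) * h x)" by simp
          also have "\<dots> \<le> (t\<^sup>2 * W x + h x)\<^sup>2"
            using sum_squares_bound[of "t\<^sup>2 * W x" "h x"] unfolding power2_sum by linarith
          finally have "2 * t * g x \<le> t\<^sup>2 * W x + h x"
            using W0[of x] h(2)[of x] by (intro power2_le_imp_le[of "2 * t * g x"]) auto
          then show ?case by (auto split: split_indicator)
        qed
      qed (use integrable_cube[OF g(1)] integrable_cube[OF W] integrable_cube[OF h(1)] in auto)
      also have "\<dots> = t\<^sup>2 * M j m + G j m"
        using integrable_cube[OF W] integrable_cube[OF h(1)] by (simp add: M_def G_def cube_integral_def)
      finally show ?thesis .
    qed
    show ?thesis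
    proof (cases "M j m = 0")
      case True
      have "F j m = 0"
      proof (rule ccontr)
        assume "F j m \<noteq> 0"
        \<comment> \<open>This choice makes the left side G + 1, while the right side is G since M =
          0.\<close>
        then show False using t[of "(G j m + 1) / (2 * F j m)"] True by simp
      qed
      then show ?thesis using M0 G0 by simp
    next
      case False
      then have "M j m > 0" using M0[of j m] by simp
      then show ?thesis using t[of "F j m / M j m"] by (simp add: field_simps power2_eq_square)
    qed
  qed
  have step: "cube_integral f j m = (\<Sum>m'\<in>descendants 1 m. cube_integral f (Suc j) m')" if "integrable lebesgue f"
    for f :: "real^'n \<Rightarrow> real" and j m
    using cube_integral_descendants[OF that, of j m 1] by simp
  have carleson: "tree_sum l F N j m \<le> 4 * A * G j m" for N j m
  proof -
    have "tree_sum l F N j m \<le> 4 * A * (G j m - A * ((F j m)\<^sup>2 / (A * M j m + tree_sum l M N j m)))"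
    proof (rule carleson_embedding_bellman[OF _ A M0 G0 _ _ _ FMG testing])
      show "M j m = (\<Sum>m'\<in>descendants 1 m. M (Suc j) m')" for j m
        unfolding M_def by (rule step[OF W])
      show "F j m = (\<Sum>m'\<in>descendants 1 m. F (Suc j) m')" for j m
        unfolding F_def by (rule step[OF g(1)])
      show "G j m = (\<Sum>m'\<in>descendants 1 m. G (Suc j) m')" for j m
        unfolding G_def by (rule step[OF h(1)])
    qed (simp add: l_def)
    also have "\<dots> \<le> 4 * A * (G j m - 0)"
      using A M0[of j m] tree_sum_nonneg[of l M N j m]
      by (intro mult_left_mono diff_left_mono) (auto simp: l_def)
    finally show ?thesis by simp
  qed
  define c where "c = real (card (neighbors (0 :: int^'n)))"
  have c0: "c \<ge> 0" by (simp add: c_def)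
  have partial: "(\<Sum>j<N. l j * (\<Sum>m\<in>I j. (F j m)\<^sup>2)) \<le> 4 * A * (LINT x|lebesgue. h x)" for N
  proof -
    have "(\<Sum>m\<in>I j. (F j m)\<^sup>2) \<le> (\<Sum>m\<in>I 0. \<Sum>m'\<in>descendants j m. (F j m')\<^sup>2)" for j
    proof -
      \<comment> \<open>A generation-j cube meeting the ball lies in a unit cube meeting it, so the
        trees rooted at these unit cubes contain every cube that matters.\<close>
      have "I j \<subseteq> (\<Union>m\<in>I 0. descendants j m)"
      proof
        fix m' assume "m' \<in> I j"
        then obtain x where x: "x \<in> ball a r" "m' = dyadic_index j x" by (auto simp: I_def)
        then have "m' \<in> descendants j (dyadic_index 0 x)"
          using dyadic_index_mem_descendants_iff[of 0 j x "dyadic_index 0 x"] by (simp add: dyadic_cube_def)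
        then show "m' \<in> (\<Union>m\<in>I 0. descendants j m)" using x by (auto simp: I_def)
      qed
      then have "(\<Sum>m\<in>I j. (F j m)\<^sup>2) \<le> (\<Sum>m\<in>(\<Union>m\<in>I 0. descendants j m). (F j m)\<^sup>2)"
        using I finite_descendants by (intro sum_mono2) auto
      also have "\<dots> = (\<Sum>m\<in>I 0. \<Sum>m'\<in>descendants j m. (F j m')\<^sup>2)"
        by (rule sum.UNION_disjoint) (auto simp: I finite_descendants, auto simp: descendants_def vec_eq_iff)
      finally show ?thesis .
    qed
    then have "(\<Sum>j<N. l j * (\<Sum>m\<in>I j. (F j m)\<^sup>2)) \<le> (\<Sum>j<N. l j * (\<Sum>m\<in>I 0. \<Sum>m'\<in>descendants j m. (F j m')\<^sup>2))"
      by (intro sum_mono mult_left_mono) (auto simp: l_def)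
    also have "\<dots> = (\<Sum>m\<in>I 0. tree_sum l F N 0 m)"
      unfolding tree_sum_eq by (subst sum.swap) (simp add: sum_distrib_left)
    also have "\<dots> \<le> (\<Sum>m\<in>I 0. 4 * A * G 0 m)"
      by (intro sum_mono carleson)
    also have "\<dots> = 4 * A * (LINT x|lebesgue. h x)"
      using sum_cube_integral_ball[of h a r 0, OF h(1) h(3)] by (simp add: G_def I_def flip: sum_distrib_left)
    finally show ?thesis .
  qed
  have "(\<integral>\<^sup>+x. \<integral>\<^sup>+y. ennreal (g x * g y / norm (x - y) ^ p) \<partial>lebesgue \<partial>lebesgue) \<le>
    ennreal (2 ^ p) * (\<Sum>j. ennreal (l j * (c * (\<Sum>m\<in>I j. (F j m)\<^sup>2))))"
    unfolding c_def I_def F_def l_def by (rule energy_le_dyadic[OF p r g])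
  also have "\<dots> \<le> ennreal (2 ^ p) * ennreal (c * (4 * A * (LINT x|lebesgue. h x)))"
  proof (rule mult_left_mono)
    have "(\<Sum>j<N. ennreal (l j * (c * (\<Sum>m\<in>I j. (F j m)\<^sup>2)))) \<le> ennreal (c * (4 * A * (LINT x|lebesgue. h x)))" for N
    proof -
      have "(\<Sum>j<N. ennreal (l j * (c * (\<Sum>m\<in>I j. (F j m)\<^sup>2)))) = ennreal (\<Sum>j<N. l j * (c * (\<Sum>m\<in>I j. (F j m)\<^sup>2)))"
        by (rule sum_ennreal) (auto simp: l_def c0 intro!: mult_nonneg_nonneg sum_nonneg)
      also have "(\<Sum>j<N. l j * (c * (\<Sum>m\<in>I j. (F j m)\<^sup>2))) = c * (\<Sum>j<N. l j * (\<Sum>m\<in>I j. (F j m)\<^sup>2))"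
        by (simp add: sum_distrib_left mult.left_commute)
      finally show ?thesis using mult_left_mono[OF partial c0, of N] by (simp add: ennreal_leI)
    qed
    then show "(\<Sum>j. ennreal (l j * (c * (\<Sum>m\<in>I j. (F j m)\<^sup>2)))) \<le> ennreal (c * (4 * A * (LINT x|lebesgue. h x)))"
      by (intro suminf_le_const) auto
  qed simp
  also have "\<dots> = ennreal (2 ^ p * (c * (4 * A * (LINT x|lebesgue. h x))))"
  proof (rule ennreal_mult[symmetric])
    have "(LINT x|lebesgue. h x) \<ge> 0" using h(2) by (intro integral_nonneg_AE) auto
    then show "0 \<le> c * (4 * A * (LINT x|lebesgue. h x))" using A c0 by simp
  qed simp
  finally show ?thesis by (simp only: p_def A_def c_def)
qed

section \<open>Weak derivatives and Newton potentials\<close>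

text \<open>The union behind \<open>ess_support\<close> may be uncountable, so its null sets cannot
  be collected directly. By Lindelof a countable subfamily has the same union.\<close>

lemma AE_zero_outside_ess_support:
  assumes "ess_support u \<subseteq> S"
  shows "AE x in lebesgue. x \<notin> S \<longrightarrow> u x = 0"
proof -
  define \<U> where "\<U> = {U. open U \<and> (AE x in lebesgue. x \<in> U \<longrightarrow> u x = 0)}"
  obtain \<F> where F: "\<F> \<subseteq> \<U>" "countable \<F>" "\<Union>\<F> = \<Union>\<U>"
    using Lindelof[of \<U>] by (auto simp: \<U>_def)
  have "AE x in lebesgue. \<forall>U\<in>\<F>. x \<in> U \<longrightarrow> u x = 0"
    using F(1) by (subst AE_ball_countable[OF F(2)]) (auto simp: \<U>_def)
  then show ?thesis
  proof eventually_elim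
    case (elim x)
    show ?case
    proof
      assume "x \<notin> S"
      then have "x \<in> \<Union>\<U>" using assms by (auto simp: ess_support_def \<U>_def)
      then show "u x = 0" using elim F(3) by auto
    qed
  qed
qed

section \<open>Integrability of products with test functions\<close>

lemma integrable_bounded_scaleR:
  fixes f :: "'a::euclidean_space \<Rightarrow> complex" and \<psi> :: "'a \<Rightarrow> real"
  assumes f: "integrable lebesgue f" and \<psi>: "continuous_on UNIV \<psi>" and f0: "\<And>x. x \<notin> K \<Longrightarrow> f x = 0"
    and K: "compact K"
  shows "integrable lebesgue (\<lambda>x. \<psi> x *\<^sub>R f x)"
proof -
  have "bounded (\<psi> ` K)"
    using K \<psi> by (meson compact_continuous_image compact_imp_bounded continuous_on_subset subset_UNIV)
  then obtain b where b: "\<And>x. x \<in> K \<Longrightarrow> \<bar>\<psi> x\<bar> \<le> b"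
    by (auto simp: bounded_iff)
  have [measurable]: "\<psi> \<in> borel_measurable lebesgue"
    by (rule measurable_completion) (simp add: borel_measurable_continuous_onI[OF \<psi>])
  have [measurable]: "f \<in> borel_measurable lebesgue" using f by auto
  show ?thesis
  proof (rule Bochner_Integration.integrable_bound)
    show "integrable lebesgue (\<lambda>x. b *\<^sub>R f x)" using f by auto
    show "(\<lambda>x. \<psi> x *\<^sub>R f x) \<in> borel_measurable lebesgue" by measurable
    show "AE x in lebesgue. norm (\<psi> x *\<^sub>R f x) \<le> norm (b *\<^sub>R f x)"
    proof (rule AE_I2)
      fix x
      show "norm (\<psi> x *\<^sub>R f x) \<le> norm (b *\<^sub>R f x)"
      proof (cases "x \<in> K")
        case True
        then have "\<bar>\<psi> x\<bar> \<le> \<bar>b\<bar>" using b[of x] by linarith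
        then show ?thesis by (simp add: mult_right_mono)
      qed (simp add: f0)
    qed
  qed
qed

lemma locally_integrable_scaleR:
  assumes f: "locally_integrable f" and \<psi>: "continuous_on UNIV \<psi>" and \<psi>0: "\<And>x. x \<notin> K \<Longrightarrow> \<psi> x = 0"
    and K: "compact K"
  shows "integrable lebesgue (\<lambda>x. \<psi> x *\<^sub>R f x)"
proof -
  have "integrable lebesgue (\<lambda>x. indicator K x *\<^sub>R f x)"
    using f K by (simp add: locally_integrable_def set_integrable_def)
  then have "integrable lebesgue (\<lambda>x. \<psi> x *\<^sub>R (indicator K x *\<^sub>R f x))"
    by (rule integrable_bounded_scaleR[OF _ \<psi> _ K]) simp
  moreover have "\<psi> x *\<^sub>R (indicator K x *\<^sub>R f x) = \<psi> x *\<^sub>R f x" for x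
    by (cases "x \<in> K") (simp_all add: \<psi>0)
  ultimately show ?thesis by (simp only:)
qed

lemma locally_integrable_measurable:
  assumes "locally_integrable (f :: real^'n::finite \<Rightarrow> complex)"
  shows "f \<in> borel_measurable lebesgue"
proof (rule borel_measurable_LIMSEQ_metric)
  show "(\<lambda>x. indicator (cball 0 (real k)) x *\<^sub>R f x) \<in> borel_measurable lebesgue" for k
  proof (rule borel_measurable_integrable)
    show "integrable lebesgue (\<lambda>x. indicator (cball 0 (real k)) x *\<^sub>R f x)"
      using assms compact_cball[of "0::real^'n" "real k"] unfolding locally_integrable_def set_integrable_def by simp
  qed
  fix x :: "real^'n"
  obtain N where "norm x \<le> real N" using real_arch_simple by blast
  then have "eventually (\<lambda>k. indicator (cball 0 (real k)) x *\<^sub>R f x = f x) sequentially"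
    by (auto simp: eventually_sequentially intro!: exI[of _ N])
  then show "(\<lambda>k. indicator (cball 0 (real k)) x *\<^sub>R f x) \<longlonglongrightarrow> f x"
    by (rule tendsto_eventually)
qed

text \<open>The real version is applied to plus and minus the real and imaginary parts; the factor 2
  comes from bounding the modulus by the sum of their absolute values.\<close>

lemma AE_norm_le_if_mollified_le:
  fixes f :: "real^'n::finite \<Rightarrow> complex"
  assumes r: "r > 0" and f: "integrable lebesgue f" and f0: "\<And>x. x \<notin> ball a r \<Longrightarrow> f x = 0"
    and w: "integrable lebesgue w" and w0: "\<And>x. w x \<ge> 0"
    and le: "AE x in lebesgue. x \<in> ball a r \<longrightarrow>
      (\<forall>e>0. norm (LINT y|lebesgue. mollifier e (y - x) *\<^sub>R f y) \<le> w x)"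
  shows "AE x in lebesgue. x \<in> ball a r \<longrightarrow> norm (f x) \<le> 2 / mollifier_const TYPE('n) * w x"
proof -
  define \<kappa> where "\<kappa> = mollifier_const TYPE('n)"
  have int: "integrable lebesgue (\<lambda>y. mollifier e (y - x) *\<^sub>R f y)" if "e > 0" for e x
    using f smooth_algebra_continuous[OF mollifier_smooth[OF that]] f0
    by (rule integrable_bounded_scaleR[where K="cball a r"]) auto
  have Re: "(LINT y|lebesgue. Re (f y) * mollifier e (y - x)) = Re (LINT y|lebesgue. mollifier e (y - x) *\<^sub>R f y)"
    and Im: "(LINT y|lebesgue. Im (f y) * mollifier e (y - x)) = Im (LINT y|lebesgue. mollifier e (y - x) *\<^sub>R f y)"
    if "e > 0" for e x
    using integral_Re[OF int[OF that, of x]] integral_Im[OF int[OF that, of x]] by (simp_all add: mult.commute)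
  have part: "AE x in lebesgue. x \<in> ball a r \<longrightarrow> \<bar>T (f x)\<bar> \<le> w x / \<kappa>"
    if T: "T = Re \<or> T = Im" for T
  proof -
    have iT: "integrable lebesgue (\<lambda>x. T (f x))" using T f by auto
    have T0: "T (f x) = 0" if "x \<notin> ball a r" for x using T f0[OF that] by auto
    have Tle: "\<bar>LINT y|lebesgue. T (f y) * mollifier e (y - x)\<bar> \<le> norm (LINT y|lebesgue. mollifier e (y - x) *\<^sub>R f y)"
      if "e > 0" for e x
      using T Re[OF that, of x] Im[OF that, of x] abs_Re_le_cmod abs_Im_le_cmod by auto
    have "AE x in lebesgue. x \<in> ball a r \<longrightarrow> T (f x) \<le> w x / \<kappa>"
      unfolding \<kappa>_def
    proof (rule AE_le_if_mollified_le[OF r iT T0 w w0])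
      show "AE x in lebesgue. x \<in> ball a r \<longrightarrow> (\<forall>e>0. (LINT y|lebesgue. T (f y) * mollifier e (y - x)) \<le> w x)"
        using le
      proof eventually_elim
        case (elim x)
        show ?case
        proof (intro impI allI)
          fix e :: real assume "x \<in> ball a r" and e: "e > 0"
          then have "norm (LINT y|lebesgue. mollifier e (y - x) *\<^sub>R f y) \<le> w x" using elim by blast
          then show "(LINT y|lebesgue. T (f y) * mollifier e (y - x)) \<le> w x" using Tle[OF e, of x] by linarith
        qed
      qed
    qed
    moreover have "AE x in lebesgue. x \<in> ball a r \<longrightarrow> - T (f x) \<le> w x / \<kappa>"
      unfolding \<kappa>_def
    proof (rule AE_le_if_mollified_le[OF r _ _ w w0])
      show "integrable lebesgue (\<lambda>x. - T (f x))" using iT by simp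
      show "AE x in lebesgue. x \<in> ball a r \<longrightarrow> (\<forall>e>0. (LINT y|lebesgue. - T (f y) * mollifier e (y - x)) \<le> w x)"
        using le
      proof eventually_elim
        case (elim x)
        show ?case
        proof (intro impI allI)
          fix e :: real assume "x \<in> ball a r" and e: "e > 0"
          then have "norm (LINT y|lebesgue. mollifier e (y - x) *\<^sub>R f y) \<le> w x" using elim by blast
          moreover have "(LINT y|lebesgue. - T (f y) * mollifier e (y - x)) = - (LINT y|lebesgue. T (f y) * mollifier e (y - x))"
            by simp
          ultimately show "(LINT y|lebesgue. - T (f y) * mollifier e (y - x)) \<le> w x" using Tle[OF e, of x] by linarith
        qed
      qed
    qed (simp add: T0)
    ultimately show ?thesis by eventually_elim auto
  qed
  have "AE x in lebesgue. x \<in> ball a r \<longrightarrow> \<bar>Re (f x)\<bar> \<le> w x / \<kappa>" by (rule part) simp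
  moreover have "AE x in lebesgue. x \<in> ball a r \<longrightarrow> \<bar>Im (f x)\<bar> \<le> w x / \<kappa>" by (rule part) simp
  ultimately show ?thesis
  proof eventually_elim
    case (elim x)
    then show ?case using cmod_le[of "f x"] by (auto simp: \<kappa>_def)
  qed
qed

text \<open>Testing with a cutoff times the bump centred at x shows that all mollifications of the
  truncated difference g1 - g2 vanish; the preceding bound with w = 0 then kills it. Uniqueness is
  what transfers properties to the arbitrarily chosen \<open>weak_deriv\<close>.\<close>

lemma weak_deriv_unique:
  fixes u :: "real^'n::finite \<Rightarrow> complex"
  assumes "is_weak_deriv is u g1" "is_weak_deriv is u g2"
  shows "AE x in lebesgue. g1 x = g2 x"
proof -
  have loc: "locally_integrable g1" "locally_integrable g2"
    using assms by (auto simp: is_weak_deriv_def)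
  have "AE x in lebesgue. x \<in> ball 0 R \<longrightarrow> g1 x = g2 x" if R: "R > 0" for R
  proof -
    define f where "f = (\<lambda>x. cutoff 0 R x *\<^sub>R (g1 x - g2 x))"
    have int: "integrable lebesgue (\<lambda>x. (cutoff 0 R x * \<psi> x) *\<^sub>R g x)"
      if "\<psi> \<in> smooth_algebra" "locally_integrable g" for g \<psi>
      by (rule locally_integrable_scaleR[where K="cball 0 (2 * R)"])
         (use that R cutoff_eq_0[OF R, of _ 0] in \<open>auto intro!: smooth_algebra_continuous smooth_algebra.mult cutoff_smooth\<close>)
    have f_int: "integrable lebesgue f"
      using int[OF smooth_algebra.const[of 1] loc(1)] int[OF smooth_algebra.const[of 1] loc(2)]
      by (simp add: f_def scaleR_diff_right)
    have zero: "(LINT y|lebesgue. mollifier e (y - x) *\<^sub>R f y) = 0" if e: "e > 0" for e x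
    proof -
      let ?\<phi> = "\<lambda>y. cutoff 0 R y * mollifier e (y - x)"
      have \<phi>: "?\<phi> \<in> test_functions"
        by (rule cutoff_mult_test_function[OF R mollifier_smooth[OF e]])
      have i: "integrable lebesgue (\<lambda>y. ?\<phi> y *\<^sub>R g1 y)" "integrable lebesgue (\<lambda>y. ?\<phi> y *\<^sub>R g2 y)"
        by (intro int mollifier_smooth e loc)+
      have "(LINT y|lebesgue. iter_partial is ?\<phi> y *\<^sub>R u y) = (-1) ^ length is * (LINT y|lebesgue. ?\<phi> y *\<^sub>R g y)"
        if "is_weak_deriv is u g" for g
        using that \<phi> unfolding is_weak_deriv_def by blast
      from this[OF assms(1)] this[OF assms(2)]
      have "(-1) ^ length is * (LINT y|lebesgue. ?\<phi> y *\<^sub>R g1 y) = (-1) ^ length is * (LINT y|lebesgue. ?\<phi> y *\<^sub>R g2 y)"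
        by (rule trans[OF sym])
      then have "(LINT y|lebesgue. ?\<phi> y *\<^sub>R g1 y) = (LINT y|lebesgue. ?\<phi> y *\<^sub>R g2 y)"
        by simp
      then have "(LINT y|lebesgue. ?\<phi> y *\<^sub>R g1 y - ?\<phi> y *\<^sub>R g2 y) = 0"
        using i by simp
      then show ?thesis by (simp add: f_def scaleR_diff_right mult.commute)
    qed
    \<comment> \<open>Radius 3 R, because the cutoff is supported in the closed ball of radius 2 R
      and the bound wants vanishing off an open ball.\<close>
    have "AE x in lebesgue. x \<in> ball 0 (3 * R) \<longrightarrow> norm (f x) \<le> 2 / mollifier_const TYPE('n) * 0"
    proof (rule AE_norm_le_if_mollified_le[OF _ f_int])
      show "f x = 0" if "x \<notin> ball 0 (3 * R)" for x
        using that R cutoff_eq_0[OF R, of x 0] by (auto simp: f_def)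
    qed (use R zero in auto)
    then show ?thesis
    proof eventually_elim
      case (elim x)
      then show ?case using R cutoff_eq_1[OF R, of x 0] by (auto simp: f_def)
    qed
  qed
  then have "AE x in lebesgue. \<forall>k::nat. x \<in> ball 0 (real k + 1) \<longrightarrow> g1 x = g2 x"
    by (subst AE_all_countable) auto
  then show ?thesis
  proof eventually_elim
    case (elim x)
    obtain k :: nat where "norm x \<le> real k" using real_arch_simple by blast
    then show ?case using elim[rule_format, of k] by simp
  qed
qed

section \<open>The weak Laplacian and its Newton potential\<close>

lemma is_weak_deriv_weak_deriv:
  assumes "u \<in> sobolev m p" "length is \<le> m"
  shows "is_weak_deriv is u (weak_deriv is u)"
proof -
  have "\<exists>g. is_weak_deriv is u g" using assms unfolding sobolev_def by blast
  then show ?thesis unfolding weak_deriv_def by (rule someI_ex)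
qed

lemma laplacian_locally_integrable:
  assumes "u \<in> sobolev 2 p"
  shows "locally_integrable (laplacian u)"
proof -
  have "locally_integrable (weak_deriv [i, i] u)" for i
    using is_weak_deriv_weak_deriv[OF assms, of "[i, i]"] by (simp add: is_weak_deriv_def)
  then show ?thesis
    unfolding locally_integrable_def laplacian_def set_integrable_def scaleR_sum_right
    by (intro allI impI Bochner_Integration.integrable_sum) blast
qed

text \<open>The test function is a cutoff times the regularised kernel centred at x; for second
  derivatives the sign in \<open>is_weak_deriv\<close> is positive. Since the cutoff is at most 1
  and \<open>newton_reg_le\<close> holds for every e, the bound is uniform in e. The representative
  v is used because it vanishes at every point off the ball.\<close>

lemma mollified_le_newton_potential:
  fixes u :: "real^'n::finite \<Rightarrow> complex"
  assumes n: "CARD('n) \<ge> 3" and r: "r > 0" and e: "e > 0" and u: "u \<in> sobolev 2 p"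
    and v: "integrable lebesgue v" "\<And>x. x \<notin> ball a r \<Longrightarrow> v x = 0" "AE x in lebesgue. u x = v x"
  shows "ennreal (real CARD('n) * (real CARD('n) - 2) * norm (LINT y|lebesgue. mollifier e (y - x) *\<^sub>R v y)) \<le>
    (\<integral>\<^sup>+y. ennreal (norm (laplacian u y) / norm (x - y) ^ (CARD('n) - 2)) \<partial>lebesgue)"
proof -
  define c where "c = real CARD('n) * (real CARD('n) - 2)"
  have c: "c \<ge> 0" using n by (simp add: c_def)
  let ?\<phi> = "\<lambda>y. cutoff a r y * newton_reg e (y - x)"
  have \<phi>: "?\<phi> \<in> test_functions"
    by (rule cutoff_mult_test_function[OF r newton_reg_smooth[OF e]])
  have \<phi>_sm: "?\<phi> \<in> smooth_algebra"
    by (intro smooth_algebra.mult cutoff_smooth r newton_reg_smooth e)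
  have um: "u \<in> borel_measurable lebesgue" using u by (simp add: sobolev_def Lp_space_def)
  have vm [measurable]: "v \<in> borel_measurable lebesgue" using v by auto
  have wd: "is_weak_deriv [i, i] u (weak_deriv [i, i] u)" for i
    by (rule is_weak_deriv_weak_deriv[OF u]) simp
  have i1: "integrable lebesgue (\<lambda>y. iter_partial [i, i] ?\<phi> y *\<^sub>R v y)" for i
    by (rule integrable_bounded_scaleR[OF v(1) smooth_algebra_continuous[OF smooth_algebra_iter_partial[OF \<phi>_sm]], of "cball a r"])
       (use v(2) in auto)
  have i2: "integrable lebesgue (\<lambda>y. ?\<phi> y *\<^sub>R weak_deriv [i, i] u y)" for i
    by (rule locally_integrable_scaleR[where K="cball a (2 * r)"])
       (use wd[of i] cutoff_eq_0[OF r, of _ a] smooth_algebra_continuous[OF \<phi>_sm] in \<open>auto simp: is_weak_deriv_def\<close>)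
  have i3: "integrable lebesgue (\<lambda>y. ?\<phi> y *\<^sub>R laplacian u y)"
    unfolding laplacian_def scaleR_sum_right using i2 by (rule Bochner_Integration.integrable_sum)
  have eq: "(LINT y|lebesgue. iter_partial [i, i] ?\<phi> y *\<^sub>R v y) = (LINT y|lebesgue. ?\<phi> y *\<^sub>R weak_deriv [i, i] u y)" for i
  proof -
    have pm [measurable]: "iter_partial [i, i] ?\<phi> \<in> borel_measurable lebesgue"
      by (rule measurable_completion)
         (simp add: borel_measurable_continuous_onI[OF smooth_algebra_continuous[OF smooth_algebra_iter_partial[OF \<phi>_sm]]])
    have "(LINT y|lebesgue. iter_partial [i, i] ?\<phi> y *\<^sub>R v y) = (LINT y|lebesgue. iter_partial [i, i] ?\<phi> y *\<^sub>R u y)"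
      by (rule integral_cong_AE) (use um v(3) in \<open>auto intro!: borel_measurable_scaleR pm\<close>)
    also have "\<dots> = (LINT y|lebesgue. ?\<phi> y *\<^sub>R weak_deriv [i, i] u y)"
      using wd[of i] \<phi> unfolding is_weak_deriv_def by auto
    finally show ?thesis .
  qed
  have "(LINT y|lebesgue. ?\<phi> y *\<^sub>R laplacian u y) = (\<Sum>i\<in>UNIV. LINT y|lebesgue. ?\<phi> y *\<^sub>R weak_deriv [i, i] u y)"
    unfolding laplacian_def scaleR_sum_right by (rule Bochner_Integration.integral_sum) (rule i2)
  also have "\<dots> = (LINT y|lebesgue. (\<Sum>i\<in>UNIV. iter_partial [i, i] ?\<phi> y *\<^sub>R v y))"
    using i1 by (simp add: eq[symmetric])
  also have "\<dots> = (LINT y|lebesgue. - c *\<^sub>R (mollifier e (y - x) *\<^sub>R v y))"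
  proof (rule Bochner_Integration.integral_cong[OF refl])
    \<comment> \<open>On the ball the cutoff is 1 and the Laplacian of the kernel is the bump; off
      the ball v = 0, so derivatives of the cutoff never contribute.\<close>
    fix y
    show "(\<Sum>i\<in>UNIV. iter_partial [i, i] ?\<phi> y *\<^sub>R v y) = - c *\<^sub>R (mollifier e (y - x) *\<^sub>R v y)"
    proof (cases "y \<in> ball a r")
      case True
      have "(\<Sum>i\<in>UNIV. iter_partial [i, i] ?\<phi> y) = (\<Sum>i\<in>UNIV. iter_partial [i, i] (\<lambda>y. newton_reg e (y - x)) y)"
        by (intro sum.cong refl iter_partial_cong_open[OF open_ball _ True]) (simp add: cutoff_eq_1[OF r])
      also have "\<dots> = - c * mollifier e (y - x)"
        by (simp add: laplacian_newton_reg[OF e] c_def)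
      finally show ?thesis by (simp flip: scaleR_sum_left)
    qed (simp add: v(2))
  qed
  also have "\<dots> = - c *\<^sub>R (LINT y|lebesgue. mollifier e (y - x) *\<^sub>R v y)"
    by (rule integral_scaleR_right)
  finally have "c * norm (LINT y|lebesgue. mollifier e (y - x) *\<^sub>R v y) = norm (LINT y|lebesgue. ?\<phi> y *\<^sub>R laplacian u y)"
    using c by simp
  then have "ennreal (c * norm (LINT y|lebesgue. mollifier e (y - x) *\<^sub>R v y)) = ennreal (norm (LINT y|lebesgue. ?\<phi> y *\<^sub>R laplacian u y))"
    by simp
  also have "\<dots> \<le> (\<integral>\<^sup>+y. ennreal (norm (?\<phi> y *\<^sub>R laplacian u y)) \<partial>lebesgue)"
    by (rule integral_norm_bound_ennreal[OF i3])
  also have "\<dots> \<le> (\<integral>\<^sup>+y. ennreal (norm (laplacian u y) / norm (x - y) ^ (CARD('n) - 2)) \<partial>lebesgue)"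
  proof (rule nn_integral_mono_AE)
    \<comment> \<open>At y = x the quotient on the right is 0 by convention, while the test function
      may be positive.\<close>
    have "AE y in lebesgue. y \<notin> {x}" by (rule AE_not_in) simp
    then show "AE y in lebesgue. ennreal (norm (?\<phi> y *\<^sub>R laplacian u y)) \<le>
      ennreal (norm (laplacian u y) / norm (x - y) ^ (CARD('n) - 2))"
    proof eventually_elim
      case (elim y)
      have pos: "newton_reg e (y - x) \<ge> 0" by (simp add: newton_reg_def)
      have "?\<phi> y \<le> newton_reg e (y - x)"
        using cutoff_range[OF r, of a y] pos by (intro mult_left_le_one_le) auto
      also have "\<dots> \<le> inverse (norm (y - x) ^ (CARD('n) - 2))"
        using elim n by (intro newton_reg_le) auto
      finally have "?\<phi> y \<le> inverse (norm (x - y) ^ (CARD('n) - 2))" by (simp add: norm_minus_commute)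
      moreover have "?\<phi> y \<ge> 0" using cutoff_range[OF r, of a y] pos by simp
      ultimately have "\<bar>?\<phi> y\<bar> * norm (laplacian u y) \<le> inverse (norm (x - y) ^ (CARD('n) - 2)) * norm (laplacian u y)"
        by (intro mult_right_mono) auto
      then show ?case by (intro ennreal_leI) (simp add: divide_inverse mult.commute)
    qed
  qed
  finally show ?thesis by (simp add: c_def)
qed

text \<open>A ball of radius 2^(-j) has volume of order 2^(-j n) against the weight 2^(j (n - 2)),
  so the sum over scales is geometric with ratio 1/4. The bound is the same for every centre
  y.\<close>

lemma newton_kernel_locally_integrable:
  fixes a :: "real^'n::finite"
  assumes n: "CARD('n) \<ge> 3" and r: "r \<le> 1 / 2"
  obtains D where "D < (\<infinity>::ennreal)"
    "\<And>y. y \<in> ball a r \<Longrightarrow> (\<integral>\<^sup>+x. ennreal (1 / norm (x - y) ^ (CARD('n) - 2)) * indicator (ball a r) x \<partial>lebesgue) \<le> D"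
proof
  define p where "p = CARD('n) - 2"
  define v where "v = measure lebesgue (ball (0::real^'n) 1)"
  have p: "p \<ge> 1" and np: "CARD('n) = p + 2" using n by (auto simp: p_def)
  define D where "D = ennreal (2 ^ p) * (\<Sum>j. ennreal ((1/4) ^ j * v))"
  have "summable (\<lambda>j. (1/4::real) ^ j * v)"
    by (intro summable_mult2 summable_geometric) simp
  then have "(\<Sum>j. ennreal ((1/4) ^ j * v)) = ennreal (\<Sum>j. (1/4) ^ j * v)"
    by (intro suminf_ennreal2) (auto simp: v_def)
  then show "D < \<infinity>" by (simp add: D_def ennreal_mult_less_top)
  fix y assume y: "y \<in> ball a r"
  have "(\<integral>\<^sup>+x. ennreal (1 / norm (x - y) ^ p) * indicator (ball a r) x \<partial>lebesgue) \<le>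
    (\<integral>\<^sup>+x. ennreal (2 ^ p) * (\<Sum>j. ennreal (2 ^ (j * p)) * indicator (ball y (1 / 2 ^ j)) x) \<partial>lebesgue)"
  proof (rule nn_integral_mono)
    fix x
    have ball: "indicator (ball 0 (1 / 2 ^ j)) (x - y) = (indicator (ball y (1 / 2 ^ j)) x :: ennreal)" for j
      by (auto simp: dist_norm norm_minus_commute split: split_indicator)
    have "ennreal (1 / norm (x - y) ^ p) \<le> ennreal (2 ^ p) * (\<Sum>j. ennreal (2 ^ (j * p)) * indicator (ball y (1 / 2 ^ j)) x)"
      if "x \<in> ball a r"
    proof -
      have "dist x y \<le> dist x a + dist a y" by (rule dist_triangle)
      then have "norm (x - y) < 1" using that y r by (simp add: dist_norm norm_minus_commute)
      from inverse_power_norm_le_dyadic_sum[OF p this] show ?thesis by (simp only: ball)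
    qed
    then show "ennreal (1 / norm (x - y) ^ p) * indicator (ball a r) x \<le>
       ennreal (2 ^ p) * (\<Sum>j. ennreal (2 ^ (j * p)) * indicator (ball y (1 / 2 ^ j)) x)"
      by (cases "x \<in> ball a r") simp_all
  qed
  also have "\<dots> = ennreal (2 ^ p) * (\<Sum>j. ennreal (2 ^ (j * p)) * emeasure lebesgue (ball y (1 / 2 ^ j)))"
  proof -
    have [measurable]: "ball y s \<in> sets lebesgue" for s by simp
    have "(\<integral>\<^sup>+x. ennreal (2 ^ (j * p)) * indicator (ball y (1 / 2 ^ j)) x \<partial>lebesgue) =
        ennreal (2 ^ (j * p)) * emeasure lebesgue (ball y (1 / 2 ^ j))" for j
      by (rule nn_integral_cmult_indicator) simp
    moreover have "(\<integral>\<^sup>+x. (\<Sum>j. ennreal (2 ^ (j * p)) * indicator (ball y (1 / 2 ^ j)) x) \<partial>lebesgue) =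
        (\<Sum>j. \<integral>\<^sup>+x. ennreal (2 ^ (j * p)) * indicator (ball y (1 / 2 ^ j)) x \<partial>lebesgue)"
      by (rule nn_integral_suminf) measurable
    moreover have "(\<integral>\<^sup>+x. ennreal (2 ^ p) * (\<Sum>j. ennreal (2 ^ (j * p)) * indicator (ball y (1 / 2 ^ j)) x) \<partial>lebesgue) =
        ennreal (2 ^ p) * (\<integral>\<^sup>+x. (\<Sum>j. ennreal (2 ^ (j * p)) * indicator (ball y (1 / 2 ^ j)) x) \<partial>lebesgue)"
      by (rule nn_integral_cmult) measurable
    ultimately show ?thesis by (simp only:)
  qed
  also have "(\<lambda>j. ennreal (2 ^ (j * p)) * emeasure lebesgue (ball y (1 / 2 ^ j))) = (\<lambda>j. ennreal ((1/4) ^ j * v))"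
  proof
    fix j
    have "emeasure lebesgue (ball y (1 / 2 ^ j)) = ennreal (measure lebesgue (ball y (1 / 2 ^ j)))"
      using lmeasurable_ball[of y "1 / 2 ^ j"] by (intro emeasure_eq_measure2) (auto simp: fmeasurable_def)
    also have "measure lebesgue (ball y (1 / 2 ^ j)) = (1 / 2 ^ j) ^ (p + 2) * v"
      using content_ball_conv_unit_ball[of "1 / 2 ^ j" y] by (simp add: v_def np)
    also have "ennreal (2 ^ (j * p)) * ennreal ((1 / 2 ^ j) ^ (p + 2) * v) = ennreal (2 ^ (j * p) * ((1 / 2 ^ j) ^ (p + 2) * v))"
      by (rule ennreal_mult[symmetric]) (auto simp: v_def)
    also have "2 ^ (j * p) * ((1 / 2 ^ j) ^ (p + 2) * v) = (1/4) ^ j * v"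
    proof -
      have "(2::real) ^ (j * p) * (1 / 2 ^ j) ^ (p + 2) = 1 / (2 ^ j)\<^sup>2"
        by (simp add: power_divide power_add power_mult power2_eq_square)
      also have "((2::real) ^ j)\<^sup>2 = 4 ^ j"
      proof -
        have "((2::real) ^ j)\<^sup>2 = (2\<^sup>2) ^ j" by (simp only: power_mult[symmetric] mult.commute)
        then show ?thesis by simp
      qed
      also have "1 / 4 ^ j = ((1/4) ^ j :: real)" by (simp add: power_divide)
      finally have "2 ^ (j * p) * (1 / 2 ^ j) ^ (p + 2) = ((1/4) ^ j :: real)" .
      then show ?thesis by (simp only: mult.assoc[symmetric])
    qed
    finally show "ennreal (2 ^ (j * p)) * emeasure lebesgue (ball y (1 / 2 ^ j)) = ennreal ((1/4) ^ j * v)" .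
  qed
  finally show "(\<integral>\<^sup>+x. ennreal (1 / norm (x - y) ^ (CARD('n) - 2)) * indicator (ball a r) x \<partial>lebesgue) \<le> D"
    by (simp only: D_def p_def)
qed

text \<open>The source of the finiteness of X. The Sobolev space provides some square integrable
  weak derivative, whereas \<open>weak_deriv\<close> is an arbitrary choice; uniqueness identifies
  the two almost everywhere, and products are bounded by sums of squares.\<close>

lemma sobolev_laplacian_product_integrable:
  fixes u :: "real^'n::finite \<Rightarrow> complex"
  assumes u: "u \<in> sobolev 2 2"
  shows "integrable lebesgue (\<lambda>x. norm (laplacian u x) * norm (u x))"
proof -
  have sq: "integrable lebesgue (\<lambda>x. (norm (f x))\<^sup>2)" if "f \<in> Lp_space 2" for f :: "real^'n \<Rightarrow> complex"
    using that by (simp add: Lp_space_def powr_numeral)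
  have "\<exists>g\<in>Lp_space 2. is_weak_deriv [i, i] u g" for i
    using u by (auto simp: sobolev_def)
  then obtain g where g: "\<And>i. g i \<in> Lp_space 2" "\<And>i. is_weak_deriv [i, i] u (g i)"
    by metis
  have "AE x in lebesgue. \<forall>i\<in>UNIV. weak_deriv [i, i] u x = g i x"
    using weak_deriv_unique[OF is_weak_deriv_weak_deriv[OF u] g(2)]
    by (intro AE_finite_allI) auto
  then have L: "AE x in lebesgue. laplacian u x = (\<Sum>i\<in>UNIV. g i x)"
    by eventually_elim (simp add: laplacian_def)
  have u2: "u \<in> Lp_space 2" using u by (simp add: sobolev_def)
  have um: "u \<in> borel_measurable lebesgue" using u2 by (simp add: Lp_space_def)
  have Lm: "laplacian u \<in> borel_measurable lebesgue"
    by (rule locally_integrable_measurable[OF laplacian_locally_integrable[OF u]])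
  show ?thesis
  proof (rule Bochner_Integration.integrable_bound)
    show "integrable lebesgue (\<lambda>x. \<Sum>i\<in>(UNIV::'n set). ((norm (g i x))\<^sup>2 + (norm (u x))\<^sup>2))"
      by (intro Bochner_Integration.integrable_sum Bochner_Integration.integrable_add sq g u2)
    show "(\<lambda>x. norm (laplacian u x) * norm (u x)) \<in> borel_measurable lebesgue"
      using um Lm by measurable
    show "AE x in lebesgue. norm (norm (laplacian u x) * norm (u x)) \<le>
      norm (\<Sum>i\<in>(UNIV::'n set). ((norm (g i x))\<^sup>2 + (norm (u x))\<^sup>2))"
      using L
    proof eventually_elim
      case (elim x)
      have "norm (laplacian u x) * norm (u x) \<le> (\<Sum>i\<in>UNIV. norm (g i x)) * norm (u x)"
        unfolding elim by (intro mult_right_mono norm_sum) auto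
      also have "\<dots> = (\<Sum>i\<in>UNIV. norm (g i x) * norm (u x))" by (rule sum_distrib_right)
      also have "\<dots> \<le> (\<Sum>i\<in>(UNIV::'n set). ((norm (g i x))\<^sup>2 + (norm (u x))\<^sup>2))"
      proof (rule sum_mono)
        fix i
        have "norm (g i x) * norm (u x) \<ge> 0" by simp
        then show "norm (g i x) * norm (u x) \<le> (norm (g i x))\<^sup>2 + (norm (u x))\<^sup>2"
          using sum_squares_bound[of "norm (g i x)" "norm (u x)"] by linarith
      qed
      finally show ?case by (simp add: sum_nonneg)
    qed
  qed
qed

text \<open>In the constant, n (n - 2) comes from \<open>laplacian_newton_reg\<close>,
  \<open>mollifier_const\<close> compensates for the missing normalisation of the bump, and 2 is
  lost between real and imaginary parts and the modulus.\<close>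

lemma norm_le_newton_potential:
  fixes u :: "real^'n::finite \<Rightarrow> complex"
  assumes n: "CARD('n) \<ge> 3" and r: "0 < r" "r \<le> 1 / 2" and u: "u \<in> sobolev 2 p"
    and u0: "AE x in lebesgue. x \<notin> ball a r \<longrightarrow> u x = 0"
    and g: "integrable lebesgue g" "\<And>x. g x \<ge> 0" "\<And>x. x \<notin> ball a r \<Longrightarrow> g x = 0"
    and gL: "AE x in lebesgue. norm (laplacian u x) = g x"
  shows "AE x in lebesgue. ennreal (norm (u x)) \<le>
    ennreal (2 / mollifier_const TYPE('n) / (real CARD('n) * (real CARD('n) - 2))) *
    (\<integral>\<^sup>+y. ennreal (g y / norm (x - y) ^ (CARD('n) - 2)) \<partial>lebesgue)"
proof -
  define q where "q = CARD('n) - 2"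
  define c where "c = real CARD('n) * (real CARD('n) - 2)"
  define \<kappa> where "\<kappa> = mollifier_const TYPE('n)"
  have c: "c > 0" using n by (simp add: c_def)
  have \<kappa>: "\<kappa> > 0" unfolding \<kappa>_def by (rule mollifier_const_pos)
  define B where "B = ball a r"
  have [measurable]: "B \<in> sets lebesgue" by (simp add: B_def)
  have gm [measurable]: "g \<in> borel_measurable lebesgue" using g by auto
  define v where "v = (\<lambda>x. indicator B x *\<^sub>R u x)"
  have "is_weak_deriv [] u (weak_deriv [] u)"
    by (rule is_weak_deriv_weak_deriv[OF u]) simp
  then have u_loc: "locally_integrable u" by (simp add: is_weak_deriv_def)
  have "set_integrable lebesgue (cball a r) u"
    using u_loc compact_cball[of a r] unfolding locally_integrable_def by blast
  then have "set_integrable lebesgue B u"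
    by (rule set_integrable_subset) (auto simp: B_def)
  then have v: "integrable lebesgue v" by (simp add: v_def set_integrable_def)
  have v0: "v x = 0" if "x \<notin> ball a r" for x using that by (simp add: v_def B_def)
  have uv: "AE x in lebesgue. u x = v x"
    using u0 by eventually_elim (auto simp: v_def B_def split: split_indicator)
  define P where "P = (\<lambda>x. \<integral>\<^sup>+y. ennreal (g y / norm (x - y) ^ q) \<partial>lebesgue)"
  have km: "(\<lambda>(x, y). ennreal (g y / norm (x - y) ^ q)) \<in> borel_measurable (lebesgue \<Otimes>\<^sub>M lebesgue)"
  proof -
    have "(\<lambda>(x, y). norm (x - y) :: real) \<in> borel_measurable (lebesgue \<Otimes>\<^sub>M (lebesgue :: (real^'n) measure))"
      by (rule measurable_lebesgue_pair) (simp add: case_prod_beta borel_measurable_continuous_onI continuous_intros)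
    note [measurable] = this
    have "(\<lambda>(x, y). ennreal (g y / (case (x, y) of (x, y) \<Rightarrow> norm (x - y)) ^ q)) \<in> borel_measurable (lebesgue \<Otimes>\<^sub>M lebesgue)"
      by measurable
    then show ?thesis by simp
  qed
  have Pm [measurable]: "P \<in> borel_measurable lebesgue"
    unfolding P_def by (rule lebesgue.borel_measurable_nn_integral[OF km])
  \<comment> \<open>\<open>AE_norm_le_if_mollified_le\<close> asks for an integrable real majorant.
    Tonelli reduces the integral of the potential over the ball to the kernel bound, uniform in y,
    times the integral of g.\<close>
  have P_fin: "(\<integral>\<^sup>+x. P x * indicator B x \<partial>lebesgue) < \<infinity>"
  proof -
    obtain D where D: "D < (\<infinity>::ennreal)"
      "\<And>y. y \<in> ball a r \<Longrightarrow> (\<integral>\<^sup>+x. ennreal (1 / norm (x - y) ^ (CARD('n) - 2)) * indicator (ball a r) x \<partial>lebesgue) \<le> D"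
      using newton_kernel_locally_integrable[OF n r(2)] by blast
    have kx: "(\<lambda>(x, y). ennreal (g y / norm (x - y) ^ q) * indicator B x) \<in> borel_measurable (lebesgue \<Otimes>\<^sub>M lebesgue)"
    proof -
      note km[measurable]
      have "(\<lambda>(x, y). (case (x, y) of (x, y) \<Rightarrow> ennreal (g y / norm (x - y) ^ q)) * indicator B x) \<in> borel_measurable (lebesgue \<Otimes>\<^sub>M lebesgue)"
        by measurable
      then show ?thesis by simp
    qed
    have ky: "(\<lambda>x. ennreal (1 / norm (x - y) ^ q) * indicator B x) \<in> borel_measurable lebesgue" for y
    proof -
      have "(\<lambda>x. norm (x - y)) \<in> borel_measurable lebesgue"
        by (rule measurable_completion) (simp add: borel_measurable_continuous_onI continuous_intros)
      note [measurable] = this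
      show ?thesis by measurable
    qed
    have "(\<integral>\<^sup>+x. P x * indicator B x \<partial>lebesgue) = (\<integral>\<^sup>+x. \<integral>\<^sup>+y. ennreal (g y / norm (x - y) ^ q) * indicator B x \<partial>lebesgue \<partial>lebesgue)"
      unfolding P_def using measurable_Pair2[OF km]
      by (intro nn_integral_cong nn_integral_multc[symmetric]) simp
    also have "\<dots> = (\<integral>\<^sup>+y. \<integral>\<^sup>+x. ennreal (g y / norm (x - y) ^ q) * indicator B x \<partial>lebesgue \<partial>lebesgue)"
      using lebesgue_pair.Fubini[OF kx] by simp
    also have "\<dots> \<le> (\<integral>\<^sup>+y. ennreal (g y) * D \<partial>lebesgue)"
    proof (rule nn_integral_mono)
      fix y
      have "(\<integral>\<^sup>+x. ennreal (g y / norm (x - y) ^ q) * indicator B x \<partial>lebesgue) =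
          (\<integral>\<^sup>+x. ennreal (g y) * (ennreal (1 / norm (x - y) ^ q) * indicator B x) \<partial>lebesgue)"
      proof (rule nn_integral_cong)
        fix x
        have "ennreal (g y / norm (x - y) ^ q) = ennreal (g y) * ennreal (1 / norm (x - y) ^ q)"
          using g(2)[of y] by (subst ennreal_mult[symmetric]) auto
        then show "ennreal (g y / norm (x - y) ^ q) * indicator B x = ennreal (g y) * (ennreal (1 / norm (x - y) ^ q) * indicator B x)"
          by (simp only: mult.assoc)
      qed
      also have "\<dots> = ennreal (g y) * (\<integral>\<^sup>+x. ennreal (1 / norm (x - y) ^ q) * indicator B x \<partial>lebesgue)"
        by (rule nn_integral_cmult[OF ky])
      also have "\<dots> \<le> ennreal (g y) * D"
      proof (cases "y \<in> ball a r")
        case True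
        then show ?thesis using D(2)[of y] by (intro mult_left_mono) (auto simp: B_def q_def)
      qed (simp add: g(3))
      finally show "(\<integral>\<^sup>+x. ennreal (g y / norm (x - y) ^ q) * indicator B x \<partial>lebesgue) \<le> ennreal (g y) * D" .
    qed
    also have "\<dots> = ennreal (LINT x|lebesgue. g x) * D"
      using nn_integral_eq_integral[OF g(1)] g(2) by (simp add: nn_integral_multc)
    also have "\<dots> < \<infinity>" using D(1) by (simp add: ennreal_mult_less_top)
    finally show ?thesis .
  qed
  then have "AE x in lebesgue. P x * indicator B x \<noteq> \<infinity>"
    by (intro nn_integral_PInf_AE) auto
  then have P_AE: "AE x in lebesgue. x \<in> B \<longrightarrow> P x < \<infinity>"
    by eventually_elim (auto simp: less_top)
  \<comment> \<open>\<open>enn2real\<close> sends the value infinity to 0; by \<open>P_AE\<close>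
    this concerns only a null subset of the ball.\<close>
  define w where "w = (\<lambda>x. enn2real (P x * indicator B x) / c)"
  have w_int: "integrable lebesgue w"
    unfolding w_def
  proof (intro integrable_divide_zero, rule integrableI_bounded)
    have "(\<integral>\<^sup>+x. ennreal (norm (enn2real (P x * indicator B x))) \<partial>lebesgue) \<le> (\<integral>\<^sup>+x. P x * indicator B x \<partial>lebesgue)"
      by (intro nn_integral_mono) (simp add: ennreal_enn2real_if)
    then show "(\<integral>\<^sup>+x. ennreal (norm (enn2real (P x * indicator B x))) \<partial>lebesgue) < \<infinity>"
      using P_fin by (rule le_less_trans)
  qed measurable
  have "AE x in lebesgue. x \<in> ball a r \<longrightarrow> norm (v x) \<le> 2 / mollifier_const TYPE('n) * w x"
  proof (rule AE_norm_le_if_mollified_le[OF r(1) v v0 w_int])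
    show "w x \<ge> 0" for x using c by (simp add: w_def)
    show "AE x in lebesgue. x \<in> ball a r \<longrightarrow> (\<forall>e>0. norm (LINT y|lebesgue. mollifier e (y - x) *\<^sub>R v y) \<le> w x)"
      using P_AE
    proof eventually_elim
      case (elim x)
      show ?case
      proof (intro impI allI)
        fix e :: real assume x: "x \<in> ball a r" and e: "e > 0"
        then have fin: "P x < \<infinity>" using elim by (simp add: B_def)
        have "ennreal (c * norm (LINT y|lebesgue. mollifier e (y - x) *\<^sub>R v y)) \<le>
          (\<integral>\<^sup>+y. ennreal (norm (laplacian u y) / norm (x - y) ^ q) \<partial>lebesgue)"
          unfolding c_def q_def by (rule mollified_le_newton_potential[OF n r(1) e u v v0 uv])
        also have "\<dots> = P x"
          unfolding P_def by (rule nn_integral_cong_AE) (use gL in eventually_elim, simp)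
        also have "\<dots> = ennreal (enn2real (P x))"
          using fin by simp
        finally have "c * norm (LINT y|lebesgue. mollifier e (y - x) *\<^sub>R v y) \<le> enn2real (P x)"
          by (simp add: ennreal_le_iff)
        then show "norm (LINT y|lebesgue. mollifier e (y - x) *\<^sub>R v y) \<le> w x"
          using c x by (simp add: w_def B_def pos_le_divide_eq mult.commute)
      qed
    qed
  qed
  with P_AE uv show ?thesis
  proof eventually_elim
    case (elim x)
    show ?case
    proof (cases "x \<in> B")
      case True
      then have fin: "P x < \<infinity>" using elim by simp
      have "norm (u x) \<le> 2 / \<kappa> * (enn2real (P x) / c)"
        using elim True by (simp add: B_def w_def \<kappa>_def)
      also have "\<dots> = 2 / \<kappa> / c * enn2real (P x)" by simp
      finally have "ennreal (norm (u x)) \<le> ennreal (2 / \<kappa> / c * enn2real (P x))" by (rule ennreal_leI)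
      also have "\<dots> = ennreal (2 / \<kappa> / c) * P x"
        using fin \<kappa> c by (subst ennreal_mult) auto
      finally show ?thesis by (simp only: P_def \<kappa>_def c_def q_def)
    qed (use elim in \<open>simp add: v_def\<close>)
  qed
qed

text \<open>Both r0 and C are chosen before r, a, V and u, hence depend on the dimension alone. The
  zero solution has to be excluded: together with V = 0 it satisfies all other hypotheses while the
  norm is 0.\<close>

theorem theorem1p1:
  assumes "CARD('n::finite) \<ge> 3"
  shows "\<exists>r0>0. \<exists>C>0. \<forall>(r::real) (a::real^'n) (V::real^'n \<Rightarrow> complex) (u::real^'n \<Rightarrow> complex).
           0 < r \<longrightarrow> r < r0 \<longrightarrow>
           u \<in> sobolev 2 2 \<longrightarrow>
           \<not> (AE x in lebesgue. u x = 0) \<longrightarrow>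
           (AE x in lebesgue. norm (laplacian u x) \<le> norm (V x * u x)) \<longrightarrow>
           ess_support u \<subseteq> ball a r \<longrightarrow>
           restrict_fun (ball a r) V \<in> KS_class \<longrightarrow>
           ks_norm (restrict_fun (ball a r) V) \<ge> ennreal C"
proof -
  define q where "q = CARD('n) - 2"
  define c where "c = 2 / mollifier_const TYPE('n) / (real CARD('n) * (real CARD('n) - 2))"
  \<comment> \<open>The factor of the potential bound times that of
    \<open>kerman_sawyer_energy_bound\<close> with K taken out: a norm of at most K gives X \<le> D
    K X. The next line picks a positive C with D C < 1.\<close>
  define D where "D = c * (2 ^ q * (real (card (neighbors (0 :: int^'n))) * (4 * (2 * real CARD('n) ^ q))))"
  define C where "C = 1 / (2 * (D + 1))"
  have c: "c > 0" using assms mollifier_const_pos[where 'n='n] by (simp add: c_def)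
  then have D: "D \<ge> 0" by (simp add: D_def)
  then have C: "C > 0" "D * C < 1" by (simp_all add: C_def field_simps)
  have main: "ks_norm (restrict_fun (ball a r) V) \<ge> ennreal C"
    if r: "0 < r" "r < 1 / 2" and u: "u \<in> sobolev 2 2" and nz: "\<not> (AE x in lebesgue. u x = 0)"
      and eq: "AE x in lebesgue. norm (laplacian u x) \<le> norm (V x * u x)"
      and supp: "ess_support u \<subseteq> ball a r" and KS: "restrict_fun (ball a r) V \<in> KS_class"
    for r :: real and a :: "real^'n" and V u :: "real^'n \<Rightarrow> complex"
  proof (rule ccontr)
    define B where "B = ball a r"
    have [measurable]: "B \<in> sets lebesgue" by (simp add: B_def)
    define V' where "V' = restrict_fun (ball a r) V"
    assume "\<not> ks_norm (restrict_fun (ball a r) V) \<ge> ennreal C"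
    then have K: "ks_norm V' \<le> ennreal C" by (simp add: V'_def)
    have Vm: "V' \<in> borel_measurable lebesgue" using KS by (simp add: V'_def KS_class_def)
    have V0: "V' x = 0" if "x \<notin> ball a r" for x using that by (simp add: V'_def restrict_fun_def)
    have VB: "V' x = V x" if "x \<in> ball a r" for x using that by (simp add: V'_def restrict_fun_def)
    have u0: "AE x in lebesgue. x \<notin> ball a r \<longrightarrow> u x = 0"
      by (rule AE_zero_outside_ess_support[OF supp])
    define g where "g = (\<lambda>x. indicator B x * norm (laplacian u x))"
    define h where "h = (\<lambda>x. g x * norm (u x))"
    have g0: "g x \<ge> 0" for x by (simp add: g_def)
    have gB: "g x = 0" if "x \<notin> ball a r" for x using that by (simp add: g_def B_def)
    have h0: "h x \<ge> 0" for x by (simp add: h_def g0)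
    \<comment> \<open>Off the ball u = 0 almost everywhere, so the differential inequality forces
      the Laplacian to vanish there, whatever the values of V.\<close>
    have gL: "AE x in lebesgue. norm (laplacian u x) = g x"
      using u0 eq by eventually_elim (auto simp: g_def B_def split: split_indicator)
    have g_int: "integrable lebesgue g"
    proof -
      have "set_integrable lebesgue (cball a r) (laplacian u)"
        using laplacian_locally_integrable[OF u] compact_cball[of a r] unfolding locally_integrable_def by blast
      then have "set_integrable lebesgue B (laplacian u)"
        by (rule set_integrable_subset) (auto simp: B_def)
      then have "integrable lebesgue (\<lambda>x. norm (indicator B x *\<^sub>R laplacian u x))"
        unfolding set_integrable_def by (rule integrable_norm)
      then show ?thesis by (simp add: g_def)
    qed
    have h_int: "integrable lebesgue h"
      using integrable_mult_indicator[OF \<open>B \<in> sets lebesgue\<close> sobolev_laplacian_product_integrable[OF u]]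
      by (simp add: h_def g_def mult.assoc)
    have gh: "AE x in lebesgue. (g x)\<^sup>2 \<le> norm (V' x) * h x"
      using eq
    proof eventually_elim
      case (elim x)
      show ?case
      proof (cases "x \<in> ball a r")
        case True
        then have "g x \<le> norm (V' x) * norm (u x)"
          using elim by (simp add: g_def B_def VB norm_mult)
        from mult_left_mono[OF this g0[of x]] show ?thesis
          by (simp add: h_def power2_eq_square mult.left_commute)
      qed (simp add: gB h_def)
    qed
    define P where "P = (\<lambda>x. \<integral>\<^sup>+y. ennreal (g y / norm (x - y) ^ q) \<partial>lebesgue)"
    have uP: "AE x in lebesgue. ennreal (norm (u x)) \<le> ennreal c * P x"
      unfolding c_def P_def q_def
      by (rule norm_le_newton_potential[OF assms r(1) less_imp_le[OF r(2)] u u0 g_int g0 gB gL])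
    have gm [measurable]: "g \<in> borel_measurable lebesgue" using g_int by auto
    have energy: "(\<integral>\<^sup>+x. \<integral>\<^sup>+y. ennreal (g x * g y / norm (x - y) ^ q) \<partial>lebesgue \<partial>lebesgue) \<le>
      ennreal (2 ^ q * (real (card (neighbors (0 :: int^'n))) * (4 * (2 * real CARD('n) ^ q * C) * (LINT x|lebesgue. h x))))"
      unfolding q_def
      by (rule kerman_sawyer_energy_bound[OF assms less_imp_le[OF r(2)] Vm V0 K C(1) g_int g0 gB h_int h0 _ gh])
         (auto simp: h_def gB)
    have kern: "ennreal (g x) * P x = (\<integral>\<^sup>+y. ennreal (g x * g y / norm (x - y) ^ q) \<partial>lebesgue)" for x
    proof -
      have [measurable]: "(\<lambda>y. norm (x - y)) \<in> borel_measurable lebesgue"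
        by (rule measurable_completion) (simp add: borel_measurable_continuous_onI continuous_intros)
      have "ennreal (g x) * P x = (\<integral>\<^sup>+y. ennreal (g x) * ennreal (g y / norm (x - y) ^ q) \<partial>lebesgue)"
        unfolding P_def by (rule nn_integral_cmult[symmetric]) measurable
      then show ?thesis by (simp add: g0 ennreal_mult[symmetric])
    qed
    have "ennreal (LINT x|lebesgue. h x) = (\<integral>\<^sup>+x. ennreal (h x) \<partial>lebesgue)"
      using nn_integral_eq_integral[OF h_int] h0 by simp
    also have "\<dots> \<le> (\<integral>\<^sup>+x. ennreal c * (\<integral>\<^sup>+y. ennreal (g x * g y / norm (x - y) ^ q) \<partial>lebesgue) \<partial>lebesgue)"
    proof (rule nn_integral_mono_AE)
      show "AE x in lebesgue. ennreal (h x) \<le> ennreal c * (\<integral>\<^sup>+y. ennreal (g x * g y / norm (x - y) ^ q) \<partial>lebesgue)"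
        using uP
      proof eventually_elim
        case (elim x)
        have "ennreal (h x) = ennreal (g x) * ennreal (norm (u x))" by (simp add: h_def ennreal_mult g0)
        also have "\<dots> \<le> ennreal (g x) * (ennreal c * P x)" using elim by (rule mult_left_mono) simp
        also have "\<dots> = ennreal c * (ennreal (g x) * P x)" by (rule mult.left_commute)
        finally show ?case by (simp only: kern)
      qed
    qed
    also have "\<dots> = ennreal c * (\<integral>\<^sup>+x. \<integral>\<^sup>+y. ennreal (g x * g y / norm (x - y) ^ q) \<partial>lebesgue \<partial>lebesgue)"
    proof (rule nn_integral_cmult)
      have "(\<lambda>(x, y). norm (x - y) :: real) \<in> borel_measurable (lebesgue \<Otimes>\<^sub>M (lebesgue :: (real^'n) measure))"
        by (rule measurable_lebesgue_pair) (simp add: case_prod_beta borel_measurable_continuous_onI continuous_intros)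
      note [measurable] = this
      have "(\<lambda>(x, y). ennreal (g x * g y / (case (x, y) of (x, y) \<Rightarrow> norm (x - y)) ^ q)) \<in> borel_measurable (lebesgue \<Otimes>\<^sub>M lebesgue)"
        by measurable
      then have "(\<lambda>(x, y). ennreal (g x * g y / norm (x - y) ^ q)) \<in> borel_measurable (lebesgue \<Otimes>\<^sub>M lebesgue)" by simp
      then show "(\<lambda>x. \<integral>\<^sup>+y. ennreal (g x * g y / norm (x - y) ^ q) \<partial>lebesgue) \<in> borel_measurable lebesgue"
        by (rule lebesgue.borel_measurable_nn_integral)
    qed
    also have "\<dots> \<le> ennreal c * ennreal (2 ^ q * (real (card (neighbors (0 :: int^'n))) * (4 * (2 * real CARD('n) ^ q * C) * (LINT x|lebesgue. h x))))"
      using energy by (rule mult_left_mono) simp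
    also have "\<dots> = ennreal (D * C * (LINT x|lebesgue. h x))"
      using c by (subst ennreal_mult'[symmetric]) (simp_all add: D_def mult_ac)
    \<comment> \<open>The absorption: with X real and D C < 1, this leaves only X = 0.\<close>
    finally have "(LINT x|lebesgue. h x) \<le> D * C * (LINT x|lebesgue. h x)"
      using D C h0 by (subst (asm) ennreal_le_iff) (auto intro!: mult_nonneg_nonneg integral_nonneg_AE)
    moreover have hpos: "(LINT x|lebesgue. h x) \<ge> 0" using h0 by (intro integral_nonneg_AE) auto
    ultimately have "(LINT x|lebesgue. h x) = 0"
      using mult_strict_right_mono[OF C(2), of "LINT x|lebesgue. h x"] by linarith
    then have "AE x in lebesgue. h x = 0"
      using integral_nonneg_eq_0_iff_AE[OF h_int] h0 by auto
    \<comment> \<open>Where the product h vanishes, either g = 0 or u = 0, and in the second case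
      the differential inequality again gives g = 0.\<close>
    then have "AE x in lebesgue. g x = 0"
      using eq by eventually_elim (auto simp: h_def g_def)
    then have "AE y in lebesgue. ennreal (g y / norm (x - y) ^ q) = 0" for x
      by eventually_elim simp
    from nn_integral_cong_AE[OF this] have P0: "P x = 0" for x
      by (simp add: P_def)
    have "AE x in lebesgue. u x = 0"
      using uP by eventually_elim (simp add: P0)
    then show False using nz by simp
  qed
  show ?thesis
    using C(1) main by (intro exI[of _ "1/2"] conjI exI[of _ C]) auto
qed

end
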